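(* In the setting of the context, assume that $(V_n)$ has a finite moment of order $4$. Then $$\sqrt{n}\,(\widehat{D}_n-D^{*})\xrightarrow{\ \mathcal{L}\ }\mathcal{N}(0,\sigma_D^2)$$ (convergence in distribution), where $D^{*}=2(1-\rho^{*})$ and $\sigma_D^2=4\sigma_\rho^2$ with $$\sigma_\rho^2=P_L'\Delta_pP_L-2\alpha^{-1}\theta_p^{*}(\Lambda_p^1)'J_pP_L+(\alpha^{-1}\theta_p^{*})^2\lambda_0.$$
   Context: Let $p\ge 1$ be an integer, $\theta=(\theta_1,\dots,\theta_p)'\in\mathbb{R}^p$ a nonzero vector with $\|\theta\|_1=\sum_i|\theta_i|<1$ and $\rho\in\mathbb{R}$ with $|\rho|<1$. A prime denotes transposition. The process is given, for all $n\ge1$, by $$X_n=\theta_1X_{n-1}+\cdots+\theta_pX_{n-p}+\varepsilon_n,\qquad \varepsilon_n=\rho\,\varepsilon_{n-1}+V_n,$$ with square-integrable initial value $X_0=\varepsilon_0$ and $X_{-1}=\cdots=X_{-p}=0$, where $(V_n)$ is a sequence of square-integrable, independent and identically distributed random variables with zero mean and variance $\sigma^2>0$. Let $\Phi_n^p=(X_n,X_{n-1},\dots,X_{n-p+1})'$ and $S_n=\sum_{k=0}^n\Phi_k^p(\Phi_k^p)'+S$, where $S$ is a fixed symmetric positive definite $p\times p$ matrix. The least squares estimator of $\theta$ is $\widehat{\theta}_n=(S_{n-1})^{-1}\sum_{k=1}^n\Phi_{k-1}^pX_k$, $n\ge1$. At stage $n$ the residuals are $\widehat{\varepsilon}_0=X_0$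 and $\widehat{\varepsilon}_k=X_k-\widehat{\theta}_n'\Phi_{k-1}^p$ for $1\le k\le n$ (they depend on $n$). The Durbin-Watson statistic is, for $n\ge1$, $$\widehat{D}_n=\Bigl(\sum_{k=0}^n\widehat{\varepsilon}_k^{\,2}\Bigr)^{-1}\sum_{k=1}^n(\widehat{\varepsilon}_k-\widehat{\varepsilon}_{k-1})^2.$$ $I_p$ is the identity matrix, $J_p$ the exchange matrix of order $p$ (ones on the antidiagonal, zeros elsewhere), and $e=(1,0,\dots,0)'\in\mathbb{R}^p$. Put $$\alpha=\frac{1}{(1-\theta_p\rho)(1+\theta_p\rho)},\qquad \beta=(\beta_1,\dots,\beta_p)'=(\theta_1+\rho,\ \theta_2-\theta_1\rho,\ \dots,\ \theta_p-\theta_{p-1}\rho)',$$ $\theta^{*}=\alpha(I_p-\theta_p\rho J_p)\beta$, with $p$-th component $\theta_p^{*}$, and $\rho^{*}=\theta_p\rho\,\theta_p^{*}$. Set $a_0=1$, $a_i=-\beta_i$ for $1\le i\le p$, $a_{p+1}=\theta_p\rho$, and $a_i=0$ for all other integers $i$. Let $B$ be the square matrix of order $p+2$ with rows and columns indexed by $0,\dots,p+1$ and entries $B_{d,0}=a_d$ and $B_{d,j}=a_{d-j}+a_{d+j}$ for $1\le j\le p+1$. Under the stability conditions $\|\theta\|_1<1$ and $|\rho|<1$, $B$ is invertible; let $\Lambda=(\lambda_0,\dots,\lambda_{p+1})'$ be the unique solution of $B\Lambda=(1,0,\dots,0)'$. Let $\Delta_p=(\lambda_{|i-j|})_{1\le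 i,j\le p}$ (it is positive definite), $\Lambda_p^1=(\lambda_1,\dots,\lambda_p)'$ and $$P_L=J_p(I_p-\theta_p\rho J_p)\bigl(\alpha\theta_p\rho\,\Delta_p^{-1}e+\theta_p^{*}\beta\bigr).$$ *)

theory Defs
  imports "HOL-Probability.Probability" "Jordan_Normal_Form.Gauss_Jordan_Elimination"
begin

unbundle no vec_syntax
unbundle no inner_syntax

text \<open>
  Vectors and matrices are those of \<open>Jordan_Normal_Form\<close>, with the order \<open>p\<close> an explicit argument.
  They are indexed from 0, so the component \<open>\<theta>\<^sub>i\<close> with \<open>1 \<le> i \<le> p\<close> is \<open>\<theta> $ (i - 1)\<close>; only the
  vector \<open>\<Lambda>\<close> and the matrix \<open>B\<close>, both of order \<open>p + 2\<close>, are indexed from 0 to begin with.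
\<close>

text \<open>The library inverse is an option; the value on singular matrices is unspecified.\<close>

definition mat_inv :: "real mat \<Rightarrow> real mat" where
  "mat_inv A = the (mat_inverse A)"

definition sym_pos_def :: "nat \<Rightarrow> real mat \<Rightarrow> bool" where
  "sym_pos_def p S \<longleftrightarrow> S \<in> carrier_mat p p \<and> transpose_mat S = S \<and>
     (\<forall>x\<in>carrier_vec p. x \<noteq> 0\<^sub>v p \<longrightarrow> 0 < x \<bullet> (S *\<^sub>v x))"

definition exchange_mat :: "nat \<Rightarrow> real mat" where
  "exchange_mat p = mat p p (\<lambda>(i, j). if i + j + 1 = p then 1 else 0)"

text \<open>The one-dimensional normal law with mean \<open>m\<close> and variance \<open>v \<ge> 0\<close>. The case \<open>v = 0\<close> is the
  Dirac mass at \<open>m\<close>; it is treated apart because \<^const>\<open>normal_density\<close> vanishes identically for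
  standard deviation 0. It does occur as a limit below, for instance when \<open>\<theta>\<^sub>p = 0\<close> and \<open>\<rho> = 0\<close>.\<close>

definition normal_law :: "real \<Rightarrow> real \<Rightarrow> real measure" where
  "normal_law m v =
     (if v = 0 then return borel m else density lborel (\<lambda>x. ennreal (normal_density m (sqrt v) x)))"


subsection \<open>The estimator and the Durbin-Watson statistic\<close>

text \<open>These are functions of one trajectory \<open>x\<close> of the process, with time ranging over the integers
  so that the initial values at negative times are included.\<close>

definition Phi :: "nat \<Rightarrow> (int \<Rightarrow> real) \<Rightarrow> int \<Rightarrow> real vec" where
  "Phi p x n = vec p (\<lambda>i. x (n - int i))"

definition S_mat :: "nat \<Rightarrow> real mat \<Rightarrow> (int \<Rightarrow> real) \<Rightarrow> nat \<Rightarrow> real mat" where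
  "S_mat p S x n =
     mat p p (\<lambda>(i, j). \<Sum>k=0..n. Phi p x (int k) $ i * Phi p x (int k) $ j) + S"

definition theta_hat :: "nat \<Rightarrow> real mat \<Rightarrow> (int \<Rightarrow> real) \<Rightarrow> nat \<Rightarrow> real vec" where
  "theta_hat p S x n =
     mat_inv (S_mat p S x (n - 1)) *\<^sub>v
       vec p (\<lambda>i. \<Sum>k=1..n. Phi p x (int k - 1) $ i * x (int k))"

definition residual :: "nat \<Rightarrow> real mat \<Rightarrow> (int \<Rightarrow> real) \<Rightarrow> nat \<Rightarrow> nat \<Rightarrow> real" where
  "residual p S x n k =
     (if k = 0 then x 0 else x (int k) - theta_hat p S x n \<bullet> Phi p x (int k - 1))"

definition durbin_watson :: "nat \<Rightarrow> real mat \<Rightarrow> (int \<Rightarrow> real) \<Rightarrow> nat \<Rightarrow> real" where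
  "durbin_watson p S x n =
     inverse (\<Sum>k=0..n. (residual p S x n k)\<^sup>2) *
     (\<Sum>k=1..n. (residual p S x n k - residual p S x n (k - 1))\<^sup>2)"


subsection \<open>The limiting quantities\<close>

definition theta_last :: "nat \<Rightarrow> real vec \<Rightarrow> real" where
  "theta_last p \<theta> = \<theta> $ (p - 1)"

definition alpha :: "nat \<Rightarrow> real vec \<Rightarrow> real \<Rightarrow> real" where
  "alpha p \<theta> \<rho> = 1 / ((1 - theta_last p \<theta> * \<rho>) * (1 + theta_last p \<theta> * \<rho>))"

definition beta :: "nat \<Rightarrow> real vec \<Rightarrow> real \<Rightarrow> real vec" where
  "beta p \<theta> \<rho> = vec p (\<lambda>i. if i = 0 then \<theta> $ 0 + \<rho> else \<theta> $ i - \<theta> $ (i - 1) * \<rho>)"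

definition theta_star :: "nat \<Rightarrow> real vec \<Rightarrow> real \<Rightarrow> real vec" where
  "theta_star p \<theta> \<rho> =
     alpha p \<theta> \<rho> \<cdot>\<^sub>v
       ((1\<^sub>m p - (theta_last p \<theta> * \<rho>) \<cdot>\<^sub>m exchange_mat p) *\<^sub>v beta p \<theta> \<rho>)"

definition theta_star_last :: "nat \<Rightarrow> real vec \<Rightarrow> real \<Rightarrow> real" where
  "theta_star_last p \<theta> \<rho> = theta_star p \<theta> \<rho> $ (p - 1)"

definition rho_star :: "nat \<Rightarrow> real vec \<Rightarrow> real \<Rightarrow> real" where
  "rho_star p \<theta> \<rho> = theta_last p \<theta> * \<rho> * theta_star_last p \<theta> \<rho>"

definition a_coeff :: "nat \<Rightarrow> real vec \<Rightarrow> real \<Rightarrow> int \<Rightarrow> real" where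
  "a_coeff p \<theta> \<rho> i =
     (if i = 0 then 1
      else if 1 \<le> i \<and> i \<le> int p then - (beta p \<theta> \<rho> $ (nat i - 1))
      else if i = int p + 1 then theta_last p \<theta> * \<rho>
      else 0)"

definition B_mat :: "nat \<Rightarrow> real vec \<Rightarrow> real \<Rightarrow> real mat" where
  "B_mat p \<theta> \<rho> = mat (p + 2) (p + 2)
     (\<lambda>(d, j). if j = 0 then a_coeff p \<theta> \<rho> (int d)
               else a_coeff p \<theta> \<rho> (int d - int j) + a_coeff p \<theta> \<rho> (int d + int j))"

definition Lambda :: "nat \<Rightarrow> real vec \<Rightarrow> real \<Rightarrow> real vec" where
  "Lambda p \<theta> \<rho> =
     (THE L. L \<in> carrier_vec (p + 2) \<and> B_mat p \<theta> \<rho> *\<^sub>v L = unit_vec (p + 2) 0)"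

definition Delta :: "nat \<Rightarrow> real vec \<Rightarrow> real \<Rightarrow> real mat" where
  "Delta p \<theta> \<rho> = mat p p (\<lambda>(i, j). Lambda p \<theta> \<rho> $ nat \<bar>int i - int j\<bar>)"

definition Lambda1 :: "nat \<Rightarrow> real vec \<Rightarrow> real \<Rightarrow> real vec" where
  "Lambda1 p \<theta> \<rho> = vec p (\<lambda>i. Lambda p \<theta> \<rho> $ (i + 1))"

definition P_L :: "nat \<Rightarrow> real vec \<Rightarrow> real \<Rightarrow> real vec" where
  "P_L p \<theta> \<rho> =
     (exchange_mat p * (1\<^sub>m p - (theta_last p \<theta> * \<rho>) \<cdot>\<^sub>m exchange_mat p)) *\<^sub>v
       ((alpha p \<theta> \<rho> * theta_last p \<theta> * \<rho>) \<cdot>\<^sub>v (mat_inv (Delta p \<theta> \<rho>) *\<^sub>v unit_vec p 0)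
        + theta_star_last p \<theta> \<rho> \<cdot>\<^sub>v beta p \<theta> \<rho>)"

definition sigma2_rho :: "nat \<Rightarrow> real vec \<Rightarrow> real \<Rightarrow> real" where
  "sigma2_rho p \<theta> \<rho> =
     P_L p \<theta> \<rho> \<bullet> (Delta p \<theta> \<rho> *\<^sub>v P_L p \<theta> \<rho>)
     - 2 * inverse (alpha p \<theta> \<rho>) * theta_star_last p \<theta> \<rho>
         * (Lambda1 p \<theta> \<rho> \<bullet> (exchange_mat p *\<^sub>v P_L p \<theta> \<rho>))
     + (inverse (alpha p \<theta> \<rho>) * theta_star_last p \<theta> \<rho>)\<^sup>2 * Lambda p \<theta> \<rho> $ 0"

definition D_star :: "nat \<Rightarrow> real vec \<Rightarrow> real \<Rightarrow> real" where
  "D_star p \<theta> \<rho> = 2 * (1 - rho_star p \<theta> \<rho>)"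

definition sigma2_D :: "nat \<Rightarrow> real vec \<Rightarrow> real \<Rightarrow> real" where
  "sigma2_D p \<theta> \<rho> = 4 * sigma2_rho p \<theta> \<rho>"

end

theory Submission
  imports Defs "Jordan_Normal_Form.Determinant"
begin

text \<open>
  The process solves an autoregression of order \<open>p + 1\<close>, namely \<open>\<Sum>\<^sub>j a\<^sub>j X\<^sub>k\<^sub>-\<^sub>j = V\<^sub>k\<close>. Multiplying by
  \<open>X\<^sub>k\<^sub>-\<^sub>d\<close> and summing gives the empirical Yule-Walker equations: up to boundary terms of order
  \<open>O\<^sub>P(1)\<close>, \<open>B\<close> maps the empirical autocovariances to the sums \<open>\<Sum>\<^sub>k V\<^sub>k X\<^sub>k\<^sub>-\<^sub>d\<close>, which are martingales for
  \<open>d \<ge> 1\<close>. Since \<open>B\<close> is invertible, this yields the law of large numbers for the empirical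
  autocovariances, with limit \<open>\<sigma>\<^sup>2\<Lambda>\<close>.

  Time reversal exchanges \<open>X\<^sub>k\<close> and \<open>X\<^sub>k\<^sub>-\<^sub>p\<^sub>-\<^sub>1\<close> around \<open>\<Phi>\<^sub>k\<^sub>-\<^sub>1\<close>. Applied to the normal equations it expresses
  the error of the estimator through the martingales. Applied to the products of the residuals with
  \<open>X\<^sub>k\<close> and \<open>X\<^sub>k\<^sub>-\<^sub>p\<^sub>-\<^sub>1\<close> it expresses the lag-one autocovariance of the residuals through
  \<open>\<theta>\<^sub>p\<rho>\<close> times their variance and another martingale. Hence \<open>\<surd>n (D\<^sub>n - D\<^sup>*)\<close> is a fixed linear
  combination of the martingales divided by \<open>\<surd>n\<close>, up to \<open>o\<^sub>P(1)\<close>, and a single scalar martingale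
  central limit theorem suffices; it is proved with characteristic functions compensated by the
  exponential of the conditional variance.
\<close>

section \<open>The autoregressive recursion and its autocovariances\<close>

text \<open>The value of \<open>D_star\<close> comes from one observation. The residual at time k is
  orthogonal, up to O_P(1), to X_{k-1}, ..., X_{k-p}; in its product with the residual at time k-1
  only X_{k-p-1} survives, with minus the last component of the estimator as coefficient. Time
  reversal turns the sum of the residuals times X_{k-p-1} into noise of order sqrt n minus
  \<theta>_p \<rho> times the residual sum of squares; this is where \<open>rho_star\<close>
  originates. The algebra is done modulo O_P(1), because lag sums are Toeplitz only up to boundary
  terms and S perturbs the normal equations; such errors disappear after division by sqrt n. The
  obstacle is that the error of the estimator stands on both sides of its own linearisation, on the
  right with a vanishing factor. Its tightness is therefore obtained by absorption before anything
  is expanded. The limit is taken with characteristic functions and without normalising by the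
  variance, which may be zero.\<close>

lemma sum_rev_index: "(\<Sum>j<p. f (p - 1 - j)) = (\<Sum>j<p. f j)" for f :: "nat \<Rightarrow> 'b :: comm_monoid_add"
  by (rule sum.reindex_bij_witness[of _ "\<lambda>j. p - 1 - j" "\<lambda>j. p - 1 - j"]) auto

text \<open>The power series coefficients of 1 / ((1 - sum of \<theta>_i z^i) (1 - \<rho> z)), that
  is, the response of the process to one unit innovation. The guard \<open>i < n\<close> encodes the
  value 0 at negative times.\<close>

function impulse :: "nat \<Rightarrow> real vec \<Rightarrow> real \<Rightarrow> nat \<Rightarrow> real" where
  "impulse p \<theta> \<rho> n = (\<Sum>i<p. if i < n then \<theta> $ i * impulse p \<theta> \<rho> (n - 1 - i) else 0) + \<rho> ^ n"
  by auto
termination by (relation "Wellfounded.measure (\<lambda>(p, \<theta>, \<rho>, n). n)") auto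

declare impulse.simps [simp del]

locale dw_params =
  fixes p :: nat and \<theta> :: "real vec" and \<rho> :: real
  assumes p: "p \<ge> 1"
    and theta_sum: "(\<Sum>i<p. \<bar>\<theta> $ i\<bar>) < 1"
    and rho: "\<bar>\<rho>\<bar> < 1"
begin

abbreviation "a j \<equiv> a_coeff p \<theta> \<rho> j"
abbreviation "b i \<equiv> beta p \<theta> \<rho> $ i"
abbreviation "c \<equiv> theta_last p \<theta> * \<rho>"

text \<open>Time is two-sided so that convolutions over lags need no case distinction at the
  origin.\<close>

definition psi :: "int \<Rightarrow> real" where
  "psi m = (if m < 0 then 0 else impulse p \<theta> \<rho> (nat m))"

lemma a_0 [simp]: "a 0 = 1"
  and a_Suc: "i < p \<Longrightarrow> a (1 + int i) = - b i"
  and a_last: "a (int p + 1) = c"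
  and a_neg: "j < 0 \<Longrightarrow> a j = 0"
  and a_large: "j > int p + 1 \<Longrightarrow> a j = 0"
  using p by (auto simp: a_coeff_def nat_add_distrib)

lemma ar_sum:
  fixes y :: "int \<Rightarrow> real"
  shows "(\<Sum>j\<le>p+1. a (int j) * y (d - int j)) =
    y d - (\<Sum>i<p. b i * y (d - 1 - int i)) + c * y (d - int p - 1)"
proof -
  have "(\<Sum>j\<le>p+1. a (int j) * y (d - int j)) =
      (\<Sum>j\<le>p. a (int j) * y (d - int j)) + c * y (d - int p - 1)"
    using a_last by (simp add: algebra_simps)
  also have "(\<Sum>j\<le>p. a (int j) * y (d - int j)) = y d + (\<Sum>i<p. a (int (Suc i)) * y (d - int (Suc i)))"
    by (simp add: sum.atMost_shift lessThan_Suc_atMost)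
  also have "(\<Sum>i<p. a (int (Suc i)) * y (d - int (Suc i))) = (\<Sum>i<p. - (b i * y (d - 1 - int i)))"
    by (intro sum.cong refl) (auto simp: a_Suc algebra_simps)
  finally show ?thesis by (simp add: sum_negf)
qed

text \<open>The coefficients \<open>a\<close> are those of the product (1 - sum of \<theta>_i z^i)
  (1 - \<rho> z). The factorisation lets the stability conditions on \<theta> and on \<rho> be used
  separately, one for each factor.\<close>

lemma ar_factor:
  fixes y :: "int \<Rightarrow> real"
  shows "(\<Sum>j\<le>p+1. a (int j) * y (d - int j)) =
    (y d - (\<Sum>i<p. \<theta> $ i * y (d - 1 - int i))) - \<rho> * (y (d - 1) - (\<Sum>i<p. \<theta> $ i * y (d - 2 - int i)))"
proof -
  obtain q where q: "p = Suc q" using p by (cases p) auto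
  have 1: "(\<Sum>i<p. b i * y (d - 1 - int i)) =
     (\<theta> $ 0 + \<rho>) * y (d - 1) + (\<Sum>i<q. (\<theta> $ Suc i - \<theta> $ i * \<rho>) * y (d - 2 - int i))"
    unfolding q by (subst sum.lessThan_Suc_shift, intro arg_cong2[where f="(+)"] sum.cong)
      (auto simp: beta_def algebra_simps)
  have 2: "(\<Sum>i<p. \<theta> $ i * y (d - 1 - int i)) =
     \<theta> $ 0 * y (d - 1) + (\<Sum>i<q. \<theta> $ Suc i * y (d - 2 - int i))"
    unfolding q by (subst sum.lessThan_Suc_shift, intro arg_cong2[where f="(+)"] sum.cong)
      (auto simp: algebra_simps)
  have 3: "(\<Sum>i<p. \<theta> $ i * y (d - 2 - int i)) = (\<Sum>i<q. \<theta> $ i * y (d - 2 - int i)) + \<theta> $ q * y (d - int p - 1)"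
    unfolding q by (simp add: algebra_simps)
  show ?thesis
    unfolding ar_sum 1 2 3 theta_last_def
    by (simp add: q algebra_simps sum_subtractf sum_distrib_left sum.distrib)
qed

lemma psi_neg [simp]: "m < 0 \<Longrightarrow> psi m = 0"
  by (simp add: psi_def)

lemma psi_rec: "psi m = (\<Sum>i<p. \<theta> $ i * psi (m - 1 - int i)) + (if m < 0 then 0 else \<rho> ^ nat m)"
proof (cases "m < 0")
  case False
  then obtain n where n: "m = int n" by (metis nonneg_int_cases not_less)
  have "(if i < n then \<theta> $ i * impulse p \<theta> \<rho> (n - 1 - i) else 0) = \<theta> $ i * psi (m - 1 - int i)" for i
  proof -
    have "nat (int n - 1 - int i) = n - 1 - i" by linarith
    then show ?thesis by (auto simp: psi_def n)
  qed
  then show ?thesis by (simp add: psi_def n impulse.simps[of p \<theta> \<rho> n])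
qed auto

lemma psi_0 [simp]: "psi 0 = 1"
  by (subst psi_rec) auto

text \<open>\<open>psi\<close> is the inverse of \<open>a\<close> under convolution: the
  \<theta>-filter turns \<open>psi\<close> into the powers of \<rho>, and the other factor cancels
  each power against the preceding one, except at time 0.\<close>

lemma psi_ar: "(\<Sum>j\<le>p+1. a (int j) * psi (m - int j)) = (if m = 0 then 1 else 0)"
proof -
  have 1: "psi k - (\<Sum>i<p. \<theta> $ i * psi (k - 1 - int i)) = (if k < 0 then 0 else \<rho> ^ nat k)" for k
    by (subst psi_rec) auto
  have "m - 2 = m - 1 - 1" by simp
  then have 2: "psi (m - 1) - (\<Sum>i<p. \<theta> $ i * psi (m - 2 - int i)) = (if m - 1 < 0 then 0 else \<rho> ^ nat (m - 1))"
    using 1[of "m - 1"] by simp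
  have "\<rho> ^ nat m = \<rho> * \<rho> ^ nat (m - 1)" if "m \<ge> 1"
  proof -
    have "nat m = Suc (nat (m - 1))" using that by linarith
    then show ?thesis by simp
  qed
  then show ?thesis unfolding ar_factor 1 2 by auto
qed

text \<open>Summing the recursion up to \<open>N\<close> bounds a partial sum by the l1 norm of
  \<theta> times itself plus a geometric series. As that norm is below 1, the partial sum can be
  moved to the left, uniformly in \<open>N\<close>.\<close>

lemma summable_psi: "summable (\<lambda>n. \<bar>psi (int n)\<bar>)"
proof (rule bounded_imp_summable[where B = "1 / (1 - \<bar>\<rho>\<bar>) / (1 - (\<Sum>i<p. \<bar>\<theta> $ i\<bar>))"])
  fix N :: nat
  let ?s = "\<Sum>n\<le>N. \<bar>psi (int n)\<bar>" and ?t = "\<Sum>i<p. \<bar>\<theta> $ i\<bar>"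
  have "?s \<le> (\<Sum>n\<le>N. (\<Sum>i<p. \<bar>\<theta> $ i\<bar> * \<bar>psi (int n - 1 - int i)\<bar>) + \<bar>\<rho>\<bar> ^ n)"
  proof (intro sum_mono)
    fix n
    have "\<bar>psi (int n)\<bar> = \<bar>(\<Sum>i<p. \<theta> $ i * psi (int n - 1 - int i)) + \<rho> ^ n\<bar>"
      by (subst psi_rec) auto
    also have "\<dots> \<le> (\<Sum>i<p. \<bar>\<theta> $ i * psi (int n - 1 - int i)\<bar>) + \<bar>\<rho> ^ n\<bar>"
      by (intro order.trans[OF abs_triangle_ineq] add_mono sum_abs order_refl)
    finally show "\<bar>psi (int n)\<bar> \<le> (\<Sum>i<p. \<bar>\<theta> $ i\<bar> * \<bar>psi (int n - 1 - int i)\<bar>) + \<bar>\<rho>\<bar> ^ n"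
      by (simp add: abs_mult power_abs)
  qed
  also have "\<dots> = (\<Sum>i<p. \<bar>\<theta> $ i\<bar> * (\<Sum>n\<le>N. \<bar>psi (int n - 1 - int i)\<bar>)) + (\<Sum>n\<le>N. \<bar>\<rho>\<bar> ^ n)"
    by (simp add: sum.distrib sum_distrib_left sum.swap[of _ "{..N}"])
  also have "\<dots> \<le> (\<Sum>i<p. \<bar>\<theta> $ i\<bar> * ?s) + (\<Sum>n. \<bar>\<rho>\<bar> ^ n)"
  proof (rule add_mono)
    have "(\<Sum>n\<le>N. \<bar>psi (int n - 1 - int i)\<bar>) \<le> ?s" for i
    proof -
      have "(\<Sum>n\<le>N. \<bar>psi (int n - 1 - int i)\<bar>) = (\<Sum>n\<in>{i+1..N}. \<bar>psi (int n - 1 - int i)\<bar>)"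
        by (intro sum.mono_neutral_right) auto
      also have "\<dots> = (\<Sum>n\<in>(\<lambda>n. n - (i + 1)) ` {i+1..N}. \<bar>psi (int n)\<bar>)"
        by (subst sum.reindex) (auto simp: inj_on_def of_nat_diff algebra_simps intro!: sum.cong)
      also have "\<dots> \<le> ?s" by (intro sum_mono2) auto
      finally show ?thesis .
    qed
    then show "(\<Sum>i<p. \<bar>\<theta> $ i\<bar> * (\<Sum>n\<le>N. \<bar>psi (int n - 1 - int i)\<bar>)) \<le> (\<Sum>i<p. \<bar>\<theta> $ i\<bar> * ?s)"
      by (metis (no_types, lifting) abs_ge_zero mult_left_mono sum_mono)
    show "(\<Sum>n\<le>N. \<bar>\<rho>\<bar> ^ n) \<le> (\<Sum>n. \<bar>\<rho>\<bar> ^ n)"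
      using rho by (intro sum_le_suminf summable_geometric) auto
  qed
  also have "\<dots> = ?t * ?s + 1 / (1 - \<bar>\<rho>\<bar>)"
    using rho by (simp add: sum_distrib_right suminf_geometric)
  finally have "(1 - ?t) * ?s \<le> 1 / (1 - \<bar>\<rho>\<bar>)" by (simp add: algebra_simps)
  then show "?s \<le> 1 / (1 - \<bar>\<rho>\<bar>) / (1 - ?t)"
    using theta_sum by (subst pos_le_divide_eq) (auto simp: mult.commute)
qed auto

definition "psi_norm = (\<Sum>n. \<bar>psi (int n)\<bar>)"

lemma sum_psi_le: "finite A \<Longrightarrow> (\<Sum>n\<in>A. \<bar>psi (int n)\<bar>) \<le> psi_norm"
  unfolding psi_norm_def by (rule sum_le_suminf[OF summable_psi]) auto

lemma psi_norm_nonneg: "psi_norm \<ge> 0"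
  using sum_psi_le[of "{}"] by simp

lemma psi_le: "\<bar>psi m\<bar> \<le> psi_norm"
proof (cases "m < 0")
  case False
  then show ?thesis using sum_psi_le[of "{nat m}"] by simp
qed (use psi_norm_nonneg in auto)

text \<open>The autocovariances of the stationary solution with unit innovations; they make up \<open>\<Lambda>\<close>.\<close>

definition gam :: "int \<Rightarrow> real" where
  "gam d = (\<Sum>m. psi (int m) * psi (int m - d))"

lemma gam_sums0: "(\<lambda>m. psi (int m) * psi (int m - d)) sums gam d"
  unfolding gam_def
proof (rule summable_sums, rule summable_comparison_test)
  show "summable (\<lambda>m. \<bar>psi (int m)\<bar> * psi_norm)" by (intro summable_mult2 summable_psi)
  show "\<exists>N. \<forall>n\<ge>N. norm (psi (int n) * psi (int n - d)) \<le> \<bar>psi (int n)\<bar> * psi_norm"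
    by (auto simp: abs_mult intro!: mult_left_mono psi_le)
qed

lemma gam_sums: "(\<lambda>m. psi (int m - int i) * psi (int m - int j)) sums gam (int j - int i)"
proof -
  have "(\<lambda>m. psi (int (m + i) - int i) * psi (int (m + i) - int j)) sums gam (int j - int i)"
    using gam_sums0[of "int j - int i"] by (simp add: algebra_simps)
  then show ?thesis
    by (subst (asm) sums_zero_iff_shift) auto
qed

lemma gam_sym: "gam (- d) = gam d"
proof -
  have *: "gam (int j - int i) = gam (int i - int j)" for i j
    using gam_sums[of i j] gam_sums[of j i] by (simp add: mult.commute sums_unique2)
  show ?thesis
    using *[of "nat d" 0] *[of "nat (-d)" 0] by (cases "d \<ge> 0") auto
qed

lemma gam_abs: "gam \<bar>d\<bar> = gam d"
  using gam_sym[of d] by (auto simp: abs_if)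

text \<open>The Yule-Walker equations of the stationary solution. Convolving \<open>psi\<close> with
  \<open>a\<close> leaves a unit mass where m + d = 0; with m \<ge> 0 and d \<ge> 0 this is met only
  at m = d = 0.\<close>

lemma gam_ar:
  assumes "d \<ge> 0"
  shows "(\<Sum>j\<le>p+1. a (int j) * gam (d - int j)) = (if d = 0 then 1 else 0)"
proof -
  have "(\<lambda>m. \<Sum>j\<le>p+1. a (int j) * (psi (int m) * psi (int m - (int j - d)))) sums
      (\<Sum>j\<le>p+1. a (int j) * gam (int j - d))"
    by (intro sums_sum sums_mult gam_sums0)
  also have "(\<lambda>m. \<Sum>j\<le>p+1. a (int j) * (psi (int m) * psi (int m - (int j - d)))) =
      (\<lambda>m. psi (int m) * (\<Sum>j\<le>p+1. a (int j) * psi (int m + d - int j)))"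
    unfolding sum_distrib_left by (intro ext sum.cong refl) (simp add: algebra_simps)
  also have "\<dots> = (\<lambda>m. if m = 0 then (if d = 0 then 1 else 0) else 0)"
    unfolding psi_ar using assms by auto
  finally have "(\<lambda>m::nat. if m = 0 then (if d = 0 then 1 else 0) else 0) sums
      (\<Sum>j\<le>p+1. a (int j) * gam (int j - d))" .
  moreover have "(\<lambda>m::nat. if m = 0 then (if d = 0 then 1 else 0) else 0) sums (if d = 0 then 1 else (0::real))"
    using sums_single[of 0 "\<lambda>_::nat. if d = 0 then 1 else (0::real)"] by simp
  ultimately have "(\<Sum>j\<le>p+1. a (int j) * gam (int j - d)) = (if d = 0 then 1 else 0)"
    by (rule sums_unique2)
  moreover have "gam (int j - d) = gam (d - int j)" for j using gam_sym[of "d - int j"] by simp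
  ultimately show ?thesis by simp
qed

text \<open>The form is the sum over m of the squares of the combinations of
  \<open>psi (m - i)\<close> with weights \<open>x i\<close>. At the first index with a nonzero
  weight the combination reduces to that weight, because \<open>psi 0 = 1\<close> and
  \<open>psi\<close> vanishes at negative times.\<close>

lemma gam_pos_def:
  assumes "i0 < q" "x i0 \<noteq> 0"
  shows "(\<Sum>i<q. \<Sum>j<q. x i * x j * gam (int i - int j)) > 0"
proof -
  define i1 where "i1 = (LEAST i. x i \<noteq> 0)"
  have i1: "x i1 \<noteq> 0" unfolding i1_def by (rule LeastI[of _ i0]) (rule assms)
  have "i1 \<le> i0" unfolding i1_def by (rule Least_le) (rule assms)
  then have i1q: "i1 < q" using assms by simp
  have before: "x i = 0" if "i < i1" for i using not_less_Least[of i "\<lambda>i. x i \<noteq> 0"] that by (simp add: i1_def)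
  have "(\<lambda>m. \<Sum>i<q. \<Sum>j<q. x i * x j * (psi (int m - int j) * psi (int m - int i))) sums
      (\<Sum>i<q. \<Sum>j<q. x i * x j * gam (int i - int j))"
    by (intro sums_sum sums_mult gam_sums)
  also have "(\<lambda>m. \<Sum>i<q. \<Sum>j<q. x i * x j * (psi (int m - int j) * psi (int m - int i))) =
      (\<lambda>m. (\<Sum>i<q. x i * psi (int m - int i))\<^sup>2)"
    unfolding power2_eq_square sum_product by (intro ext sum.cong refl) (simp add: ac_simps)
  finally have s: "(\<lambda>m. (\<Sum>i<q. x i * psi (int m - int i))\<^sup>2) sums
      (\<Sum>i<q. \<Sum>j<q. x i * x j * gam (int i - int j))" .
  have "(\<Sum>i<q. x i * psi (int i1 - int i)) = (\<Sum>i\<in>{i1}. x i * psi (int i1 - int i))"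
  proof (rule sum.mono_neutral_right)
    show "\<forall>i\<in>{..<q} - {i1}. x i * psi (int i1 - int i) = 0"
    proof
      fix i assume "i \<in> {..<q} - {i1}"
      then have "i < i1 \<or> i1 < i" by (simp add: linorder_neq_iff)
      then show "x i * psi (int i1 - int i) = 0"
      proof
        assume "i < i1"
        then show ?thesis by (simp add: before)
      qed simp
    qed
  qed (use i1q in simp_all)
  then have "(\<Sum>i<q. x i * psi (int i1 - int i))\<^sup>2 > 0" using i1 by simp
  then have "0 < (\<Sum>m. (\<Sum>i<q. x i * psi (int m - int i))\<^sup>2)"
    by (intro suminf_pos2[OF sums_summable[OF s]]) auto
  then show ?thesis using sums_unique[OF s] by simp
qed

text \<open>A row of \<open>B\<close> is a folded convolution: a_{d-j} + a_{d+j} collects the lags j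
  and -j, which carry the same value once \<open>f\<close> is extended symmetrically, while lag 0 is
  its own mirror image and is counted once.\<close>

lemma B_mat_sum:
  assumes "d \<le> p + 1"
  shows "(\<Sum>j<p+2. B_mat p \<theta> \<rho> $$ (d, j) * f j) =
    (\<Sum>j\<le>p+1. a (int j) * f (nat \<bar>int d - int j\<bar>))"
proof -
  have "(\<Sum>j<p+2. B_mat p \<theta> \<rho> $$ (d, j) * f j) =
      (\<Sum>j<p+2. a (int d - int j) * f j + (if j = 0 then 0 else a (int d + int j) * f j))"
    using assms by (intro sum.cong refl) (auto simp: B_mat_def algebra_simps)
  also have "\<dots> = (\<Sum>j<p+2. a (int d - int j) * f j) + (\<Sum>j<p+2. if j = 0 then 0 else a (int d + int j) * f j)"
    by (simp add: sum.distrib)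
  also have "(\<Sum>j<p+2. a (int d - int j) * f j) = (\<Sum>j\<in>{..d}. a (int d - int j) * f j)"
    using assms by (intro sum.mono_neutral_right) (auto simp: a_neg)
  also have "\<dots> = (\<Sum>j\<in>{..d}. a (int j) * f (nat \<bar>int d - int j\<bar>))"
    by (rule sum.reindex_bij_witness[of _ "\<lambda>j. d - j" "\<lambda>j. d - j"]) (auto simp: of_nat_diff)
  also have "(\<Sum>j<p+2. if j = 0 then 0 else a (int d + int j) * f j) = (\<Sum>j\<in>{1..p+1-d}. a (int d + int j) * f j)"
    using assms by (intro sum.mono_neutral_cong_right) (auto simp: a_large)
  also have "\<dots> = (\<Sum>j\<in>{d<..p+1}. a (int j) * f (nat \<bar>int d - int j\<bar>))"
    using assms by (intro sum.reindex_bij_witness[of _ "\<lambda>j. j - d" "\<lambda>j. j + d"]) (auto simp: of_nat_diff algebra_simps)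
  also have "(\<Sum>j\<in>{..d}. a (int j) * f (nat \<bar>int d - int j\<bar>)) + \<dots> =
      (\<Sum>j\<in>{..d} \<union> {d<..p+1}. a (int j) * f (nat \<bar>int d - int j\<bar>))"
    by (rule sum.union_disjoint[symmetric]) auto
  also have "{..d} \<union> {d<..p+1} = {..p+1}" using assms by auto
  finally show ?thesis .
qed

text \<open>Both factors of the recursion contract the supremum norm. Any bound on the
  \<theta>-filtered sequence improves by the factor |\<rho>|, which forces that sequence to vanish;
  then any bound on \<open>f\<close> improves by the l1 norm of \<theta>.\<close>

lemma bounded_two_sided_eq_0:
  fixes f :: "int \<Rightarrow> real"
  assumes ar: "\<And>d. (\<Sum>j\<le>p+1. a (int j) * f (d - int j)) = 0"
    and bd: "\<And>d. \<bar>f d\<bar> \<le> K"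
  shows "f d = 0"
proof -
  have contr: "g d = 0" if g: "\<And>d. \<bar>g d\<bar> \<le> C" and q: "0 \<le> q" "q < 1"
    and step: "\<And>C' d. (\<And>d. \<bar>g d\<bar> \<le> C') \<Longrightarrow> \<bar>g d\<bar> \<le> q * C'" for g :: "int \<Rightarrow> real" and C q d
  proof -
    have "\<bar>g d\<bar> \<le> q ^ n * C" for n d
      by (induction n arbitrary: d) (use g step in \<open>auto simp: mult.assoc\<close>)
    moreover have "(\<lambda>n. q ^ n * C) \<longlonglongrightarrow> 0"
      using q by (intro tendsto_mult_left_zero LIMSEQ_power_zero) auto
    ultimately have "\<bar>g d\<bar> \<le> 0" by (intro LIMSEQ_le_const) auto
    then show ?thesis by simp
  qed
  define u where "u d = f d - (\<Sum>i<p. \<theta> $ i * f (d - 1 - int i))" for d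
  have u_rec: "u d = \<rho> * u (d - 1)" for d
  proof -
    have "d - 2 = d - 1 - 1" by simp
    then show ?thesis using ar[of d] unfolding ar_factor u_def by simp
  qed
  have th: "\<bar>\<Sum>i<p. \<theta> $ i * f (d - 1 - int i)\<bar> \<le> (\<Sum>i<p. \<bar>\<theta> $ i\<bar>) * C"
    if "\<And>d. \<bar>f d\<bar> \<le> C" for C d
    unfolding sum_distrib_right
    by (intro order.trans[OF sum_abs] sum_mono) (auto simp: abs_mult intro!: mult_left_mono that)
  have u0: "u d = 0" for d
  proof (rule contr[where q="\<bar>\<rho>\<bar>"])
    show "\<bar>u d\<bar> \<le> K + (\<Sum>i<p. \<bar>\<theta> $ i\<bar>) * K" for d
      unfolding u_def by (intro order.trans[OF abs_triangle_ineq4] add_mono bd th)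
    show "\<bar>u d\<bar> \<le> \<bar>\<rho>\<bar> * C'" if "\<And>d. \<bar>u d\<bar> \<le> C'" for C' d
      by (subst u_rec) (auto simp: abs_mult intro!: mult_left_mono that)
  qed (use rho in auto)
  show ?thesis
  proof (rule contr[where q="\<Sum>i<p. \<bar>\<theta> $ i\<bar>", OF bd])
    show "\<bar>f d\<bar> \<le> (\<Sum>i<p. \<bar>\<theta> $ i\<bar>) * C'" if "\<And>d. \<bar>f d\<bar> \<le> C'" for C' d
      using u0[of d] th[OF that, of d] by (simp add: u_def)
  qed (use theta_sum in \<open>auto intro: sum_nonneg\<close>)
qed

text \<open>From time 0 on the \<theta>-filtered sequence does not grow in absolute value, and a
  recursion whose coefficients have l1 norm below 1 stays bounded under bounded forcing.\<close>

lemma bounded_one_sided: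
  fixes f :: "int \<Rightarrow> real"
  assumes ar: "\<And>d. d > 0 \<Longrightarrow> (\<Sum>j\<le>p+1. a (int j) * f (d - int j)) = 0"
  obtains K where "\<And>d. d \<ge> - int p \<Longrightarrow> \<bar>f d\<bar> \<le> K"
proof -
  define u where "u d = f d - (\<Sum>i<p. \<theta> $ i * f (d - 1 - int i))" for d
  let ?t = "\<Sum>i<p. \<bar>\<theta> $ i\<bar>"
  have u_rec: "u d = \<rho> * u (d - 1)" if "d > 0" for d
  proof -
    have "d - 2 = d - 1 - 1" by simp
    then show ?thesis using ar[of d] that unfolding ar_factor u_def by simp
  qed
  have u: "\<bar>u (int n)\<bar> \<le> \<bar>u 0\<bar>" for n
  proof (induction n)
    case (Suc n)
    have "\<bar>u (int (Suc n))\<bar> = \<bar>\<rho>\<bar> * \<bar>u (int n)\<bar>"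
      using u_rec[of "int (Suc n)"] by (simp add: abs_mult)
    also have "\<dots> \<le> 1 * \<bar>u (int n)\<bar>" using rho by (intro mult_right_mono) auto
    finally show ?case using Suc by simp
  qed simp
  \<comment> \<open>\<open>K\<close> dominates the initial values and also |u 0| / (1 - t), the
    fixed point of the map sending K to t K + |u 0|, so that the bound reproduces itself in the
    induction.\<close>
  define K where "K = (\<Sum>d\<in>{- int p..0}. \<bar>f d\<bar>) + \<bar>u 0\<bar> / (1 - ?t)"
  have K0: "\<bar>u 0\<bar> / (1 - ?t) \<ge> 0" using theta_sum by auto
  have K1: "?t * K + \<bar>u 0\<bar> \<le> K"
  proof -
    have "(1 - ?t) * K \<ge> (1 - ?t) * (\<bar>u 0\<bar> / (1 - ?t))"
      using theta_sum by (intro mult_left_mono) (auto simp: K_def intro: sum_nonneg)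
    also have "(1 - ?t) * (\<bar>u 0\<bar> / (1 - ?t)) = \<bar>u 0\<bar>" using theta_sum by simp
    finally show ?thesis by (simp add: algebra_simps)
  qed
  have K2: "\<bar>f d\<bar> \<le> K" if "d \<in> {- int p..0}" for d
    using member_le_sum[of d "{- int p..0}" "\<lambda>d. \<bar>f d\<bar>"] that K0 unfolding K_def by auto
  have "\<bar>f (int n)\<bar> \<le> K" for n
  proof (induction n rule: less_induct)
    case (less n)
    show ?case
    proof (cases "n = 0")
      case False
      have "\<bar>f (int n)\<bar> = \<bar>(\<Sum>i<p. \<theta> $ i * f (int n - 1 - int i)) + u (int n)\<bar>"
        unfolding u_def by simp
      also have "\<dots> \<le> (\<Sum>i<p. \<bar>\<theta> $ i * f (int n - 1 - int i)\<bar>) + \<bar>u 0\<bar>"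
        by (intro order.trans[OF abs_triangle_ineq] add_mono sum_abs u)
      also have "\<dots> \<le> (\<Sum>i<p. \<bar>\<theta> $ i\<bar> * K) + \<bar>u 0\<bar>"
      proof (intro add_mono order_refl sum_mono)
        fix i assume i: "i \<in> {..<p}"
        have "\<bar>f (int n - 1 - int i)\<bar> \<le> K"
        proof (cases "int n - 1 - int i \<le> 0")
          case True
          then show ?thesis using i False by (intro K2) auto
        next
          case False
          then have "int n - 1 - int i = int (n - 1 - i)" "n - 1 - i < n" by auto
          then show ?thesis using less[of "n - 1 - i"] by simp
        qed
        then show "\<bar>\<theta> $ i * f (int n - 1 - int i)\<bar> \<le> \<bar>\<theta> $ i\<bar> * K"
          by (auto simp: abs_mult intro!: mult_left_mono)
      qed
      also have "\<dots> \<le> K" using K1 by (simp add: sum_distrib_right)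
      finally show ?thesis .
    qed (use K2[of 0] in simp)
  qed
  then have "\<bar>f d\<bar> \<le> K" if "d \<ge> - int p" for d
    using that K2[of d] nonneg_int_cases[of d] by (cases "d \<ge> 0") auto
  then show ?thesis using that by blast
qed

end

section \<open>Invertibility of \<open>B\<close> and identification of \<open>Lambda\<close> with
  the autocovariances\<close>

function extend_rec :: "nat \<Rightarrow> (nat \<Rightarrow> real) \<Rightarrow> (nat \<Rightarrow> real) \<Rightarrow> nat \<Rightarrow> real" where
  "extend_rec q a g n =
     (if n \<le> q then g n else - (\<Sum>j<q. a (Suc j) * extend_rec q a g (n - 1 - j)))"
  by auto
termination by (relation "Wellfounded.measure (\<lambda>(q, a, g, n). n)") auto

declare extend_rec.simps [simp del]

lemma mult_mat_vec_nth:
  fixes A :: "'a :: semiring_0 mat"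
  assumes "A \<in> carrier_mat n m" "v \<in> carrier_vec m" "i < n"
  shows "(A *\<^sub>v v) $ i = (\<Sum>j<m. A $$ (i, j) * v $ j)"
  using assms by (simp add: scalar_prod_def lessThan_atLeast0)

lemma left_inverse_solve:
  fixes A C :: "'b :: comm_ring_1 mat"
  assumes "A \<in> carrier_mat m m" "C \<in> carrier_mat m m" "C * A = 1\<^sub>m m" "h < m"
  shows "(\<Sum>d<m. C $$ (h, d) * (\<Sum>j<m. A $$ (d, j) * z j)) = z h"
proof -
  let ?z = "vec m z"
  have z: "?z \<in> carrier_vec m" by simp
  have Az: "A *\<^sub>v ?z \<in> carrier_vec m" using assms(1) z by (rule mult_mat_vec_carrier)
  have "z h = ?z $ h" using assms(4) by simp
  also have "?z = (C * A) *\<^sub>v ?z" unfolding assms(3) using z by simp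
  also have "\<dots> = C *\<^sub>v (A *\<^sub>v ?z)" by (rule assoc_mult_mat_vec[OF assms(2,1) z])
  also have "\<dots> $ h = (\<Sum>d<m. C $$ (h, d) * (A *\<^sub>v ?z) $ d)"
    by (rule mult_mat_vec_nth[OF assms(2) Az assms(4)])
  also have "\<dots> = (\<Sum>d<m. C $$ (h, d) * (\<Sum>j<m. A $$ (d, j) * z j))"
  proof (intro sum.cong refl arg_cong2[where f="(*)"])
    fix d assume "d \<in> {..<m}"
    then show "(A *\<^sub>v ?z) $ d = (\<Sum>j<m. A $$ (d, j) * z j)"
      using mult_mat_vec_nth[OF assms(1) z, of d] by (simp del: index_mult_mat_vec)
  qed
  finally show ?thesis by (rule sym)
qed

context dw_params
begin

text \<open>A kernel vector of \<open>B\<close> extends to a symmetric \<open>f\<close> on \<open>\<int>\<close> solving the recursion at times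
  \<open>\<ge> 0\<close>. Applying the adjoint recursion to the defect \<open>h\<close> of \<open>f\<close> gives a symmetric function vanishing
  at times \<open>\<ge> 0\<close>, hence everywhere; so \<open>h = 0\<close> by downward induction, and a bounded solution on all of
  \<open>\<int>\<close> of a stable recursion vanishes.\<close>

lemma B_kernel:
  fixes g :: "nat \<Rightarrow> real"
  assumes g: "\<And>d. d \<le> p + 1 \<Longrightarrow> (\<Sum>j\<le>p+1. a (int j) * g (nat \<bar>int d - int j\<bar>)) = 0"
    and d: "d \<le> p + 1"
  shows "g d = 0"
proof -
  \<comment> \<open>\<open>g\<close> has p + 2 relevant entries although the recursion has order p +
    1. All of them are copied: the equations at times 0 to p + 1 come from the hypothesis on
    \<open>g\<close>, the later ones from the extension.\<close>
  define e where "e = extend_rec (p+1) (\<lambda>j. a (int j)) g"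
  define f where "f d = e (nat \<bar>d\<bar>)" for d :: int
  have f_sym: "f (- d) = f d" for d by (simp add: f_def)
  have e_small: "e n = g n" if "n \<le> p + 1" for n
    using that unfolding e_def by (subst extend_rec.simps) simp
  have f_ar: "(\<Sum>j\<le>p+1. a (int j) * f (d - int j)) = 0" if d0: "d \<ge> 0" for d
  proof -
    obtain n where n: "d = int n" using nonneg_int_cases[OF d0] by metis
    show ?thesis
    proof (cases "n \<le> p + 1")
      case True
      have "f (d - int j) = g (nat \<bar>int n - int j\<bar>)" if "j \<le> p + 1" for j
        using True that unfolding f_def n by (intro e_small) linarith
      then show ?thesis using g[OF True] by simp
    next
      case False
      have "(\<Sum>j\<le>p+1. a (int j) * f (d - int j)) = f d + (\<Sum>j<p+1. a (int (Suc j)) * f (d - int (Suc j)))"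
        by (subst sum.atMost_shift) simp
      also have "(\<Sum>j<p+1. a (int (Suc j)) * f (d - int (Suc j))) = (\<Sum>j<p+1. a (int (Suc j)) * e (n - 1 - j))"
      proof (intro sum.cong refl)
        fix j assume "j \<in> {..<p+1}"
        then have "nat \<bar>d - int (Suc j)\<bar> = n - 1 - j" using False n by auto
        then show "a (int (Suc j)) * f (d - int (Suc j)) = a (int (Suc j)) * e (n - 1 - j)"
          by (simp add: f_def)
      qed
      also have "f d = - (\<Sum>j<p+1. a (int (Suc j)) * e (n - 1 - j))"
        using False unfolding f_def e_def n by (subst extend_rec.simps) simp
      finally show ?thesis by simp
    qed
  qed
  define h where "h d = (\<Sum>j\<le>p+1. a (int j) * f (d - int j))" for d
  have h_nonneg: "h d = 0" if "d \<ge> 0" for d using f_ar that by (simp add: h_def)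
  define w where "w d = (\<Sum>j\<le>p+1. a (int j) * h (d + int j))" for d
  have w_sym: "w (- d) = w d" for d
  proof -
    have "w (- d) = (\<Sum>j\<le>p+1. \<Sum>k\<le>p+1. a (int j) * (a (int k) * f (- d + int j - int k)))"
      unfolding w_def h_def by (simp only: sum_distrib_left)
    also have "\<dots> = (\<Sum>j\<le>p+1. \<Sum>k\<le>p+1. a (int j) * (a (int k) * f (d + int k - int j)))"
    proof (intro sum.cong refl)
      fix j k
      show "a (int j) * (a (int k) * f (- d + int j - int k)) = a (int j) * (a (int k) * f (d + int k - int j))"
        using f_sym[of "d + int k - int j"] by (simp add: algebra_simps)
    qed
    also have "\<dots> = (\<Sum>k\<le>p+1. \<Sum>j\<le>p+1. a (int j) * (a (int k) * f (d + int k - int j)))"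
      by (rule sum.swap)
    also have "\<dots> = w d"
      unfolding w_def h_def sum_distrib_left by (intro sum.cong refl) (simp only: mult.left_commute)
    finally show ?thesis .
  qed
  have w_nonneg: "w d = 0" if "d \<ge> 0" for d using that by (simp add: w_def h_nonneg)
  have w0: "w d = 0" for d
    using w_nonneg[of d] w_nonneg[of "- d"] w_sym[of d] by linarith
  \<comment> \<open>As a_0 = 1, the vanishing quantity \<open>w (- int n)\<close> is
    \<open>h (- int n)\<close> plus a combination of values of \<open>h\<close> at later times,
    which are already known to be 0.\<close>
  have h_neg: "h (- int n) = 0" for n
  proof (induction n rule: less_induct)
    case (less n)
    have "w (- int n) = h (- int n) + (\<Sum>j<p+1. a (int (Suc j)) * h (- int n + int (Suc j)))"
      unfolding w_def by (subst sum.atMost_shift) simp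
    also have "(\<Sum>j<p+1. a (int (Suc j)) * h (- int n + int (Suc j))) = 0"
    proof (intro sum.neutral ballI)
      fix j
      show "a (int (Suc j)) * h (- int n + int (Suc j)) = 0"
      proof (cases "n \<le> Suc j")
        case False
        then have e: "- int n + int (Suc j) = - int (n - Suc j)" and lt: "n - Suc j < n" by auto
        show ?thesis unfolding e less[OF lt] by (rule mult_zero_right)
      next
        case True
        then have "0 \<le> - int n + int (Suc j)" by linarith
        then show ?thesis by (subst h_nonneg) auto
      qed
    qed
    finally show ?case using w0[of "- int n"] by linarith
  qed
  have h0: "h d = 0" for d
    using h_nonneg[of d] h_neg[of "nat (- d)"] by (cases "d \<ge> 0") auto
  have f_ar_all: "(\<Sum>j\<le>p+1. a (int j) * f (d - int j)) = 0" for d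
    using h0[of d] unfolding h_def .
  obtain K where K: "\<And>d. d \<ge> - int p \<Longrightarrow> \<bar>f d\<bar> \<le> K"
    by (rule bounded_one_sided[of f, OF f_ar_all]) blast
  have f_bd: "\<bar>f d\<bar> \<le> K" for d
  proof -
    have "f d = f \<bar>d\<bar>" by (simp add: f_def)
    then show ?thesis using K[of "\<bar>d\<bar>"] by simp
  qed
  have "f (int d) = 0"
    by (rule bounded_two_sided_eq_0[OF f_ar_all f_bd])
  then show ?thesis using e_small[OF d] by (simp add: f_def)
qed

lemma B_carrier: "B_mat p \<theta> \<rho> \<in> carrier_mat (p + 2) (p + 2)"
  by (simp add: B_mat_def)

lemma B_mult_vec:
  assumes "L \<in> carrier_vec (p + 2)" "d \<le> p + 1"
  shows "(B_mat p \<theta> \<rho> *\<^sub>v L) $ d = (\<Sum>j\<le>p+1. a (int j) * L $ (nat \<bar>int d - int j\<bar>))"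
  using assms B_mat_sum[OF assms(2), of "\<lambda>j. L $ j"]
  by (subst mult_mat_vec_nth[OF B_carrier]) auto

lemma B_inj:
  assumes "L \<in> carrier_vec (p + 2)" "L' \<in> carrier_vec (p + 2)"
    "B_mat p \<theta> \<rho> *\<^sub>v L = B_mat p \<theta> \<rho> *\<^sub>v L'"
  shows "L = L'"
proof (rule eq_vecI)
  fix d assume "d < dim_vec L'"
  then have d: "d \<le> p + 1" using assms by auto
  have "L $ d - L' $ d = 0"
  proof (rule B_kernel[OF _ d])
    fix d assume d: "d \<le> p + 1"
    show "(\<Sum>j\<le>p+1. a (int j) * (L $ (nat \<bar>int d - int j\<bar>) - L' $ (nat \<bar>int d - int j\<bar>))) = 0"
      using B_mult_vec[OF assms(1) d] B_mult_vec[OF assms(2) d] assms(3)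
      by (simp add: right_diff_distrib sum_subtractf)
  qed
  then show "L $ d = L' $ d" by simp
qed (use assms in auto)

text \<open>\<open>gam_ar\<close> makes the autocovariances a solution of the system and
  \<open>B_inj\<close> makes it the only one, so the description operator in \<open>Lambda\<close>
  returns them.\<close>

lemma Lambda_eq: "Lambda p \<theta> \<rho> = vec (p + 2) (\<lambda>d. gam (int d))"
proof -
  let ?L = "vec (p + 2) (\<lambda>d. gam (int d))"
  have "B_mat p \<theta> \<rho> *\<^sub>v ?L = unit_vec (p + 2) 0"
  proof (rule eq_vecI)
    fix d assume "d < dim_vec (unit_vec (p + 2) 0 :: real vec)"
    then have d: "d \<le> p + 1" by simp
    have "(B_mat p \<theta> \<rho> *\<^sub>v ?L) $ d = (\<Sum>j\<le>p+1. a (int j) * ?L $ (nat \<bar>int d - int j\<bar>))"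
      by (rule B_mult_vec) (use d in auto)
    also have "\<dots> = (\<Sum>j\<le>p+1. a (int j) * gam (int d - int j))"
    proof (intro sum.cong refl)
      fix j assume "j \<in> {..p+1}"
      then have "nat \<bar>int d - int j\<bar> < p + 2" using d by auto
      then show "a (int j) * ?L $ (nat \<bar>int d - int j\<bar>) = a (int j) * gam (int d - int j)"
        by (simp add: gam_abs)
    qed
    also have "\<dots> = unit_vec (p + 2) 0 $ d"
      using d by (subst gam_ar) (auto simp: unit_vec_def)
    finally show "(B_mat p \<theta> \<rho> *\<^sub>v ?L) $ d = unit_vec (p + 2) 0 $ d" .
  qed (auto simp: B_mat_def)
  then show ?thesis
    unfolding Lambda_def by (intro the_equality) (auto intro: B_inj)
qed

lemma Lambda_nth: "d \<le> p + 1 \<Longrightarrow> Lambda p \<theta> \<rho> $ d = gam (int d)"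
  by (simp add: Lambda_eq)

lemma Delta_nth: "i < p \<Longrightarrow> j < p \<Longrightarrow> Delta p \<theta> \<rho> $$ (i, j) = gam (int i - int j)"
  by (simp add: Delta_def Lambda_nth gam_abs nat_le_iff abs_le_iff)

lemma Delta_carrier: "Delta p \<theta> \<rho> \<in> carrier_mat p p"
  by (simp add: Delta_def)

end

section \<open>Matrix inverses and a Toeplitz form of the limiting variance\<close>

lemma quad_form_sum:
  fixes A :: "'a :: comm_semiring_0 mat"
  assumes "A \<in> carrier_mat n n" "x \<in> carrier_vec n"
  shows "x \<bullet> (A *\<^sub>v x) = (\<Sum>i<n. \<Sum>j<n. x $ i * x $ j * A $$ (i, j))"
proof -
  have "x \<bullet> (A *\<^sub>v x) = (\<Sum>i<n. x $ i * (A *\<^sub>v x) $ i)"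
    using assms by (simp add: scalar_prod_def lessThan_atLeast0)
  also have "\<dots> = (\<Sum>i<n. \<Sum>j<n. x $ i * x $ j * A $$ (i, j))"
  proof (intro sum.cong refl)
    fix i assume "i \<in> {..<n}"
    then show "x $ i * (A *\<^sub>v x) $ i = (\<Sum>j<n. x $ i * x $ j * A $$ (i, j))"
      unfolding lessThan_iff mult_mat_vec_nth[OF assms] by (simp add: sum_distrib_left ac_simps mult_mat_vec_nth[OF assms] del: index_mult_mat_vec)
  qed
  finally show ?thesis .
qed

lemma pos_def_det_nonzero:
  fixes A :: "real mat"
  assumes A: "A \<in> carrier_mat n n"
    and pos: "\<And>x. x \<in> carrier_vec n \<Longrightarrow> x \<noteq> 0\<^sub>v n \<Longrightarrow> 0 < x \<bullet> (A *\<^sub>v x)"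
  shows "Determinant.det A \<noteq> 0"
proof
  assume "Determinant.det A = 0"
  then obtain x where x: "x \<in> carrier_vec n" "x \<noteq> 0\<^sub>v n" "A *\<^sub>v x = 0\<^sub>v n"
    using det_0_iff_vec_prod_zero[OF A] by auto
  then show False using pos[of x] by simp
qed

text \<open>The adjugate formula is recorded because it exhibits the entries of the inverse as
  rational functions of those of \<open>A\<close>; the measurability of the estimator rests on
  it.\<close>

lemma mat_inv_nonsingular:
  fixes A :: "real mat"
  assumes A: "A \<in> carrier_mat n n" and det: "Determinant.det A \<noteq> 0"
  shows "mat_inv A \<in> carrier_mat n n" "A * mat_inv A = 1\<^sub>m n" "mat_inv A * A = 1\<^sub>m n"
    and "mat_inv A = (1 / Determinant.det A) \<cdot>\<^sub>m adj_mat A"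
proof -
  have "A \<in> Units (ring_mat TYPE(real) n ())"
    using det_non_zero_imp_unit[OF A det] .
  then obtain B where B: "mat_inverse A = Some B"
    using mat_inverse(1)[OF A, where b = "()"] by (cases "mat_inverse A") auto
  note * = mat_inverse(2)[OF A B]
  then show c: "mat_inv A \<in> carrier_mat n n" and r: "A * mat_inv A = 1\<^sub>m n" and l: "mat_inv A * A = 1\<^sub>m n"
    by (auto simp: mat_inv_def B)
  note adj = adj_mat[OF A]
  let ?C = "(1 / Determinant.det A) \<cdot>\<^sub>m adj_mat A"
  have C: "?C \<in> carrier_mat n n" using adj by simp
  have "A * ?C = 1\<^sub>m n"
    using adj A det by (simp add: mult_smult_distrib[OF A adj(1)]) (auto intro!: eq_matI)
  then have "mat_inv A = mat_inv A * (A * ?C)" using c by simp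
  also have "\<dots> = (mat_inv A * A) * ?C" using assoc_mult_mat[OF c A C] by simp
  also have "\<dots> = ?C" unfolding l by (rule left_mult_one_mat[OF C])
  finally show "mat_inv A = ?C" .
qed

context dw_params
begin

lemma Delta_pos:
  assumes "x \<in> carrier_vec p" "x \<noteq> 0\<^sub>v p"
  shows "0 < x \<bullet> (Delta p \<theta> \<rho> *\<^sub>v x)"
proof -
  obtain i where "i < p" "x $ i \<noteq> 0" using assms by (metis carrier_vecD eq_vecI index_zero_vec)
  then have "(\<Sum>i<p. \<Sum>j<p. x $ i * x $ j * gam (int i - int j)) > 0"
    by (rule gam_pos_def)
  then show ?thesis
    unfolding quad_form_sum[OF Delta_carrier assms(1)] by (simp add: Delta_nth)
qed

lemma Delta_det: "Determinant.det (Delta p \<theta> \<rho>) \<noteq> 0"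
  using pos_def_det_nonzero[OF Delta_carrier] Delta_pos by blast

lemmas Delta_inv = mat_inv_nonsingular[OF Delta_carrier Delta_det]

lemma c_less: "\<bar>c\<bar> < 1"
proof -
  have "\<bar>theta_last p \<theta>\<bar> \<le> (\<Sum>i<p. \<bar>\<theta> $ i\<bar>)"
    unfolding theta_last_def using p by (intro member_le_sum) auto
  then have "\<bar>theta_last p \<theta>\<bar> < 1" using theta_sum by simp
  then have "\<bar>theta_last p \<theta>\<bar> * \<bar>\<rho>\<bar> < 1 * 1"
    using rho by (intro mult_strict_mono') auto
  then show ?thesis by (simp add: abs_mult)
qed

abbreviation "alph \<equiv> alpha p \<theta> \<rho>"

lemma c_square: "1 - c * c > 0"
proof -
  have "\<bar>c\<bar> * \<bar>c\<bar> < 1 * 1" using c_less by (intro mult_strict_mono') auto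
  then show ?thesis by (simp add: abs_mult[symmetric] flip: abs_mult)
qed

lemma alph_eq: "alph = 1 / (1 - c * c)"
  by (simp add: alpha_def algebra_simps)

lemma alph_pos: "alph > 0"
  using c_square by (simp add: alph_eq)

lemma alph_c: "alph * (1 - c * c) = 1"
  using c_square by (simp add: alph_eq)

definition "th_star j = alph * (b j - c * b (p - 1 - j))"

end

lemma exchange_mat_mult_nth:
  assumes "z \<in> carrier_vec p" "d < p"
  shows "(exchange_mat p *\<^sub>v z) $ d = z $ (p - 1 - d)"
proof -
  have "(exchange_mat p *\<^sub>v z) $ d = (\<Sum>j<p. (if d + j + 1 = p then 1 else 0) * z $ j)"
    using assms by (subst mult_mat_vec_nth[where n=p and m=p]) (auto simp: exchange_mat_def)
  also have "\<dots> = (\<Sum>j<p. if j = p - 1 - d then z $ j else 0)"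
    using assms by (intro sum.cong refl) auto
  also have "\<dots> = z $ (p - 1 - d)" using assms by simp
  finally show ?thesis .
qed

lemma exchange_mat_carrier: "exchange_mat p \<in> carrier_mat p p"
  by (simp add: exchange_mat_def)

lemma exchange_mat_dims [simp]: "dim_row (exchange_mat p) = p" "dim_col (exchange_mat p) = p"
  by (simp_all add: exchange_mat_def)

lemma one_minus_exchange_carrier: "1\<^sub>m p - k \<cdot>\<^sub>m exchange_mat p \<in> carrier_mat p p"
  by (rule carrier_matI) simp_all

lemma one_minus_exchange_nth:
  assumes z: "z \<in> carrier_vec p" and d: "d < p"
  shows "((1\<^sub>m p - k \<cdot>\<^sub>m exchange_mat p) *\<^sub>v z) $ d = z $ d - k * z $ (p - 1 - d)"
proof -
  have e: "(1\<^sub>m p - k \<cdot>\<^sub>m exchange_mat p) $$ (d, j) = (if j = d then 1 else 0) - (if j = p - 1 - d then k else 0)" if "j < p" for j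
  proof -
    have "exchange_mat p $$ (d, j) = (if j = p - 1 - d then 1 else 0)"
    proof -
      have "d + j + 1 = p \<longleftrightarrow> j = p - 1 - d" using d by linarith
      then show ?thesis using d that by (simp only: exchange_mat_def index_mat case_prod_conv)
    qed
    then show ?thesis using d that by (simp add: index_mat)
  qed
  have "((1\<^sub>m p - k \<cdot>\<^sub>m exchange_mat p) *\<^sub>v z) $ d = (\<Sum>j<p. (1\<^sub>m p - k \<cdot>\<^sub>m exchange_mat p) $$ (d, j) * z $ j)"
    by (rule mult_mat_vec_nth[OF one_minus_exchange_carrier z d])
  also have "\<dots> = (\<Sum>j<p. (if j = d then z $ j else 0) - (if j = p - 1 - d then k * z $ j else 0))"
  proof (intro sum.cong refl)
    fix j assume "j \<in> {..<p}"
    then show "(1\<^sub>m p - k \<cdot>\<^sub>m exchange_mat p) $$ (d, j) * z $ j =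
       (if j = d then z $ j else 0) - (if j = p - 1 - d then k * z $ j else 0)"
      by (subst e) (auto simp: algebra_simps)
  qed
  also have "\<dots> = z $ d - k * z $ (p - 1 - d)"
    using d by (simp add: sum_subtractf)
  finally show ?thesis .
qed

context dw_params
begin

lemma beta_carrier: "beta p \<theta> \<rho> \<in> carrier_vec p"
  by (simp add: beta_def)

lemma theta_star_nth: "j < p \<Longrightarrow> theta_star p \<theta> \<rho> $ j = th_star j"
proof -
  assume j: "j < p"
  have "(1\<^sub>m p - c \<cdot>\<^sub>m exchange_mat p) *\<^sub>v beta p \<theta> \<rho> \<in> carrier_vec p"
    by (rule mult_mat_vec_carrier[OF one_minus_exchange_carrier beta_carrier])
  then show ?thesis
    unfolding theta_star_def th_star_def using j one_minus_exchange_nth[OF beta_carrier j, of c]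
    by (simp del: index_mult_mat_vec)
qed

lemma theta_star_last_eq: "theta_star_last p \<theta> \<rho> = th_star (p - 1)"
  unfolding theta_star_last_def using p by (intro theta_star_nth) auto

lemma D_star_eq: "D_star p \<theta> \<rho> = 2 * (1 - c * th_star (p - 1))"
  by (simp add: D_star_def rho_star_def theta_star_last_eq)

text \<open>Component i of the vector to which \<open>P_L\<close> applies J_p (I_p - c J_p).\<close>

definition "PL_arg i = alph * c * mat_inv (Delta p \<theta> \<rho>) $$ (i, 0) + th_star (p - 1) * b i"

lemma P_L_carrier: "P_L p \<theta> \<rho> \<in> carrier_vec p"
  unfolding P_L_def
  by (rule mult_mat_vec_carrier[OF mult_carrier_mat[OF exchange_mat_carrier one_minus_exchange_carrier]])
     (intro add_carrier_vec smult_carrier_vec[THEN iffD2] mult_mat_vec_carrier[OF Delta_inv(1)] unit_vec_carrier beta_carrier)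

text \<open>Since J_p is an involution, J_p (I_p - c J_p) = J_p - c I_p; hence the mirrored index in
  the first term only.\<close>

lemma P_L_nth:
  assumes d: "d < p" shows "P_L p \<theta> \<rho> $ d = PL_arg (p - 1 - d) - c * PL_arg d"
proof -
  let ?w = "(alph * theta_last p \<theta> * \<rho>) \<cdot>\<^sub>v (mat_inv (Delta p \<theta> \<rho>) *\<^sub>v unit_vec p 0) + theta_star_last p \<theta> \<rho> \<cdot>\<^sub>v beta p \<theta> \<rho>"
  have Ce: "mat_inv (Delta p \<theta> \<rho>) *\<^sub>v unit_vec p 0 \<in> carrier_vec p"
    using Delta_inv(1) by (rule mult_mat_vec_carrier) simp
  then have w: "?w \<in> carrier_vec p" using beta_carrier by auto
  have wi: "?w $ i = PL_arg i" if i: "i < p" for i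
  proof -
    have "(mat_inv (Delta p \<theta> \<rho>) *\<^sub>v unit_vec p 0) $ i = (\<Sum>j<p. mat_inv (Delta p \<theta> \<rho>) $$ (i, j) * unit_vec p 0 $ j)"
      using i by (intro mult_mat_vec_nth[OF Delta_inv(1)]) auto
    also have "\<dots> = (\<Sum>j<p. if j = 0 then mat_inv (Delta p \<theta> \<rho>) $$ (i, j) else 0)"
      by (intro sum.cong refl) (auto simp: unit_vec_def)
    also have "\<dots> = mat_inv (Delta p \<theta> \<rho>) $$ (i, 0)" using p by simp
    finally have "(mat_inv (Delta p \<theta> \<rho>) *\<^sub>v unit_vec p 0) $ i = mat_inv (Delta p \<theta> \<rho>) $$ (i, 0)" .
    then show ?thesis
      using i carrier_vecD[OF Ce] carrier_matD[OF Delta_inv(1)] carrier_vecD[OF beta_carrier]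
      by (simp add: PL_arg_def theta_star_last_eq mult.assoc del: index_mult_mat_vec)
  qed
  let ?K = "1\<^sub>m p - c \<cdot>\<^sub>m exchange_mat p"
  have K: "?K \<in> carrier_mat p p" by (rule one_minus_exchange_carrier)
  have "P_L p \<theta> \<rho> = exchange_mat p *\<^sub>v (?K *\<^sub>v ?w)"
    unfolding P_L_def by (rule assoc_mult_mat_vec[OF exchange_mat_carrier K w])
  also have "\<dots> $ d = (?K *\<^sub>v ?w) $ (p - 1 - d)"
    by (rule exchange_mat_mult_nth[OF mult_mat_vec_carrier[OF K w] d])
  also have "\<dots> = ?w $ (p - 1 - d) - c * ?w $ (p - 1 - (p - 1 - d))"
    using d by (intro one_minus_exchange_nth[OF w]) auto
  also have "p - 1 - (p - 1 - d) = d" using d by auto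
  finally show ?thesis using wi[of d] wi[of "p - 1 - d"] d by simp
qed

text \<open>The coefficients of \<open>X\<^sub>k\<^sub>-\<^sub>1, \<dots>, X\<^sub>k\<^sub>-\<^sub>p\<^sub>-\<^sub>1\<close> in the limiting martingale; the last one is not part of
  \<open>P\<^sub>L\<close> and accounts for the two extra terms of the variance.\<close>

definition "limit_coeff d = (if d < p then P_L p \<theta> \<rho> $ d else - (inverse alph * th_star (p - 1)))"

text \<open>The three terms of \<open>sigma2_rho\<close> are the block, twice the border and the
  corner of one Toeplitz form of order p + 1. The border holds the autocovariances at lags p - d,
  that is, \<open>Lambda1\<close> read backwards. In this shape the quantity is the variance of a
  linear combination of p + 1 consecutive values, which is what the central limit theorem
  delivers.\<close>

lemma sigma2_rho_eq: "sigma2_rho p \<theta> \<rho> =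
   (\<Sum>d<p+1. \<Sum>e<p+1. limit_coeff d * limit_coeff e * gam (int d - int e))"
proof -
  let ?P = "\<lambda>d. P_L p \<theta> \<rho> $ d" and ?k = "- (inverse alph * th_star (p - 1))"
  have h: "limit_coeff d = ?P d" if "d < p" for d using that by (simp add: limit_coeff_def)
  have hp: "limit_coeff p = ?k" by (simp add: limit_coeff_def)
  have cross: "(\<Sum>d<p. ?P d * ?k * gam (int d - int p)) = ?k * (\<Sum>d<p. ?P d * gam (int p - int d))"
    unfolding sum_distrib_left
  proof (intro sum.cong refl)
    fix d
    show "?P d * ?k * gam (int d - int p) = ?k * (?P d * gam (int p - int d))"
      using gam_sym[of "int d - int p"] by simp
  qed
  have "(\<Sum>d<p+1. \<Sum>e<p+1. limit_coeff d * limit_coeff e * gam (int d - int e)) =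
      (\<Sum>d<p. \<Sum>e<p. limit_coeff d * limit_coeff e * gam (int d - int e)) + (\<Sum>d<p. limit_coeff d * limit_coeff p * gam (int d - int p))
      + ((\<Sum>e<p. limit_coeff p * limit_coeff e * gam (int p - int e)) + limit_coeff p * limit_coeff p * gam 0)"
    by (simp add: sum.distrib)
  also have "\<dots> = (\<Sum>d<p. \<Sum>e<p. ?P d * ?P e * gam (int d - int e)) + (\<Sum>d<p. ?P d * ?k * gam (int d - int p))
      + ((\<Sum>e<p. ?k * (?P e * gam (int p - int e))) + ?k * ?k * gam 0)"
    unfolding hp by (intro arg_cong2[where f="(+)"] sum.cong refl) (simp_all add: h)
  also have "\<dots> = (\<Sum>d<p. \<Sum>e<p. ?P d * ?P e * gam (int d - int e)) + 2 * ?k * (\<Sum>d<p. ?P d * gam (int p - int d)) + ?k * ?k * gam 0"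
    unfolding cross sum_distrib_left[symmetric] by simp
  finally have rhs: "(\<Sum>d<p+1. \<Sum>e<p+1. limit_coeff d * limit_coeff e * gam (int d - int e)) = \<dots>" .
  have "P_L p \<theta> \<rho> \<bullet> (Delta p \<theta> \<rho> *\<^sub>v P_L p \<theta> \<rho>) = (\<Sum>d<p. \<Sum>e<p. ?P d * ?P e * gam (int d - int e))"
    unfolding quad_form_sum[OF Delta_carrier P_L_carrier] by (simp add: Delta_nth)
  moreover have "Lambda1 p \<theta> \<rho> \<bullet> (exchange_mat p *\<^sub>v P_L p \<theta> \<rho>) = (\<Sum>d<p. ?P d * gam (int p - int d))"
  proof -
    have "Lambda1 p \<theta> \<rho> \<bullet> (exchange_mat p *\<^sub>v P_L p \<theta> \<rho>) = (\<Sum>i<p. Lambda1 p \<theta> \<rho> $ i * (exchange_mat p *\<^sub>v P_L p \<theta> \<rho>) $ i)"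
    proof -
      have dim: "dim_vec (exchange_mat p *\<^sub>v P_L p \<theta> \<rho>) = p" by (simp add: exchange_mat_def)
      show ?thesis unfolding scalar_prod_def[of "Lambda1 p \<theta> \<rho>"] dim lessThan_atLeast0 ..
    qed
    also have "\<dots> = (\<Sum>i<p. gam (int i + 1) * ?P (p - 1 - i))"
      by (intro sum.cong refl)
        (simp add: Lambda1_def Lambda_nth exchange_mat_mult_nth[OF P_L_carrier] add.commute del: index_mult_mat_vec)
    \<comment> \<open>Reversing the summation moves the exchange matrix from \<open>P_L\<close> to
      \<open>Lambda1\<close>.\<close>
    also have "\<dots> = (\<Sum>i<p. gam (int (p - 1 - i) + 1) * ?P (p - 1 - (p - 1 - i)))"
      by (rule sum_rev_index[symmetric])
    also have "\<dots> = (\<Sum>d<p. ?P d * gam (int p - int d))"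
    proof (intro sum.cong refl)
      fix i assume "i \<in> {..<p}"
      then have "int (p - 1 - i) + 1 = int p - int i" "p - 1 - (p - 1 - i) = i" by auto
      then show "gam (int (p - 1 - i) + 1) * ?P (p - 1 - (p - 1 - i)) = ?P i * gam (int p - int i)" by simp
    qed
    finally show ?thesis .
  qed
  ultimately show ?thesis
    unfolding sigma2_rho_def rhs theta_star_last_eq using Lambda_nth[of 0]
    by (simp add: power2_eq_square mult.assoc)
qed

text \<open>A symmetric Toeplitz matrix commutes with the exchange matrix, so the first column of
  its inverse read backwards is the last column. This is why the first unit vector occurs in
  \<open>P_L\<close> although the last component of the estimator is the one that matters.\<close>

lemma Delta_inv_last:
  assumes j: "j < p"
  shows "(\<Sum>i<p. mat_inv (Delta p \<theta> \<rho>) $$ (p - 1 - i, 0) * gam (int i - int j)) = (if j = p - 1 then 1 else 0)"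
proof -
  let ?C = "mat_inv (Delta p \<theta> \<rho>)"
  let ?f = "\<lambda>i. ?C $$ (p - 1 - i, 0) * gam (int i - int j)"
  have "(\<Sum>i<p. ?f i) = (\<Sum>i<p. ?f (p - 1 - i))" by (rule sum_rev_index[symmetric])
  also have "\<dots> = (\<Sum>i<p. Delta p \<theta> \<rho> $$ (p - 1 - j, i) * ?C $$ (i, 0))"
  proof (intro sum.cong refl)
    fix i assume "i \<in> {..<p}"
    then have i: "p - 1 - (p - 1 - i) = i" "int (p - 1 - i) - int j = int (p - 1 - j) - int i" "i < p" using j by auto
    have "p - 1 - j < p" using p by auto
    then show "?f (p - 1 - i) = Delta p \<theta> \<rho> $$ (p - 1 - j, i) * ?C $$ (i, 0)"
      unfolding i using i by (simp add: Delta_nth)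
  qed
  also have "\<dots> = (Delta p \<theta> \<rho> * ?C) $$ (p - 1 - j, 0)"
    using p Delta_carrier Delta_inv(1) by (subst index_mult_mat) (auto simp: scalar_prod_def lessThan_atLeast0)
  also have "\<dots> = (if j = p - 1 then 1 else 0)"
    unfolding Delta_inv(2) using p j by auto
  finally show ?thesis .
qed

end

section \<open>Stochastic order symbols\<close>

context prob_space
begin

abbreviation outside :: "real \<Rightarrow> ('a \<Rightarrow> bool) \<Rightarrow> bool" where
  "outside e P \<equiv> \<exists>E\<in>events. prob E \<le> e \<and> (\<forall>\<omega>\<in>space M - E. P \<omega>)"

text \<open>Stochastic order symbols, phrased with exceptional events so that the sequences themselves
  need not be measurable.\<close>

definition Op :: "(nat \<Rightarrow> 'a \<Rightarrow> real) \<Rightarrow> bool" where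
  "Op A \<longleftrightarrow> (\<forall>e>0. \<exists>K. \<forall>\<^sub>F n in sequentially.
     outside e (\<lambda>\<omega>. \<bar>A n \<omega>\<bar> \<le> K))"

definition op :: "(nat \<Rightarrow> 'a \<Rightarrow> real) \<Rightarrow> bool" where
  "op A \<longleftrightarrow> (\<forall>e>0. \<forall>d>0. \<forall>\<^sub>F n in sequentially.
     outside e (\<lambda>\<omega>. \<bar>A n \<omega>\<bar> \<le> d))"

lemma OpE:
  assumes "Op A" "e > 0"
  obtains K where "K > 0" "\<forall>\<^sub>F n in sequentially.
     outside e (\<lambda>\<omega>. \<bar>A n \<omega>\<bar> \<le> K)"
proof -
  obtain K where K: "\<forall>\<^sub>F n in sequentially.
     outside e (\<lambda>\<omega>. \<bar>A n \<omega>\<bar> \<le> K)"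
    using assms unfolding Op_def by blast
  have "\<forall>\<^sub>F n in sequentially.
     outside e (\<lambda>\<omega>. \<bar>A n \<omega>\<bar> \<le> max K 1)"
    using K by eventually_elim (meson max.coboundedI1)
  then show ?thesis by (rule that[rotated]) auto
qed

lemma exceptional_union:
  assumes "E \<in> events \<and> prob E \<le> e1" "F \<in> events \<and> prob F \<le> e2"
  shows "E \<union> F \<in> events" "prob (E \<union> F) \<le> e1 + e2"
  using assms measure_Un_le[of E M F] by auto

lemma eventually_exceptional2:
  assumes "\<forall>\<^sub>F n in sequentially. outside e1 (\<lambda>\<omega>. P n \<omega>)"
    and "\<forall>\<^sub>F n in sequentially. outside e2 (\<lambda>\<omega>. Q n \<omega>)"
    and "\<And>n \<omega>. n \<ge> N \<Longrightarrow> \<omega> \<in> space M \<Longrightarrow> P n \<omega> \<Longrightarrow> Q n \<omega> \<Longrightarrow> R n \<omega>"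
    and "e1 + e2 \<le> e"
  shows "\<forall>\<^sub>F n in sequentially. outside e (\<lambda>\<omega>. R n \<omega>)"
  using assms(1,2) eventually_ge_at_top[of N]
proof eventually_elim
  case (elim n)
  then obtain E F where E: "E \<in> events" "prob E \<le> e1" "\<forall>\<omega>\<in>space M - E. P n \<omega>"
    and F: "F \<in> events" "prob F \<le> e2" "\<forall>\<omega>\<in>space M - F. Q n \<omega>" by blast
  have "E \<union> F \<in> events" "prob (E \<union> F) \<le> e"
    using exceptional_union[of E e1 F e2] E F assms(4) by auto
  moreover have "\<forall>\<omega>\<in>space M - (E \<union> F). R n \<omega>" using E F elim(3) assms(3) by auto
  ultimately show ?case by blast
qed

lemma op_imp_Op: "op A \<Longrightarrow> Op A"
  unfolding op_def Op_def by (intro allI impI exI[of _ 1]) simp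

lemma op_cong:
  assumes "op A" "\<And>n \<omega>. \<omega> \<in> space M \<Longrightarrow> n \<ge> N \<Longrightarrow> \<bar>B n \<omega>\<bar> \<le> \<bar>A n \<omega>\<bar>"
  shows "op B"
  unfolding op_def
proof (intro allI impI)
  fix e d :: real assume "e > 0" "d > 0"
  then have "\<forall>\<^sub>F n in sequentially. outside e (\<lambda>\<omega>. \<bar>A n \<omega>\<bar> \<le> d)"
    using assms(1) unfolding op_def by blast
  moreover have "\<forall>\<^sub>F n in sequentially. n \<ge> N" by (rule eventually_ge_at_top)
  ultimately show "\<forall>\<^sub>F n in sequentially. outside e (\<lambda>\<omega>. \<bar>B n \<omega>\<bar> \<le> d)"
  proof eventually_elim
    case (elim n)
    then obtain E where E: "E \<in> events" "prob E \<le> e" "\<forall>\<omega>\<in>space M - E. \<bar>A n \<omega>\<bar> \<le> d" by blast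
    have "\<forall>\<omega>\<in>space M - E. \<bar>B n \<omega>\<bar> \<le> d" using E(3) assms(2) elim(2) by (meson DiffD1 order_trans)
    then show ?case using E by blast
  qed
qed

lemma Op_cong:
  assumes "Op A" "\<And>n \<omega>. \<omega> \<in> space M \<Longrightarrow> n \<ge> N \<Longrightarrow> \<bar>B n \<omega>\<bar> \<le> \<bar>A n \<omega>\<bar>"
  shows "Op B"
  unfolding Op_def
proof (intro allI impI)
  fix e :: real assume "e > 0"
  then obtain K where "\<forall>\<^sub>F n in sequentially. outside e (\<lambda>\<omega>. \<bar>A n \<omega>\<bar> \<le> K)"
    using assms(1) unfolding Op_def by blast
  moreover have "\<forall>\<^sub>F n in sequentially. n \<ge> N" by (rule eventually_ge_at_top)
  ultimately have "\<forall>\<^sub>F n in sequentially. outside e (\<lambda>\<omega>. \<bar>B n \<omega>\<bar> \<le> K)"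
  proof eventually_elim
    case (elim n)
    then obtain E where E: "E \<in> events" "prob E \<le> e" "\<forall>\<omega>\<in>space M - E. \<bar>A n \<omega>\<bar> \<le> K" by blast
    have "\<forall>\<omega>\<in>space M - E. \<bar>B n \<omega>\<bar> \<le> K" using E(3) assms(2) elim(2) by (meson DiffD1 order_trans)
    then show ?case using E by blast
  qed
  then show "\<exists>K. \<forall>\<^sub>F n in sequentially. outside e (\<lambda>\<omega>. \<bar>B n \<omega>\<bar> \<le> K)" ..
qed

lemma op_add:
  assumes "op A" "op B" shows "op (\<lambda>n \<omega>. A n \<omega> + B n \<omega>)"
  unfolding op_def
proof (intro allI impI)
  fix e d :: real assume *: "e > 0" "d > 0"
  show "\<forall>\<^sub>F n in sequentially. outside e (\<lambda>\<omega>. \<bar>A n \<omega> + B n \<omega>\<bar> \<le> d)"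
    by (rule eventually_exceptional2[OF assms(1)[unfolded op_def, rule_format, of "e/2" "d/2"]
          assms(2)[unfolded op_def, rule_format, of "e/2" "d/2"], where N=0]) (use * in auto)
qed

lemma Op_add:
  assumes "Op A" "Op B" shows "Op (\<lambda>n \<omega>. A n \<omega> + B n \<omega>)"
  unfolding Op_def
proof (intro allI impI)
  fix e :: real assume e: "e > 0"
  then have e2: "e/2 > 0" by simp
  obtain K where K: "\<forall>\<^sub>F n in sequentially. outside (e/2) (\<lambda>\<omega>. \<bar>A n \<omega>\<bar> \<le> K)"
    using OpE[OF assms(1) e2] by blast
  obtain L where L: "\<forall>\<^sub>F n in sequentially. outside (e/2) (\<lambda>\<omega>. \<bar>B n \<omega>\<bar> \<le> L)"
    using OpE[OF assms(2) e2] by blast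
  have "\<forall>\<^sub>F n in sequentially. outside e (\<lambda>\<omega>. \<bar>A n \<omega> + B n \<omega>\<bar> \<le> K + L)"
    by (rule eventually_exceptional2[OF K L, where N=0]) auto
  then show "\<exists>K. \<forall>\<^sub>F n in sequentially. outside e (\<lambda>\<omega>. \<bar>A n \<omega> + B n \<omega>\<bar> \<le> K)" ..
qed

lemma Op_mult:
  assumes "Op A" "Op B" shows "Op (\<lambda>n \<omega>. A n \<omega> * B n \<omega>)"
  unfolding Op_def
proof (intro allI impI)
  fix e :: real assume e: "e > 0"
  then have e2: "e/2 > 0" by simp
  obtain K where K: "K > 0" "\<forall>\<^sub>F n in sequentially. outside (e/2) (\<lambda>\<omega>. \<bar>A n \<omega>\<bar> \<le> K)"
    using OpE[OF assms(1) e2] by blast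
  obtain L where L: "L > 0" "\<forall>\<^sub>F n in sequentially. outside (e/2) (\<lambda>\<omega>. \<bar>B n \<omega>\<bar> \<le> L)"
    using OpE[OF assms(2) e2] by blast
  have "\<forall>\<^sub>F n in sequentially. outside e (\<lambda>\<omega>. \<bar>A n \<omega> * B n \<omega>\<bar> \<le> K * L)"
    by (rule eventually_exceptional2[OF K(2) L(2), where N=0]) (use K(1) L(1) in \<open>auto simp: abs_mult intro!: mult_mono\<close>)
  then show "\<exists>K. \<forall>\<^sub>F n in sequentially. outside e (\<lambda>\<omega>. \<bar>A n \<omega> * B n \<omega>\<bar> \<le> K)" ..
qed

lemma op_mult_Op:
  assumes "op A" "Op B" shows "op (\<lambda>n \<omega>. A n \<omega> * B n \<omega>)"
  unfolding op_def
proof (intro allI impI)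
  fix e d :: real assume *: "e > 0" "d > 0"
  then have e2: "e/2 > 0" by simp
  obtain L where L: "L > 0" "\<forall>\<^sub>F n in sequentially. outside (e/2) (\<lambda>\<omega>. \<bar>B n \<omega>\<bar> \<le> L)"
    using OpE[OF assms(2) e2] by blast
  have dL: "d/L > 0" using * L by simp
  have "\<bar>x * y\<bar> \<le> d" if "\<bar>x\<bar> \<le> d/L" "\<bar>y\<bar> \<le> L" for x y
  proof -
    have "\<bar>x * y\<bar> \<le> d/L * L" unfolding abs_mult using that dL by (intro mult_mono) auto
    then show ?thesis using L by simp
  qed
  then show "\<forall>\<^sub>F n in sequentially. outside e (\<lambda>\<omega>. \<bar>A n \<omega> * B n \<omega>\<bar> \<le> d)"
    by (intro eventually_exceptional2[OF assms(1)[unfolded op_def, rule_format, OF e2 dL] L(2), where N=0]) auto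
qed

lemma Op_mult_op: "Op A \<Longrightarrow> op B \<Longrightarrow> op (\<lambda>n \<omega>. A n \<omega> * B n \<omega>)"
  using op_mult_Op[of B A] by (simp add: mult.commute)

lemma op_of_tendsto:
  assumes "f \<longlonglongrightarrow> 0" shows "op (\<lambda>n \<omega>. f n)"
  unfolding op_def
proof (intro allI impI)
  fix e d :: real assume *: "e > 0" "d > 0"
  then have "\<forall>\<^sub>F n in sequentially. \<bar>f n\<bar> < d"
    using assms by (auto simp: tendsto_iff dist_real_def)
  then show "\<forall>\<^sub>F n in sequentially. outside e (\<lambda>\<omega>. \<bar>f n\<bar> \<le> d)"
    by eventually_elim (use * in \<open>auto intro!: bexI[of _ "{}"]\<close>)
qed

lemma Op_fun: "Op (\<lambda>n. f)" if f: "f \<in> borel_measurable M"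
proof -
  have "\<exists>K::nat. prob {\<omega>\<in>space M. \<bar>f \<omega>\<bar> > K} \<le> e" if "e > 0" for e
  proof -
    have "(\<lambda>n. prob {\<omega>\<in>space M. \<bar>f \<omega>\<bar> > real n}) \<longlonglongrightarrow> prob (\<Inter>n::nat. {\<omega>\<in>space M. \<bar>f \<omega>\<bar> > real n})"
      by (intro finite_Lim_measure_decseq) (use f in \<open>auto simp: decseq_def\<close>)
    also have "(\<Inter>n::nat. {\<omega>\<in>space M. \<bar>f \<omega>\<bar> > real n}) = {}"
    proof -
      have "\<omega> \<notin> (\<Inter>n::nat. {\<omega>\<in>space M. \<bar>f \<omega>\<bar> > real n})" for \<omega>
      proof -
        obtain n :: nat where "\<bar>f \<omega>\<bar> < real n" using reals_Archimedean2 by blast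
        then have "\<not> real n < \<bar>f \<omega>\<bar>" by simp
        then show ?thesis by blast
      qed
      then show ?thesis by blast
    qed
    finally have "\<forall>\<^sub>F n in sequentially. prob {\<omega>\<in>space M. \<bar>f \<omega>\<bar> > real n} < e"
      using that by (auto simp: order_tendsto_iff)
    then obtain n where "prob {\<omega>\<in>space M. \<bar>f \<omega>\<bar> > real n} < e"
      by (auto simp: eventually_sequentially)
    then show ?thesis by (intro exI[of _ n]) auto
  qed
  then show ?thesis
    unfolding Op_def
  proof (intro allI impI)
    fix e :: real assume "e > 0"
    then obtain K :: nat where K: "prob {\<omega>\<in>space M. \<bar>f \<omega>\<bar> > K} \<le> e"
      using \<open>\<And>e. e > 0 \<Longrightarrow> \<exists>K::nat. prob {\<omega>\<in>space M. \<bar>f \<omega>\<bar> > K} \<le> e\<close> by blast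
    show "\<exists>K. \<forall>\<^sub>F n in sequentially. outside e (\<lambda>\<omega>. \<bar>f \<omega>\<bar> \<le> K)"
      by (intro exI[of _ "real K"] always_eventually allI bexI[of _ "{\<omega>\<in>space M. \<bar>f \<omega>\<bar> > K}"])
        (use K f in auto)
  qed
qed

lemma Op_const: "Op (\<lambda>n \<omega>. k)" by (rule Op_fun) simp

lemma op_zero: "op (\<lambda>n \<omega>. 0)" by (rule op_of_tendsto) simp

lemma op_cmult: "op A \<Longrightarrow> op (\<lambda>n \<omega>. k * A n \<omega>)"
  by (rule Op_mult_op[OF Op_const])

lemma Op_cmult: "Op A \<Longrightarrow> Op (\<lambda>n \<omega>. k * A n \<omega>)"
  by (rule Op_mult[OF Op_const])

lemma op_uminus: "op A \<Longrightarrow> op (\<lambda>n \<omega>. - A n \<omega>)"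
  using op_cmult[of A "-1"] by simp

lemma Op_uminus: "Op A \<Longrightarrow> Op (\<lambda>n \<omega>. - A n \<omega>)"
  using Op_cmult[of A "-1"] by simp

lemma op_diff: "op A \<Longrightarrow> op B \<Longrightarrow> op (\<lambda>n \<omega>. A n \<omega> - B n \<omega>)"
  using op_add[OF _ op_uminus, of A B] by simp

lemma Op_diff: "Op A \<Longrightarrow> Op B \<Longrightarrow> Op (\<lambda>n \<omega>. A n \<omega> - B n \<omega>)"
  using Op_add[OF _ Op_uminus, of A B] by simp

lemma op_sum:
  assumes "\<And>i. i \<in> I \<Longrightarrow> op (A i)" shows "op (\<lambda>n \<omega>. \<Sum>i\<in>I. A i n \<omega>)"
  using assms by (induction I rule: infinite_finite_induct) (auto intro: op_zero op_add)

lemma Op_sum: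
  assumes "\<And>i. i \<in> I \<Longrightarrow> Op (A i)" shows "Op (\<lambda>n \<omega>. \<Sum>i\<in>I. A i n \<omega>)"
  using assms by (induction I rule: infinite_finite_induct) (auto intro: Op_const Op_add)

lemma op_eq:
  assumes "op A" "\<And>n \<omega>. \<omega> \<in> space M \<Longrightarrow> n \<ge> N \<Longrightarrow> B n \<omega> = A n \<omega>" shows "op B"
  by (rule op_cong[OF assms(1), where N=N]) (use assms(2) in auto)

lemma Op_eq:
  assumes "Op A" "\<And>n \<omega>. \<omega> \<in> space M \<Longrightarrow> n \<ge> N \<Longrightarrow> B n \<omega> = A n \<omega>" shows "Op B"
  by (rule Op_cong[OF assms(1), where N=N]) (use assms(2) in auto)

lemma op_inverse:
  assumes "op (\<lambda>n \<omega>. A n \<omega> - k)" "k \<noteq> 0"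
  shows "op (\<lambda>n \<omega>. inverse (A n \<omega>) - inverse k)"
  unfolding op_def
proof (intro allI impI)
  fix e d :: real assume *: "e > 0" "d > 0"
  \<comment> \<open>The first bound keeps |x| \<ge> |k| / 2; then the difference of the inverses is
    at most 2 |x - k| / k^2, which the second bound brings down to \<open>d\<close>.\<close>
  define \<delta> where "\<delta> = min (\<bar>k\<bar> / 2) (d * \<bar>k\<bar>\<^sup>2 / 2)"
  have \<delta>: "\<delta> > 0" using * assms(2) by (auto simp: \<delta>_def)
  have "\<bar>inverse x - inverse k\<bar> \<le> d" if "\<bar>x - k\<bar> \<le> \<delta>" for x
  proof -
    have "\<bar>x - k\<bar> \<le> \<bar>k\<bar> / 2" using that by (simp add: \<delta>_def)
    then have x: "\<bar>x\<bar> \<ge> \<bar>k\<bar> / 2" by linarith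
    then have x0: "x \<noteq> 0" using assms(2) by auto
    have "\<bar>inverse x - inverse k\<bar> = \<bar>x - k\<bar> / (\<bar>x\<bar> * \<bar>k\<bar>)"
      using x0 assms(2) by (simp add: field_simps abs_mult[symmetric] abs_minus_commute flip: abs_divide)
    also have "\<dots> \<le> (d * \<bar>k\<bar>\<^sup>2 / 2) / (\<bar>k\<bar> / 2 * \<bar>k\<bar>)"
      using that x assms(2) * by (intro frac_le mult_right_mono mult_pos_pos) (auto simp: \<delta>_def)
    also have "\<dots> = d" using assms(2) by (simp add: power2_eq_square)
    finally show ?thesis .
  qed
  moreover have "\<forall>\<^sub>F n in sequentially. outside e (\<lambda>\<omega>. \<bar>A n \<omega> - k\<bar> \<le> \<delta>)"
    using assms(1) * \<delta> unfolding op_def by blast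
  ultimately show "\<forall>\<^sub>F n in sequentially. outside e (\<lambda>\<omega>. \<bar>inverse (A n \<omega>) - inverse k\<bar> \<le> d)"
    by (elim eventually_mono) blast
qed

lemma Op_of_op_diff: "op (\<lambda>n \<omega>. A n \<omega> - k) \<Longrightarrow> Op A"
  using Op_add[OF op_imp_Op Op_const, of "\<lambda>n \<omega>. A n \<omega> - k" k] by simp

text \<open>Where \<open>H\<close> is at most 1/2, the term containing \<open>A\<close> moves to the
  left and leaves |A| \<le> 2 |B|. This serves sequences about which nothing is known beforehand,
  such as the scaled error of the estimator.\<close>

lemma op_absorb:
  assumes H: "op H" and B: "Op B"
    and le: "\<And>n \<omega>. \<omega> \<in> space M \<Longrightarrow> n \<ge> N \<Longrightarrow> \<bar>A n \<omega>\<bar> \<le> H n \<omega> * \<bar>A n \<omega>\<bar> + B n \<omega>"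
  shows "Op A"
  unfolding Op_def
proof (intro allI impI)
  fix e :: real assume e: "e > 0"
  then have e2: "e/2 > 0" by simp
  obtain K where K: "K > 0" "\<forall>\<^sub>F n in sequentially. outside (e/2) (\<lambda>\<omega>. \<bar>B n \<omega>\<bar> \<le> K)"
    using OpE[OF B e2] by blast
  have "x \<le> 2 * K" if "\<bar>h\<bar> \<le> 1/2" "\<bar>b\<bar> \<le> K" "x \<le> h * x + b" "x \<ge> 0" for x h b :: real
  proof -
    have "h * x \<le> 1/2 * x" using that by (intro mult_right_mono) auto
    then show ?thesis using that by linarith
  qed
  note bound = this
  have "\<forall>\<^sub>F n in sequentially. outside e (\<lambda>\<omega>. \<bar>A n \<omega>\<bar> \<le> 2 * K)"
  proof (rule eventually_exceptional2[OF H[unfolded op_def, rule_format, of "e/2" "1/2"] K(2), where N=N])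
    fix n \<omega> assume "N \<le> n" "\<omega> \<in> space M" "\<bar>H n \<omega>\<bar> \<le> 1/2" "\<bar>B n \<omega>\<bar> \<le> K"
    then show "\<bar>A n \<omega>\<bar> \<le> 2 * K" using le by (intro bound[of "H n \<omega>" "B n \<omega>"]) auto
  qed (use e in auto)
  then show "\<exists>K. \<forall>\<^sub>F n in sequentially. outside e (\<lambda>\<omega>. \<bar>A n \<omega>\<bar> \<le> K)" ..
qed

lemma markov_abs:
  assumes f: "integrable M f" and E: "expectation (\<lambda>\<omega>. \<bar>f \<omega>\<bar>) \<le> C" and k: "k > (0::real)"
  shows "prob {\<omega>\<in>space M. \<bar>f \<omega>\<bar> \<ge> k} \<le> C / k"
proof -
  have "prob {\<omega>\<in>space M. k \<le> \<bar>f \<omega>\<bar>} \<le> expectation (\<lambda>\<omega>. \<bar>f \<omega>\<bar>) / k"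
    using f k by (intro integral_Markov_inequality_measure[where A="{}"]) auto
  also have "\<dots> \<le> C / k" using E k by (simp add: divide_right_mono)
  finally show ?thesis .
qed

lemma Op_of_L1_bound:
  assumes "\<And>n. integrable M (A n)" "\<And>n. n \<ge> N \<Longrightarrow> expectation (\<lambda>\<omega>. \<bar>A n \<omega>\<bar>) \<le> C"
  shows "Op A"
  unfolding Op_def
proof (intro allI impI)
  fix e :: real assume e: "e > 0"
  define K where "K = max C 1 / e"
  have K: "K > 0" using e by (auto simp: K_def)
  have "prob {\<omega>\<in>space M. \<bar>A n \<omega>\<bar> \<ge> K} \<le> e" if "n \<ge> N" for n
  proof -
    have "prob {\<omega>\<in>space M. \<bar>A n \<omega>\<bar> \<ge> K} \<le> max C 1 / K"
      using assms(2)[OF that] K by (intro markov_abs assms) auto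
    then show ?thesis using e by (simp add: K_def)
  qed
  moreover have "{\<omega>\<in>space M. \<bar>A n \<omega>\<bar> \<ge> K} \<in> events" for n
    using borel_measurable_integrable[OF assms(1)[of n]] by measurable
  ultimately have "outside e (\<lambda>\<omega>. \<bar>A n \<omega>\<bar> \<le> K)" if "n \<ge> N" for n
    using that by (intro bexI[of _ "{\<omega>\<in>space M. \<bar>A n \<omega>\<bar> \<ge> K}"]) auto
  then show "\<exists>K. \<forall>\<^sub>F n in sequentially. outside e (\<lambda>\<omega>. \<bar>A n \<omega>\<bar> \<le> K)"
    by (intro exI[of _ K] eventually_sequentiallyI[of N]) auto
qed

lemma Op_of_L2_bound:
  assumes m: "\<And>n. A n \<in> borel_measurable M" and i: "\<And>n. integrable M (\<lambda>\<omega>. (A n \<omega>)\<^sup>2)"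
    and "\<And>n. n \<ge> N \<Longrightarrow> expectation (\<lambda>\<omega>. (A n \<omega>)\<^sup>2) \<le> C"
  shows "Op A"
proof -
  have "Op (\<lambda>n \<omega>. 1 + (A n \<omega>)\<^sup>2)"
    by (intro Op_add Op_const Op_of_L1_bound[where N=N and C=C]) (use assms in auto)
  then show ?thesis
  proof (rule Op_cong)
    fix n \<omega>
    have "\<bar>x\<bar> \<le> 1 + x\<^sup>2" for x :: real
      using zero_le_power2[of "\<bar>x\<bar> - 1"] by (simp add: power2_diff)
    from this[of "A n \<omega>"] show "\<bar>A n \<omega>\<bar> \<le> \<bar>1 + (A n \<omega>)\<^sup>2\<bar>" by simp
  qed
qed

text \<open>The function \<open>iexp\<close> is 1-Lipschitz and bounded by 1: off the exceptional
  event the integrands differ by at most |t| d, on it by at most 2. This is Slutsky's lemma for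
  characteristic functions.\<close>

lemma op_char_diff:
  assumes A: "\<And>n. A n \<in> borel_measurable M" and B: "\<And>n. n \<ge> N \<Longrightarrow> B n \<in> borel_measurable M"
    and op: "op (\<lambda>n \<omega>. A n \<omega> - B n \<omega>)"
    and lim: "(\<lambda>n. expectation (\<lambda>\<omega>. iexp (t * A n \<omega>))) \<longlonglongrightarrow> l"
  shows "(\<lambda>n. expectation (\<lambda>\<omega>. iexp (t * B n \<omega>))) \<longlonglongrightarrow> (l::complex)"
proof -
  have "(\<lambda>n. expectation (\<lambda>\<omega>. iexp (t * B n \<omega>)) - expectation (\<lambda>\<omega>. iexp (t * A n \<omega>))) \<longlonglongrightarrow> 0"
  proof (rule tendstoI)
    fix e :: real assume e: "e > 0"
    \<comment> \<open>With this \<open>d\<close> and an exceptional event of probability at most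
      e/8, each of the two contributions is at most e/4; the summand 1 covers t = 0.\<close>
    define d where "d = e / (4 * (\<bar>t\<bar> + 1))"
    have d: "d > 0" using e by (auto simp: d_def)
    have "\<forall>\<^sub>F n in sequentially. outside (e/8) (\<lambda>\<omega>. \<bar>A n \<omega> - B n \<omega>\<bar> \<le> d)"
      using e d by (intro op[unfolded op_def, rule_format]) auto
    then show "\<forall>\<^sub>F n in sequentially. dist (expectation (\<lambda>\<omega>. iexp (t * B n \<omega>)) - expectation (\<lambda>\<omega>. iexp (t * A n \<omega>))) 0 < e"
      using eventually_ge_at_top[of N]
    proof eventually_elim
      case (elim n)
      then obtain E where E: "E \<in> events" "prob E \<le> e/8" "\<forall>\<omega>\<in>space M - E. \<bar>A n \<omega> - B n \<omega>\<bar> \<le> d" by blast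
      note [measurable] = A[of n] B[OF elim(2)] E(1)
      have iA: "integrable M (\<lambda>\<omega>. iexp (t * A n \<omega>))" and iB: "integrable M (\<lambda>\<omega>. iexp (t * B n \<omega>))"
        by (auto intro!: integrable_const_bound[where B=1])
      have "expectation (\<lambda>\<omega>. iexp (t * B n \<omega>)) - expectation (\<lambda>\<omega>. iexp (t * A n \<omega>))
          = expectation (\<lambda>\<omega>. iexp (t * B n \<omega>) - iexp (t * A n \<omega>))"
        using iA iB by simp
      also have "norm \<dots> \<le> expectation (\<lambda>\<omega>. norm (iexp (t * B n \<omega>) - iexp (t * A n \<omega>)))"
        by (rule integral_norm_bound)
      also have "\<dots> \<le> expectation (\<lambda>\<omega>. \<bar>t\<bar> * d + 2 * indicator E \<omega>)"
      proof (rule integral_mono)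
        fix \<omega> assume \<omega>: "\<omega> \<in> space M"
        show "norm (iexp (t * B n \<omega>) - iexp (t * A n \<omega>)) \<le> \<bar>t\<bar> * d + 2 * indicator E \<omega>"
        proof (cases "\<omega> \<in> E")
          case True
          have "norm (iexp (t * B n \<omega>) - iexp (t * A n \<omega>)) \<le> 1 + 1"
            by (rule order.trans[OF norm_triangle_ineq4]) simp
          also have "\<dots> \<le> \<bar>t\<bar> * d + 2 * indicator E \<omega>" using True d by simp
          finally show ?thesis .
        next
          case False
          have "iexp (x + y) = iexp x * iexp y" for x y by (simp add: distrib_left exp_add)
          from this[of "t * A n \<omega>" "t * (B n \<omega> - A n \<omega>)"]
          have "iexp (t * B n \<omega>) - iexp (t * A n \<omega>) = iexp (t * A n \<omega>) * (iexp (t * (B n \<omega> - A n \<omega>)) - 1)"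
            by (simp only: right_diff_distrib mult_1_right) (simp only: add_diff_cancel_left' add_diff_eq)
          then have "norm (iexp (t * B n \<omega>) - iexp (t * A n \<omega>)) = norm (iexp (t * (B n \<omega> - A n \<omega>)) - 1)"
            by (simp add: norm_mult)
          also have "\<dots> \<le> \<bar>t * (B n \<omega> - A n \<omega>)\<bar>"
            using iexp_approx1[of "t * (B n \<omega> - A n \<omega>)" 0] by simp
          also have "\<dots> \<le> \<bar>t\<bar> * d"
            using E(3) False \<omega> by (auto simp: abs_mult abs_minus_commute intro!: mult_left_mono)
          finally show ?thesis using False by simp
        qed
      next
        show "integrable M (\<lambda>\<omega>. norm (iexp (t * B n \<omega>) - iexp (t * A n \<omega>)))"
          by (intro integrable_norm Bochner_Integration.integrable_diff iA iB)
      qed (auto simp: emeasure_eq_measure)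
      also have "\<dots> = \<bar>t\<bar> * d + 2 * prob E"
        by (subst Bochner_Integration.integral_add) (auto simp: emeasure_eq_measure prob_space)
      also have "\<dots> < e"
      proof -
        have "\<bar>t\<bar> * d \<le> e/4" using e by (simp add: d_def field_simps)
        then show ?thesis using E(2) e by simp
      qed
      finally show ?case by (simp add: dist_norm)
    qed
  qed
  from tendsto_add[OF this lim] show ?thesis by simp
qed

lemma div_sqrt_Op:
  assumes "Op A" shows "op (\<lambda>n \<omega>. A n \<omega> / sqrt (real n))"
proof -
  have "(\<lambda>n. inverse (sqrt (real n))) \<longlonglongrightarrow> 0"
    by (rule tendsto_inverse_0_at_top[OF filterlim_compose[OF sqrt_at_top filterlim_real_sequentially]])
  then have "op (\<lambda>n \<omega>. A n \<omega> * inverse (sqrt (real n)))"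
    by (intro Op_mult_op[OF assms] op_of_tendsto)
  then show ?thesis by (simp add: divide_inverse)
qed

lemma op_div_n: 
  assumes "Op (\<lambda>n \<omega>. A n \<omega> / sqrt (real n))" shows "op (\<lambda>n \<omega>. A n \<omega> / real n)"
  using div_sqrt_Op[OF assms] by (rule op_eq[where N=0]) (simp flip: real_sqrt_mult)

lemma Op_div_n: "Op A \<Longrightarrow> op (\<lambda>n \<omega>. A n \<omega> / real n)"
  by (rule op_div_n[OF op_imp_Op[OF div_sqrt_Op]])

lemma integrable_mult_of_squares:
  assumes "f \<in> borel_measurable M" "g \<in> borel_measurable M"
    "integrable M (\<lambda>\<omega>. (f \<omega>)\<^sup>2)" "integrable M (\<lambda>\<omega>. (g \<omega> :: real)\<^sup>2)"
  shows "integrable M (\<lambda>\<omega>. f \<omega> * g \<omega>)"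
proof (rule Bochner_Integration.integrable_bound)
  show "integrable M (\<lambda>\<omega>. (f \<omega>)\<^sup>2 + (g \<omega>)\<^sup>2)" using assms by simp
  have "\<bar>x * y\<bar> \<le> x\<^sup>2 + y\<^sup>2" for x y :: real
  proof -
    have "0 \<le> (\<bar>x\<bar> - \<bar>y\<bar>)\<^sup>2" "0 \<le> \<bar>x\<bar> * \<bar>y\<bar>" by simp_all
    then show ?thesis unfolding power2_diff power2_abs abs_mult by linarith
  qed
  then show "AE x in M. norm (f x * g x) \<le> norm ((f x)\<^sup>2 + (g x)\<^sup>2)" by auto
qed (use assms in auto)

lemma integrable_square_add:
  assumes "f \<in> borel_measurable M" "g \<in> borel_measurable M"
    "integrable M (\<lambda>\<omega>. (f \<omega>)\<^sup>2)" "integrable M (\<lambda>\<omega>. (g \<omega> :: real)\<^sup>2)"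
  shows "integrable M (\<lambda>\<omega>. (f \<omega> + g \<omega>)\<^sup>2)"
  unfolding power2_sum using assms integrable_mult_of_squares[OF assms] by (simp add: mult.assoc)

lemma op_bounded_expectation:
  assumes A: "\<And>n. A n \<in> borel_measurable M" and op: "op A"
    and bd: "\<And>n \<omega>. \<omega> \<in> space M \<Longrightarrow> \<bar>A n \<omega>\<bar> \<le> B"
  shows "(\<lambda>n. expectation (\<lambda>\<omega>. \<bar>A n \<omega>\<bar>)) \<longlonglongrightarrow> 0"
proof (rule tendstoI)
  fix e :: real assume e: "e > 0"
  have B: "B \<ge> 0" using not_empty bd[of _ 0] by fastforce
  define d where "d = e / (4 * (B + 1))"
  have d: "d > 0" using e B by (simp add: d_def)
  have Bd: "B * d \<le> e / 4" using e B by (simp add: d_def field_simps)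
  have "\<forall>\<^sub>F n in sequentially. outside d (\<lambda>\<omega>. \<bar>A n \<omega>\<bar> \<le> e/4)"
    using e d by (intro op[unfolded op_def, rule_format]) auto
  then show "\<forall>\<^sub>F n in sequentially. dist (expectation (\<lambda>\<omega>. \<bar>A n \<omega>\<bar>)) 0 < e"
  proof eventually_elim
    case (elim n)
    then obtain E where E: "E \<in> events" "prob E \<le> d" "\<forall>\<omega>\<in>space M - E. \<bar>A n \<omega>\<bar> \<le> e/4" by blast
    have "expectation (\<lambda>\<omega>. \<bar>A n \<omega>\<bar>) \<le> expectation (\<lambda>\<omega>. e/4 + B * indicator E \<omega>)"
    proof (rule integral_mono)
      show "integrable M (\<lambda>\<omega>. \<bar>A n \<omega>\<bar>)"
        using A[of n] bd by (intro integrable_const_bound[where B=B]) auto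
      show "integrable M (\<lambda>\<omega>. e/4 + B * indicator E \<omega>)"
        using E by (auto simp: emeasure_eq_measure)
      show "\<bar>A n \<omega>\<bar> \<le> e/4 + B * indicator E \<omega>" if "\<omega> \<in> space M" for \<omega>
        using E(3) bd[OF that, of n] that e by (cases "\<omega> \<in> E") auto
    qed
    also have "\<dots> = e/4 + B * prob E"
      using E by (subst Bochner_Integration.integral_add) (auto simp: emeasure_eq_measure prob_space)
    also have "\<dots> \<le> e/4 + B * d" using E(2) B by (intro add_mono mult_left_mono) auto
    also have "\<dots> < e" using Bd e by simp
    finally show ?case by (simp add: integral_nonneg_AE)
  qed
qed

lemma Op_abs: "Op A \<Longrightarrow> Op (\<lambda>n \<omega>. \<bar>A n \<omega>\<bar>)"
  by (rule Op_cong[where N=0]) auto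

lemma op_abs: "op A \<Longrightarrow> op (\<lambda>n \<omega>. \<bar>A n \<omega>\<bar>)"
  by (rule op_cong[where N=0]) auto

text \<open>\<open>inverse\<close> is total, so an identity obtained by dividing holds only where
  the denominator is nonzero. A denominator that converges to \<open>k\<close> \<noteq> 0 is nonzero
  outside events of small probability, and the order symbol ignores those.\<close>

lemma op_off_zero:
  assumes A: "op (\<lambda>n \<omega>. A n \<omega> - k)" "k \<noteq> 0" and C: "op C"
    and eq: "\<And>n \<omega>. \<omega> \<in> space M \<Longrightarrow> n \<ge> N \<Longrightarrow> A n \<omega> \<noteq> 0 \<Longrightarrow> B n \<omega> = C n \<omega>"
  shows "op B"
  unfolding op_def
proof (intro allI impI)
  fix e d :: real assume ed: "e > 0" "d > 0"
  show "\<forall>\<^sub>F n in sequentially. outside e (\<lambda>\<omega>. \<bar>B n \<omega>\<bar> \<le> d)"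
  proof (rule eventually_exceptional2[OF A(1)[unfolded op_def, rule_format, of "e/2" "\<bar>k\<bar>/2"]
        C[unfolded op_def, rule_format, of "e/2" d], where N=N])
    fix n \<omega>
    assume n: "N \<le> n" and \<omega>: "\<omega> \<in> space M" and le: "\<bar>A n \<omega> - k\<bar> \<le> \<bar>k\<bar> / 2" and "\<bar>C n \<omega>\<bar> \<le> d"
    moreover have "A n \<omega> \<noteq> 0" using le A(2) by auto
    ultimately show "\<bar>B n \<omega>\<bar> \<le> d" using eq[OF \<omega> n] by simp
  qed (use ed A(2) in auto)
qed

text \<open>Equality up to a stochastically bounded error.\<close>

definition eqO :: "(nat \<Rightarrow> 'a \<Rightarrow> real) \<Rightarrow> (nat \<Rightarrow> 'a \<Rightarrow> real) \<Rightarrow> bool" where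
  "eqO A B \<longleftrightarrow> Op (\<lambda>n \<omega>. A n \<omega> - B n \<omega>)"

lemma eqO_refl: "eqO A A"
  unfolding eqO_def using Op_const[of 0] by simp

lemma eqO_sym: "eqO A B \<Longrightarrow> eqO B A"
  unfolding eqO_def using Op_uminus by force

lemma eqO_trans [trans]: "eqO A B \<Longrightarrow> eqO B C \<Longrightarrow> eqO A C"
  unfolding eqO_def using Op_add[of "\<lambda>n \<omega>. A n \<omega> - B n \<omega>" "\<lambda>n \<omega>. B n \<omega> - C n \<omega>"] by simp

lemma eqO_add: "eqO A B \<Longrightarrow> eqO C D \<Longrightarrow> eqO (\<lambda>n \<omega>. A n \<omega> + C n \<omega>) (\<lambda>n \<omega>. B n \<omega> + D n \<omega>)"
  unfolding eqO_def using Op_add[of "\<lambda>n \<omega>. A n \<omega> - B n \<omega>" "\<lambda>n \<omega>. C n \<omega> - D n \<omega>"] by (simp add: algebra_simps)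

lemma eqO_mult: "Op C \<Longrightarrow> eqO A B \<Longrightarrow> eqO (\<lambda>n \<omega>. C n \<omega> * A n \<omega>) (\<lambda>n \<omega>. C n \<omega> * B n \<omega>)"
  unfolding eqO_def using Op_mult[of C "\<lambda>n \<omega>. A n \<omega> - B n \<omega>"] by (simp add: algebra_simps)

lemma eqO_cmult: "eqO A B \<Longrightarrow> eqO (\<lambda>n \<omega>. c * A n \<omega>) (\<lambda>n \<omega>. c * B n \<omega>)"
  by (rule eqO_mult[OF Op_const])

lemma eqO_diff: "eqO A B \<Longrightarrow> eqO C D \<Longrightarrow> eqO (\<lambda>n \<omega>. A n \<omega> - C n \<omega>) (\<lambda>n \<omega>. B n \<omega> - D n \<omega>)"
  using eqO_add[OF _ eqO_cmult[of C D "-1"]] by simp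

lemma eqO_sum:
  "(\<And>i. i \<in> I \<Longrightarrow> eqO (A i) (B i)) \<Longrightarrow> eqO (\<lambda>n \<omega>. \<Sum>i\<in>I. A i n \<omega>) (\<lambda>n \<omega>. \<Sum>i\<in>I. B i n \<omega>)"
  unfolding eqO_def sum_subtractf[symmetric] by (rule Op_sum)

lemma eqO_0: "eqO A (\<lambda>n \<omega>. 0) \<longleftrightarrow> Op A"
  by (simp add: eqO_def)

lemma eqO_eq: "(\<And>n \<omega>. \<omega> \<in> space M \<Longrightarrow> n \<ge> N \<Longrightarrow> A n \<omega> = B n \<omega>) \<Longrightarrow> eqO A B"
  unfolding eqO_def by (rule Op_eq[OF Op_const[of 0], where N=N]) auto

end

section \<open>A martingale central limit theorem\<close>

lemma (in prob_space) indep_set_mono: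
  "indep_set A B \<Longrightarrow> A' \<subseteq> A \<Longrightarrow> B' \<subseteq> B \<Longrightarrow> indep_set A' B'"
  unfolding indep_sets2_eq by blast

locale innovations = prob_space M for M :: "'a measure" +
  fixes V :: "nat \<Rightarrow> 'a \<Rightarrow> real" and v :: real
  assumes V_indep: "indep_vars (\<lambda>_. borel) V {1..}"
    and V_ident: "n \<ge> 1 \<Longrightarrow> distr M borel (V n) = distr M borel (V 1)"
    and V_square: "n \<ge> 1 \<Longrightarrow> integrable M (\<lambda>\<omega>. (V n \<omega>)\<^sup>2)"
    and V_mean: "n \<ge> 1 \<Longrightarrow> expectation (V n) = 0"
    and V_second: "n \<ge> 1 \<Longrightarrow> expectation (\<lambda>\<omega>. (V n \<omega>)\<^sup>2) = v"
begin

lemma V_meas: "n \<ge> 1 \<Longrightarrow> V n \<in> borel_measurable M"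
  using V_indep by (auto simp: indep_vars_def)

lemma V_integrable: "n \<ge> 1 \<Longrightarrow> integrable M (V n)"
  using square_integrable_imp_integrable[OF V_meas V_square] by simp

lemma v_nonneg: "v \<ge> 0"
  using V_second[of 1] by (metis integral_nonneg_AE AE_I2 zero_le_power2 order_refl)

section \<open>Filtration of the innovations and orthogonality of martingale increments\<close>

definition past :: "nat \<Rightarrow> 'a \<Rightarrow> nat \<Rightarrow> real" where
  "past k \<omega> = restrict (\<lambda>i. V i \<omega>) {1..k}"

text \<open>The sigma-algebra generated by the first k innovations, encoded as the pullback of a
  product space so that its independence of the next innovation follows from independence of
  disjoint index blocks.\<close>

definition F :: "nat \<Rightarrow> 'a measure" where
  "F k = vimage_algebra (space M) (past k) (PiM {1..k} (\<lambda>_. borel))"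

lemma past_space: "past k \<in> space M \<rightarrow> space (PiM {1..k} (\<lambda>_. borel))"
  by (auto simp: past_def space_PiM)

lemma space_F [simp]: "space (F k) = space M"
  by (simp add: F_def)

lemma sets_F: "sets (F k) = {past k -` A \<inter> space M | A. A \<in> sets (PiM {1..k} (\<lambda>_. borel))}"
  unfolding F_def by (rule sets_vimage_algebra2[OF past_space])

lemma V_F: "1 \<le> j \<Longrightarrow> j \<le> k \<Longrightarrow> V j \<in> borel_measurable (F k)"
proof -
  assume j: "1 \<le> j" "j \<le> k"
  have "(\<lambda>\<omega>. past k \<omega> j) \<in> borel_measurable (F k)"
    unfolding F_def
    by (rule measurable_compose[OF measurable_vimage_algebra1[OF past_space]])
       (use j in \<open>auto intro!: measurable_component_singleton\<close>)
  then show ?thesis using j by (simp add: past_def)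
qed

lemma id_F_M: "(\<lambda>\<omega>. \<omega>) \<in> measurable M (F k)"
  unfolding F_def
proof (rule measurable_vimage_algebra2)
  show "past k \<in> measurable M (PiM {1..k} (\<lambda>_. borel))"
    unfolding past_def by (rule measurable_restrict) (auto intro: V_meas)
qed auto

lemma id_F_F: "j \<le> k \<Longrightarrow> (\<lambda>\<omega>. \<omega>) \<in> measurable (F k) (F j)"
  unfolding F_def[of j]
proof (rule measurable_vimage_algebra2)
  assume "j \<le> k"
  then show "past j \<in> measurable (F k) (PiM {1..j} (\<lambda>_. borel))"
    unfolding past_def by (intro measurable_restrict) (auto intro: V_F)
qed auto

lemma F_M: "f \<in> borel_measurable (F k) \<Longrightarrow> f \<in> borel_measurable M"
  by (rule measurable_compose[OF id_F_M])

lemma F_mono: "f \<in> borel_measurable (F j) \<Longrightarrow> j \<le> k \<Longrightarrow> f \<in> borel_measurable (F k)"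
  by (rule measurable_compose[OF id_F_F])

lemma indep_F:
  assumes "A \<in> sets (F k)" "B \<in> sets borel"
  shows "prob (A \<inter> (V (Suc k) -` B \<inter> space M)) = prob A * prob (V (Suc k) -` B \<inter> space M)"
proof -
  obtain A' where A': "A' \<in> sets (PiM {1..k} (\<lambda>_. borel))" "A = past k -` A' \<inter> space M"
    using assms(1) unfolding sets_F by blast
  define W where "W \<omega> = restrict (\<lambda>i. V i \<omega>) {Suc k}" for \<omega>
  define B' where "B' = (\<lambda>x. x (Suc k)) -` B \<inter> space (PiM {Suc k} (\<lambda>_. borel :: real measure))"
  have B': "B' \<in> sets (PiM {Suc k} (\<lambda>_. borel))"
    unfolding B'_def using assms(2) by (intro measurable_sets[where A="borel"] measurable_component_singleton) auto
  have iv: "indep_var (PiM {1..k} (\<lambda>_. borel)) (past k) (PiM {Suc k} (\<lambda>_. borel)) W"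
    using indep_var_restrict[OF V_indep, of "{1..k}" "{Suc k}"] by (auto simp: past_def[abs_def] W_def[abs_def])
  have W: "W -` B' \<inter> space M = V (Suc k) -` B \<inter> space M"
    by (auto simp: W_def B'_def space_PiM)
  have "(\<lambda>x. (past k x, W x)) -` (A' \<times> B') \<inter> space M = A \<inter> (V (Suc k) -` B \<inter> space M)"
    using W unfolding A' by auto
  with indep_varD[OF iv A'(1) B'] show ?thesis
    by (simp add: W A'(2)[symmetric])
qed

definition law :: "real measure" where
  "law = distr M borel (V 1)"

lemma law_eq: "n \<ge> 1 \<Longrightarrow> distr M borel (V n) = law"
  unfolding law_def by (rule V_ident)

sublocale law: real_distribution law
  unfolding law_def by (rule real_distribution_distr) (rule V_meas, simp)

text \<open>Plays the role of conditioning on the past: the joint law of the past and the next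
  innovation is a product, so Fubini allows the innovation to be integrated out with the past
  frozen.\<close>

lemma expectation_past_V:
  fixes f :: "'a \<times> real \<Rightarrow> 'b :: {banach, second_countable_topology}"
  assumes f: "f \<in> borel_measurable (F k \<Otimes>\<^sub>M borel)"
    and i: "integrable M (\<lambda>\<omega>. f (\<omega>, V (Suc k) \<omega>))"
  shows "expectation (\<lambda>\<omega>. f (\<omega>, V (Suc k) \<omega>)) = expectation (\<lambda>\<omega>. \<integral>y. f (\<omega>, y) \<partial>law)"
proof -
  have mV [measurable]: "V (Suc k) \<in> borel_measurable M" by (rule V_meas) simp
  note id_F_M [measurable]
  note f [measurable]
  define P where "P = distr M (F k) (\<lambda>\<omega>. \<omega>)"
  define Q where "Q = distr M borel (V (Suc k))"
  interpret P: prob_space P unfolding P_def by (rule prob_space_distr) simp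
  interpret Q: prob_space Q unfolding Q_def by (rule prob_space_distr) simp
  interpret PQ: pair_sigma_finite P Q ..
  \<comment> \<open>Independence determines the joint law on rectangles, and these generate the
    product sigma-algebra.\<close>
  have PQ_eq: "P \<Otimes>\<^sub>M Q = distr M (F k \<Otimes>\<^sub>M borel) (\<lambda>\<omega>. (\<omega>, V (Suc k) \<omega>))"
  proof (rule pair_measure_eqI)
    fix A B assume A: "A \<in> sets P" and B: "B \<in> sets Q"
    then have A': "A \<in> sets (F k)" "A \<inter> space M = A" and B': "B \<in> sets borel"
      using sets.sets_into_space[of A "F k"] by (auto simp: P_def Q_def)
    have "A \<in> events" using measurable_sets[OF id_F_M A'(1)] A'(2) by (simp add: vimage_def)
    have "emeasure P A * emeasure Q B = ennreal (prob A * prob (V (Suc k) -` B \<inter> space M))"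
      unfolding P_def Q_def using A' B' by (simp add: emeasure_distr emeasure_eq_measure ennreal_mult)
    also have "\<dots> = emeasure M (A \<inter> (V (Suc k) -` B \<inter> space M))"
      using indep_F[OF A'(1) B'] by (simp add: emeasure_eq_measure)
    also have "A \<inter> (V (Suc k) -` B \<inter> space M) = (\<lambda>\<omega>. (\<omega>, V (Suc k) \<omega>)) -` (A \<times> B) \<inter> space M"
      by auto
    also have "emeasure M \<dots> = emeasure (distr M (F k \<Otimes>\<^sub>M borel) (\<lambda>\<omega>. (\<omega>, V (Suc k) \<omega>))) (A \<times> B)"
      using A' B' by (subst emeasure_distr) auto
    finally show "emeasure P A * emeasure Q B = emeasure (distr M (F k \<Otimes>\<^sub>M borel) (\<lambda>\<omega>. (\<omega>, V (Suc k) \<omega>))) (A \<times> B)" .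
  qed (auto simp: P_def Q_def P.sigma_finite_measure_axioms[unfolded P_def] Q.sigma_finite_measure_axioms[unfolded Q_def]
        cong: sets_pair_measure_cong)
  have fPQ: "integrable (P \<Otimes>\<^sub>M Q) f"
    unfolding PQ_eq using i by (subst integrable_distr_eq) auto
  have Q1: "Q = law" unfolding Q_def by (rule law_eq) simp
  have sQ: "sets Q = sets borel" by (simp add: Q_def)
  have inner: "(\<lambda>\<omega>. \<integral>y. f (\<omega>, y) \<partial>Q) \<in> borel_measurable (F k)"
    by (rule Q.borel_measurable_lebesgue_integral) (use f sQ in \<open>simp cong: measurable_cong_sets sets_pair_measure_cong\<close>)
  have "expectation (\<lambda>\<omega>. f (\<omega>, V (Suc k) \<omega>)) = integral\<^sup>L (P \<Otimes>\<^sub>M Q) f"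
    unfolding PQ_eq by (subst integral_distr) auto
  also have "\<dots> = (\<integral>\<omega>. \<integral>y. f (\<omega>, y) \<partial>Q \<partial>P)"
    by (rule PQ.integral_fst'[OF fPQ, symmetric])
  also have "\<dots> = expectation (\<lambda>\<omega>. \<integral>y. f (\<omega>, y) \<partial>Q)"
    unfolding P_def using inner by (subst integral_distr) auto
  finally show ?thesis unfolding Q1 .
qed

lemma indep_past_V:
  assumes "Z \<in> borel_measurable (F k)" "g \<in> borel_measurable borel"
  shows "indep_var borel Z borel (\<lambda>\<omega>. g (V (Suc k) \<omega>))"
proof -
  let ?G = "{V (Suc k) -` A \<inter> space M | A. A \<in> sets borel}"
  have mV [measurable]: "V (Suc k) \<in> borel_measurable M" by (rule V_meas) simp
  have G: "sets (vimage_algebra (space M) (V (Suc k)) borel) = ?G"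
    by (rule sets_vimage_algebra2) auto
  have 1: "sigma_sets (space M) {Z -` A \<inter> space M | A. A \<in> sets borel} \<subseteq> sets (F k)"
    using sets.sigma_sets_subset[of "{Z -` A \<inter> space M | A. A \<in> sets borel}" "F k"]
      measurable_sets[OF assms(1)] by auto
  have "(\<lambda>\<omega>. g (V (Suc k) \<omega>)) \<in> borel_measurable (vimage_algebra (space M) (V (Suc k)) borel)"
    by (rule measurable_compose[OF measurable_vimage_algebra1 assms(2)]) auto
  from measurable_sets[OF this]
  have "sigma_sets (space M) {(\<lambda>\<omega>. g (V (Suc k) \<omega>)) -` A \<inter> space M | A. A \<in> sets borel}
      \<subseteq> sets (vimage_algebra (space M) (V (Suc k)) borel)"
    using sets.sigma_sets_subset[of "{(\<lambda>\<omega>. g (V (Suc k) \<omega>)) -` A \<inter> space M | A. A \<in> sets borel}"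
      "vimage_algebra (space M) (V (Suc k)) borel"] by auto
  then have 2: "sigma_sets (space M) {(\<lambda>\<omega>. g (V (Suc k) \<omega>)) -` A \<inter> space M | A. A \<in> sets borel} \<subseteq> ?G"
    unfolding G .
  have "sets (F k) \<subseteq> events"
  proof
    fix A assume A: "A \<in> sets (F k)"
    then have "A \<inter> space M = A" using sets.sets_into_space[of A "F k"] by auto
    then show "A \<in> events" using measurable_sets[OF id_F_M A] by (simp add: vimage_def)
  qed
  then have "indep_set (sets (F k)) ?G"
    unfolding indep_sets2_eq using indep_F[of _ k] by (auto intro: measurable_sets[OF mV])
  then have "indep_set (sigma_sets (space M) {Z -` A \<inter> space M | A. A \<in> sets borel})
     (sigma_sets (space M) {(\<lambda>\<omega>. g (V (Suc k) \<omega>)) -` A \<inter> space M | A. A \<in> sets borel})"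
    by (rule indep_set_mono[OF _ 1 2])
  moreover have "Z \<in> borel_measurable M" by (rule F_M[OF assms(1)])
  moreover have "(\<lambda>\<omega>. g (V (Suc k) \<omega>)) \<in> borel_measurable M"
    using assms(2) by measurable
  ultimately show ?thesis unfolding indep_var_eq by (intro conjI)
qed

lemma past_times_V:
  assumes Z: "Z \<in> borel_measurable (F k)" "integrable M Z"
  shows "integrable M (\<lambda>\<omega>. Z \<omega> * V (Suc k) \<omega>)" "expectation (\<lambda>\<omega>. Z \<omega> * V (Suc k) \<omega>) = 0"
  using indep_var_integrable[OF indep_past_V[OF Z(1), of "\<lambda>x. x"] Z(2)]
    indep_var_lebesgue_integral[OF indep_past_V[OF Z(1), of "\<lambda>x. x"] Z(2)]
    V_integrable[of "Suc k"] V_mean[of "Suc k"] by auto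

lemma past_times_V_square:
  assumes Z: "Z \<in> borel_measurable (F k)" "integrable M (\<lambda>\<omega>. (Z \<omega>)\<^sup>2)"
  shows "integrable M (\<lambda>\<omega>. (Z \<omega> * V (Suc k) \<omega>)\<^sup>2)"
    "expectation (\<lambda>\<omega>. (Z \<omega> * V (Suc k) \<omega>)\<^sup>2) = expectation (\<lambda>\<omega>. (Z \<omega>)\<^sup>2) * v"
proof -
  have m: "(\<lambda>\<omega>. (Z \<omega>)\<^sup>2) \<in> borel_measurable (F k)" using Z by measurable
  note * = indep_past_V[OF m, of "\<lambda>x. x\<^sup>2"]
  show "integrable M (\<lambda>\<omega>. (Z \<omega> * V (Suc k) \<omega>)\<^sup>2)"
    unfolding power_mult_distrib using V_square[of "Suc k"] by (intro indep_var_integrable * Z) auto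
  show "expectation (\<lambda>\<omega>. (Z \<omega> * V (Suc k) \<omega>)\<^sup>2) = expectation (\<lambda>\<omega>. (Z \<omega>)\<^sup>2) * v"
    unfolding power_mult_distrib using V_square[of "Suc k"] V_second[of "Suc k"]
    by (subst indep_var_lebesgue_integral) (auto intro!: * Z)
qed

text \<open>The increments are orthogonal: in the expansion of the square, the cross term is the
  product of \<open>V (Suc n)\<close> with a variable depending on the past only, so its mean is 0.
  Each increment contributes at most \<open>K * v\<close>.\<close>

lemma martingale_second_moment:
  assumes Z: "\<And>k. Z k \<in> borel_measurable (F k)" "\<And>k. integrable M (\<lambda>\<omega>. (Z k \<omega>)\<^sup>2)"
    and K: "\<And>k. expectation (\<lambda>\<omega>. (Z k \<omega>)\<^sup>2) \<le> K"
  defines "T \<equiv> \<lambda>n \<omega>. \<Sum>k<n. Z k \<omega> * V (Suc k) \<omega>"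
  shows "T n \<in> borel_measurable (F n)" "integrable M (\<lambda>\<omega>. (T n \<omega>)\<^sup>2)"
    "expectation (\<lambda>\<omega>. (T n \<omega>)\<^sup>2) \<le> n * (K * v)"
proof -
  show meas: "T n \<in> borel_measurable (F n)" for n
    unfolding T_def by (intro borel_measurable_sum borel_measurable_times) (auto intro: F_mono[OF Z(1)] V_F)
  have "integrable M (\<lambda>\<omega>. (T n \<omega>)\<^sup>2) \<and> expectation (\<lambda>\<omega>. (T n \<omega>)\<^sup>2) \<le> n * (K * v)"
  proof (induction n)
    case (Suc n)
    let ?z = "\<lambda>\<omega>. Z n \<omega> * V (Suc n) \<omega>"
    have T: "T (Suc n) \<omega> = T n \<omega> + ?z \<omega>" for \<omega> by (simp add: T_def)
    have mz: "?z \<in> borel_measurable M"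
      using F_M[OF Z(1)] V_meas by (intro borel_measurable_times) auto
    have int: "integrable M (\<lambda>\<omega>. T n \<omega> * Z n \<omega>)"
      using Suc Z F_M[OF meas] F_M[OF Z(1)] by (intro integrable_mult_of_squares) auto
    note c = past_times_V[OF borel_measurable_times[OF meas[of n] Z(1)] int]
    note s = past_times_V_square[OF Z, of n]
    have eq: "(T (Suc n) \<omega>)\<^sup>2 = (T n \<omega>)\<^sup>2 + 2 * (T n \<omega> * Z n \<omega> * V (Suc n) \<omega>) + (?z \<omega>)\<^sup>2" for \<omega>
      unfolding T power2_sum by (simp add: mult.assoc)
    have "expectation (\<lambda>\<omega>. (T (Suc n) \<omega>)\<^sup>2) = expectation (\<lambda>\<omega>. (T n \<omega>)\<^sup>2) + expectation (\<lambda>\<omega>. (Z n \<omega>)\<^sup>2) * v"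
      unfolding eq using Suc c s by simp
    also have "\<dots> \<le> n * (K * v) + K * v"
      using Suc K v_nonneg by (intro add_mono mult_right_mono) auto
    finally have "expectation (\<lambda>\<omega>. (T (Suc n) \<omega>)\<^sup>2) \<le> Suc n * (K * v)" by (simp add: algebra_simps)
    moreover have "integrable M (\<lambda>\<omega>. (T (Suc n) \<omega>)\<^sup>2)"
      unfolding eq using Suc c s by simp
    ultimately show ?case by simp
  qed (simp add: T_def)
  then show "integrable M (\<lambda>\<omega>. (T n \<omega>)\<^sup>2)" "expectation (\<lambda>\<omega>. (T n \<omega>)\<^sup>2) \<le> n * (K * v)" by auto
qed

lemma martingale_Op:
  assumes Z: "\<And>k. Z k \<in> borel_measurable (F k)" "\<And>k. integrable M (\<lambda>\<omega>. (Z k \<omega>)\<^sup>2)"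
    and K: "\<And>k. expectation (\<lambda>\<omega>. (Z k \<omega>)\<^sup>2) \<le> K"
  shows "Op (\<lambda>n \<omega>. (\<Sum>k<n. Z k \<omega> * V (Suc k) \<omega>) / sqrt n)"
proof (rule Op_of_L2_bound)
  note * = martingale_second_moment[OF assms]
  show "(\<lambda>\<omega>. (\<Sum>k<n. Z k \<omega> * V (Suc k) \<omega>) / sqrt n) \<in> borel_measurable M" for n
    using F_M[OF *(1)] by measurable
  show "integrable M (\<lambda>\<omega>. ((\<Sum>k<n. Z k \<omega> * V (Suc k) \<omega>) / sqrt n)\<^sup>2)" for n
    unfolding power_divide using *(2) by (intro integrable_divide) auto
  show "expectation (\<lambda>\<omega>. ((\<Sum>k<n. Z k \<omega> * V (Suc k) \<omega>) / sqrt n)\<^sup>2) \<le> K * v" if "n \<ge> 1" for n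
    unfolding power_divide using *(3)[of n] that by (simp add: field_simps)
qed

end

section \<open>Characteristic functions with exponential compensation\<close>

lemma exp_times_one_minus:
  fixes x :: real assumes "x \<ge> 0"
  shows "\<bar>exp x * (1 - x) - 1\<bar> \<le> exp x * x\<^sup>2"
proof -
  have "exp x * (1 - x) \<le> exp x * exp (- x)"
    using exp_ge_add_one_self[of "- x"] by (intro mult_left_mono) auto
  then have 1: "exp x * (1 - x) \<le> 1" by (simp flip: exp_add)
  then have "x * (exp x - 1) \<le> x * (x * exp x)"
    using assms by (intro mult_left_mono) (auto simp: algebra_simps)
  then have "x * exp x - x \<le> exp x * x\<^sup>2" by (simp add: algebra_simps power2_eq_square)
  moreover have "exp x * (1 - x) = exp x - x * exp x" by (simp add: algebra_simps)
  ultimately have "1 - exp x * (1 - x) \<le> exp x * x\<^sup>2"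
    using exp_ge_add_one_self[of x] by linarith
  with 1 show ?thesis by simp
qed

context innovations
begin

abbreviation "chV \<equiv> char law"

text \<open>Second-order Taylor expansion; the linear term is absent because the innovations are
  centred. Keeping only the cubic side of the minimum yields an error of order n^(-3/2) once
  \<open>s\<close> is of order 1 / sqrt n.\<close>

lemma chV_bound:
  assumes "integrable M (\<lambda>\<omega>. \<bar>V 1 \<omega>\<bar> ^ 3)"
  shows "cmod (chV s - (1 - s\<^sup>2 * v / 2)) \<le> \<bar>s\<bar> ^ 3 * expectation (\<lambda>\<omega>. \<bar>V 1 \<omega>\<bar> ^ 3)"
proof -
  have m [measurable]: "V 1 \<in> borel_measurable M" by (rule V_meas) simp
  have "cmod (chV s - (1 - s\<^sup>2 * v / 2)) \<le> (s\<^sup>2 / 6) * expectation (\<lambda>\<omega>. min (6 * (V 1 \<omega>)\<^sup>2) (\<bar>s\<bar> * \<bar>V 1 \<omega>\<bar> ^ 3))"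
    using char_approx3'[OF m V_integrable V_square V_mean _ law_def, of v s] V_mean[of 1] V_second[of 1] by simp
  also have "\<dots> \<le> (s\<^sup>2 / 6) * expectation (\<lambda>\<omega>. \<bar>s\<bar> * \<bar>V 1 \<omega>\<bar> ^ 3)"
  proof (intro mult_left_mono integral_mono)
    show "integrable M (\<lambda>\<omega>. min (6 * (V 1 \<omega>)\<^sup>2) (\<bar>s\<bar> * \<bar>V 1 \<omega>\<bar> ^ 3))"
      using assms V_square[of 1] by (intro integrable_min) auto
  qed (use assms in auto)
  also have "\<dots> = \<bar>s\<bar> ^ 3 * expectation (\<lambda>\<omega>. \<bar>V 1 \<omega>\<bar> ^ 3) / 6"
    by (simp add: power3_eq_cube power2_eq_square abs_mult[symmetric] flip: abs_mult)
  also have "\<dots> \<le> \<bar>s\<bar> ^ 3 * expectation (\<lambda>\<omega>. \<bar>V 1 \<omega>\<bar> ^ 3)"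
    by (simp add: integral_nonneg_AE)
  finally show ?thesis .
qed

text \<open>The exponential factor compensates the decay of the characteristic function of \<open>s V\<close>, so that
  expectations are nearly preserved from one step to the next.\<close>

lemma compensated_step:
  fixes P :: "'a \<Rightarrow> complex"
  assumes V3: "integrable M (\<lambda>\<omega>. \<bar>V 1 \<omega>\<bar> ^ 3)"
    and P [measurable]: "P \<in> borel_measurable (F k)" and Pb: "\<And>\<omega>. \<omega> \<in> space M \<Longrightarrow> cmod (P \<omega>) \<le> C"
    and s [measurable]: "s \<in> borel_measurable (F k)"
    and sb: "\<And>\<omega>. \<omega> \<in> space M \<Longrightarrow> (s \<omega>)\<^sup>2 * v / 2 \<le> L"
    and s4: "integrable M (\<lambda>\<omega>. (s \<omega>) ^ 4)" and s3: "integrable M (\<lambda>\<omega>. \<bar>s \<omega>\<bar> ^ 3)"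
  shows "cmod (expectation (\<lambda>\<omega>. P \<omega> * exp ((s \<omega>)\<^sup>2 * v / 2) * iexp (s \<omega> * V (Suc k) \<omega>)) - expectation P)
    \<le> C * exp L * (v\<^sup>2 * expectation (\<lambda>\<omega>. (s \<omega>) ^ 4)
        + expectation (\<lambda>\<omega>. \<bar>V 1 \<omega>\<bar> ^ 3) * expectation (\<lambda>\<omega>. \<bar>s \<omega>\<bar> ^ 3))"
proof -
  let ?x = "\<lambda>\<omega>. (s \<omega>)\<^sup>2 * v / 2" and ?m3 = "expectation (\<lambda>\<omega>. \<bar>V 1 \<omega>\<bar> ^ 3)"
  note [measurable] = F_M[OF s] V_meas[of "Suc k", simplified] 
  have [measurable]: "P \<in> borel_measurable M" by (rule measurable_compose[OF id_F_M P])
  have C: "C \<ge> 0" using not_empty Pb norm_ge_zero by (metis all_not_in_conv order_trans)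
  have m3: "?m3 \<ge> 0" by (simp add: integral_nonneg_AE)
  define f where "f = (\<lambda>(\<omega>, y). P \<omega> * complex_of_real (exp (?x \<omega>)) * iexp (s \<omega> * y))"
  have f_meas: "f \<in> borel_measurable (F k \<Otimes>\<^sub>M borel)"
    unfolding f_def by measurable
  have nb: "cmod (P \<omega> * complex_of_real (exp (?x \<omega>)) * z) \<le> C * exp L" if "\<omega> \<in> space M" "cmod z \<le> 1" for \<omega> z
  proof -
    have "cmod (P \<omega>) * exp (?x \<omega>) * cmod z \<le> C * exp L * 1"
      using Pb[OF that(1)] sb[OF that(1)] that(2) C by (intro mult_mono) auto
    then show ?thesis by (simp add: norm_mult)
  qed
  have i1: "integrable M (\<lambda>\<omega>. f (\<omega>, V (Suc k) \<omega>))"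
    unfolding f_def by (rule integrable_const_bound[where B="C * exp L"]) (auto intro!: nb)
  have int: "(\<integral>y. f (\<omega>, y) \<partial>law) = P \<omega> * exp (?x \<omega>) * chV (s \<omega>)" for \<omega>
    unfolding f_def char_def by simp
  have chm [measurable]: "chV \<in> borel_measurable borel" by (rule law.char_measurable)
  have i2: "integrable M (\<lambda>\<omega>. P \<omega> * complex_of_real (exp (?x \<omega>)) * chV (s \<omega>))"
    by (rule integrable_const_bound[where B="C * exp L"]) (auto intro!: nb law.cmod_char_le_1)
  have i3: "integrable M P"
    by (rule integrable_const_bound[where B=C]) (auto intro!: Pb)
  have "expectation (\<lambda>\<omega>. P \<omega> * exp (?x \<omega>) * iexp (s \<omega> * V (Suc k) \<omega>)) = expectation (\<lambda>\<omega>. P \<omega> * exp (?x \<omega>) * chV (s \<omega>))"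
    using expectation_past_V[OF f_meas i1] unfolding int by (simp add: f_def)
  then have "cmod (expectation (\<lambda>\<omega>. P \<omega> * exp (?x \<omega>) * iexp (s \<omega> * V (Suc k) \<omega>)) - expectation P)
      = cmod (expectation (\<lambda>\<omega>. P \<omega> * exp (?x \<omega>) * chV (s \<omega>) - P \<omega>))"
    using i2 i3 by simp
  also have "\<dots> \<le> expectation (\<lambda>\<omega>. cmod (P \<omega> * exp (?x \<omega>) * chV (s \<omega>) - P \<omega>))"
    by (rule integral_norm_bound)
  also have "\<dots> \<le> expectation (\<lambda>\<omega>. C * exp L * (v\<^sup>2 * (s \<omega>) ^ 4 + ?m3 * \<bar>s \<omega>\<bar> ^ 3))"
  proof (rule integral_mono)
    show "integrable M (\<lambda>\<omega>. cmod (P \<omega> * exp (?x \<omega>) * chV (s \<omega>) - P \<omega>))"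
      using i2 i3 by (intro integrable_norm Bochner_Integration.integrable_diff) auto
    show "integrable M (\<lambda>\<omega>. C * exp L * (v\<^sup>2 * (s \<omega>) ^ 4 + ?m3 * \<bar>s \<omega>\<bar> ^ 3))"
      using s3 s4 by auto
    fix \<omega> assume \<omega>: "\<omega> \<in> space M"
    let ?s = "s \<omega>" let ?y = "?x \<omega>"
    have y: "?y \<ge> 0" using v_nonneg by simp
    \<comment> \<open>The first part compares 1 - y with exp (- y), an error of second order in y;
      the second part is the Taylor error of \<open>chV\<close>, inflated by the
      compensator.\<close>
    have "exp ?y * chV ?s - 1 = complex_of_real (exp ?y * (1 - ?y) - 1) + exp ?y * (chV ?s - (1 - ?y))"
      by (simp add: algebra_simps)
    also have "cmod \<dots> \<le> cmod (complex_of_real (exp ?y * (1 - ?y) - 1)) + cmod (exp ?y * (chV ?s - (1 - ?y)))"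
      by (rule norm_triangle_ineq)
    also have "\<dots> = \<bar>exp ?y * (1 - ?y) - 1\<bar> + exp ?y * cmod (chV ?s - (1 - ?y))"
      by (simp only: norm_of_real norm_mult abs_exp_cancel)
    also have "\<dots> \<le> exp ?y * ?y\<^sup>2 + exp ?y * (\<bar>?s\<bar> ^ 3 * ?m3)"
      using chV_bound[OF V3, of ?s] by (intro add_mono exp_times_one_minus y mult_left_mono) auto
    also have "\<dots> = exp ?y * (?y\<^sup>2 + ?m3 * \<bar>?s\<bar> ^ 3)" by (simp add: algebra_simps)
    also have "\<dots> \<le> exp L * (v\<^sup>2 * ?s ^ 4 + ?m3 * \<bar>?s\<bar> ^ 3)"
    proof (intro mult_mono add_mono)
      have "?y\<^sup>2 = v\<^sup>2 * ?s ^ 4 / 4" by (simp add: power2_eq_square power4_eq_xxxx)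
      also have "\<dots> \<le> v\<^sup>2 * ?s ^ 4" by simp
      finally show "?y\<^sup>2 \<le> v\<^sup>2 * ?s ^ 4" .
    qed (use sb[OF \<omega>] m3 in auto)
    finally have b: "cmod (exp ?y * chV ?s - 1) \<le> exp L * (v\<^sup>2 * ?s ^ 4 + ?m3 * \<bar>?s\<bar> ^ 3)" .
    have "cmod (P \<omega> * exp ?y * chV ?s - P \<omega>) = cmod (P \<omega>) * cmod (exp ?y * chV ?s - 1)"
      by (simp add: algebra_simps flip: norm_mult)
    also have "\<dots> \<le> C * (exp L * (v\<^sup>2 * ?s ^ 4 + ?m3 * \<bar>?s\<bar> ^ 3))"
      using Pb[OF \<omega>] b C by (intro mult_mono) auto
    finally show "cmod (P \<omega> * exp ?y * chV ?s - P \<omega>) \<le> C * exp L * (v\<^sup>2 * ?s ^ 4 + ?m3 * \<bar>?s\<bar> ^ 3)"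
      by (simp add: mult.assoc)
  qed
  also have "\<dots> = C * exp L * (v\<^sup>2 * expectation (\<lambda>\<omega>. (s \<omega>) ^ 4) + ?m3 * expectation (\<lambda>\<omega>. \<bar>s \<omega>\<bar> ^ 3))"
    using s3 s4 by simp
  finally show ?thesis .
qed

end

lemma abs_exp_diff_le:
  fixes x y :: real assumes "x \<le> L" "y \<le> L"
  shows "\<bar>exp x - exp y\<bar> \<le> exp L * \<bar>x - y\<bar>"
proof -
  have *: "exp y - exp x \<le> exp L * (y - x)" if "x \<le> y" "y \<le> L" for x y :: real
  proof -
    have "exp y * (1 + (x - y)) \<le> exp y * exp (x - y)"
      by (intro mult_left_mono exp_ge_add_one_self) auto
    then have "exp y - exp x \<le> exp y * (y - x)" by (simp add: algebra_simps flip: exp_add)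
    also have "\<dots> \<le> exp L * (y - x)" using that by (intro mult_right_mono) auto
    finally show ?thesis .
  qed
  show ?thesis
    using *[of x y] *[of y x] assms by (cases "x \<le> y") (auto simp: abs_if)
qed

lemma abs_cube_le: "\<bar>x\<bar> ^ 3 \<le> 1 + (x :: real) ^ 4"
proof (cases "\<bar>x\<bar> \<le> 1")
  case True
  then have "\<bar>x\<bar> ^ 3 \<le> 1" by (simp add: power_le_one)
  then show ?thesis by (smt (verit) zero_le_even_power even_numeral)
next
  case False
  then have "\<bar>x\<bar> ^ 3 \<le> \<bar>x\<bar> ^ 4" by (intro power_increasing) auto
  then show ?thesis by (simp add: power_even_abs_numeral)
qed

context innovations
begin

text \<open>The expectation of exp (W + i N) starts at 1 and moves by O(n^(-3/2)) at each of n
  steps, hence tends to 1. As the compensator \<open>W\<close> tends in probability to the constant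
  \<open>l\<close> and stays below \<open>L\<close>, the factor exp (W) may be replaced by exp (l)
  and divided out. Nothing is divided by \<open>w\<close>, so w = 0 is covered.\<close>

lemma martingale_clt_char:
  assumes V3: "integrable M (\<lambda>\<omega>. \<bar>V 1 \<omega>\<bar> ^ 3)"
    and Y: "\<And>k. Y k \<in> borel_measurable (F k)" "\<And>k. integrable M (\<lambda>\<omega>. (Y k \<omega>) ^ 4)"
    and K: "\<And>k. expectation (\<lambda>\<omega>. (Y k \<omega>) ^ 4) \<le> K"
    and w: "w \<ge> 0" and avg: "op (\<lambda>n \<omega>. (\<Sum>k<n. (Y k \<omega>)\<^sup>2) / n - w)"
  shows "(\<lambda>n. expectation (\<lambda>\<omega>. iexp (t * ((\<Sum>k<n. Y k \<omega> * V (Suc k) \<omega>) / sqrt n))))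
    \<longlonglongrightarrow> complex_of_real (exp (- (t\<^sup>2 * v * w / 2)))"
proof -
  text \<open>Truncating when the empirical conditional variance gets too large keeps all the
    exponentials below bounded.\<close>
  define Z where "Z n k \<omega> = (if (\<Sum>j\<le>k. (Y j \<omega>)\<^sup>2) \<le> (w + 1) * real n then Y k \<omega> else 0)" for n k \<omega>
  define s where "s n k \<omega> = t * Z n k \<omega> / sqrt n" for n k \<omega>
  define W where "W n m \<omega> = (\<Sum>k<m. (s n k \<omega>)\<^sup>2 * v / 2)" for n m \<omega>
  define N where "N n m \<omega> = (\<Sum>k<m. s n k \<omega> * V (Suc k) \<omega>)" for n m \<omega>
  define P where "P n m \<omega> = complex_of_real (exp (W n m \<omega>)) * iexp (N n m \<omega>)" for n m \<omega>
  define L where "L = t\<^sup>2 * v * (w + 1) / 2"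
  define l where "l = t\<^sup>2 * v * w / 2"
  define m3 where "m3 = expectation (\<lambda>\<omega>. \<bar>V 1 \<omega>\<bar> ^ 3)"
  have lL: "l \<le> L" and l0: "l \<ge> 0" unfolding l_def L_def using v_nonneg w by (auto intro!: mult_left_mono)
  then have L0: "L \<ge> 0" by simp
  have K0: "K \<ge> 0" using K[of 0] by (rule order.trans[rotated]) (simp add: integral_nonneg_AE)
  have m30: "m3 \<ge> 0" by (simp add: m3_def integral_nonneg_AE)

  have Z_meas [measurable]: "Z n k \<in> borel_measurable (F k)" for n k
  proof -
    have [measurable]: "(\<lambda>\<omega>. \<Sum>j\<le>k. (Y j \<omega>)\<^sup>2) \<in> borel_measurable (F k)"
      by (intro borel_measurable_sum borel_measurable_power) (auto intro: F_mono[OF Y(1)])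
    have [measurable]: "Y k \<in> borel_measurable (F k)" by (rule Y)
    show ?thesis unfolding Z_def by measurable
  qed
  have s_meas [measurable]: "s n k \<in> borel_measurable (F k)" for n k
    unfolding s_def by measurable
  have W_meas [measurable]: "W n m \<in> borel_measurable (F m)" for n m
    unfolding W_def
    by (intro borel_measurable_sum borel_measurable_divide borel_measurable_times borel_measurable_power)
       (auto intro: F_mono[OF s_meas])
  have N_meas [measurable]: "N n m \<in> borel_measurable (F m)" for n m
    unfolding N_def
    by (intro borel_measurable_sum borel_measurable_times) (auto intro: F_mono[OF s_meas] V_F)
  have P_meas [measurable]: "P n m \<in> borel_measurable (F m)" for n m
    unfolding P_def by measurable

  \<comment> \<open>While the truncation is inactive, the sum is at most the sum of the squares of
    \<open>Y\<close>, which is below the level; once that sum exceeds the level, the new summand is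
    0.\<close>
  have Z_sum: "(\<Sum>k<m. (Z n k \<omega>)\<^sup>2) \<le> (w + 1) * real n" for n m \<omega>
  proof (induction m)
    case (Suc m)
    show ?case
    proof (cases "(\<Sum>j\<le>m. (Y j \<omega>)\<^sup>2) \<le> (w + 1) * real n")
      case True
      have "(\<Sum>k<Suc m. (Z n k \<omega>)\<^sup>2) \<le> (\<Sum>k<Suc m. (Y k \<omega>)\<^sup>2)"
        by (intro sum_mono) (auto simp: Z_def)
      then show ?thesis using True by (simp only: lessThan_Suc_atMost)
    next
      case False
      then have "Z n m \<omega> = 0" by (simp add: Z_def)
      then show ?thesis using Suc by simp
    qed
  qed (use w in simp)
  have Z_eq: "Z n k \<omega> = Y k \<omega>" if "(\<Sum>j<n. (Y j \<omega>)\<^sup>2) / n - w \<le> 1" "k < n" for n k \<omega>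
  proof -
    have n: "real n > 0" using that by simp
    have "(\<Sum>j\<le>k. (Y j \<omega>)\<^sup>2) \<le> (\<Sum>j<n. (Y j \<omega>)\<^sup>2)"
      using that by (intro sum_mono2) auto
    also have "\<dots> \<le> (w + 1) * real n" using that(1) n by (simp add: field_simps)
    finally show ?thesis by (simp add: Z_def)
  qed
  have W_eq: "W n m \<omega> = t\<^sup>2 * v / 2 * ((\<Sum>k<m. (Z n k \<omega>)\<^sup>2) / n)" for n m \<omega>
    unfolding W_def s_def
    by (simp add: power_divide power_mult_distrib sum_divide_distrib sum_distrib_left mult_ac)
  have W_le: "W n m \<omega> \<le> L" for n m \<omega>
  proof (cases "n = 0")
    case False
    have "t\<^sup>2 * v / 2 * ((\<Sum>k<m. (Z n k \<omega>)\<^sup>2) / n) \<le> t\<^sup>2 * v / 2 * (w + 1)"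
      using Z_sum[of n \<omega> m] False v_nonneg by (intro mult_left_mono) (auto simp: field_simps)
    then show ?thesis unfolding W_eq by (simp add: L_def)
  qed (use L0 in \<open>simp add: W_def s_def\<close>)
  have P_le: "cmod (P n m \<omega>) \<le> exp L" for n m \<omega>
    unfolding P_def using W_le by (simp add: norm_mult)
  have P_Suc: "P n (Suc m) \<omega> = P n m \<omega> * exp ((s n m \<omega>)\<^sup>2 * v / 2) * iexp (s n m \<omega> * V (Suc m) \<omega>)" for n m \<omega>
    unfolding P_def W_def N_def by (simp add: distrib_left exp_add)

  have Y3: "integrable M (\<lambda>\<omega>. \<bar>Y k \<omega>\<bar> ^ 3)" and Y3K: "expectation (\<lambda>\<omega>. \<bar>Y k \<omega>\<bar> ^ 3) \<le> 1 + K" for k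
  proof -
    have [measurable]: "Y k \<in> borel_measurable M" by (rule F_M[OF Y(1)])
    show i: "integrable M (\<lambda>\<omega>. \<bar>Y k \<omega>\<bar> ^ 3)"
      by (rule Bochner_Integration.integrable_bound[where f="\<lambda>\<omega>. 1 + (Y k \<omega>) ^ 4"])
         (use Y(2) abs_cube_le in \<open>auto simp: power_abs\<close>)
    have "expectation (\<lambda>\<omega>. \<bar>Y k \<omega>\<bar> ^ 3) \<le> expectation (\<lambda>\<omega>. 1 + (Y k \<omega>) ^ 4)"
      using i Y(2) by (intro integral_mono abs_cube_le) auto
    also have "\<dots> = 1 + expectation (\<lambda>\<omega>. (Y k \<omega>) ^ 4)" using Y(2) by (simp add: prob_space)
    finally show "expectation (\<lambda>\<omega>. \<bar>Y k \<omega>\<bar> ^ 3) \<le> 1 + K" using K[of k] by simp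
  qed
  have s_abs: "\<bar>s n k \<omega>\<bar> \<le> \<bar>t\<bar> / sqrt n * \<bar>Y k \<omega>\<bar>" for n k \<omega>
    by (auto simp: s_def Z_def abs_mult)
  have s_pow: "\<bar>s n k \<omega>\<bar> ^ q \<le> (\<bar>t\<bar> / sqrt n) ^ q * \<bar>Y k \<omega>\<bar> ^ q" for n k \<omega> q
    using power_mono[OF s_abs, of n k \<omega> q] by (simp only: power_mult_distrib)
  have s_int: "integrable M (\<lambda>\<omega>. \<bar>s n k \<omega>\<bar> ^ q)"
      "expectation (\<lambda>\<omega>. \<bar>s n k \<omega>\<bar> ^ q) \<le> (\<bar>t\<bar> / sqrt n) ^ q * C"
    if "integrable M (\<lambda>\<omega>. \<bar>Y k \<omega>\<bar> ^ q)" "expectation (\<lambda>\<omega>. \<bar>Y k \<omega>\<bar> ^ q) \<le> C" for n k q C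
  proof -
    have [measurable]: "s n k \<in> borel_measurable M" by (rule F_M[OF s_meas])
    show i: "integrable M (\<lambda>\<omega>. \<bar>s n k \<omega>\<bar> ^ q)"
      by (rule Bochner_Integration.integrable_bound[where f="\<lambda>\<omega>. (\<bar>t\<bar> / sqrt n) ^ q * \<bar>Y k \<omega>\<bar> ^ q"])
         (use that(1) s_pow in \<open>auto\<close>)
    have "expectation (\<lambda>\<omega>. \<bar>s n k \<omega>\<bar> ^ q) \<le> expectation (\<lambda>\<omega>. (\<bar>t\<bar> / sqrt n) ^ q * \<bar>Y k \<omega>\<bar> ^ q)"
      using i that(1) by (intro integral_mono s_pow) auto
    also have "\<dots> = (\<bar>t\<bar> / sqrt n) ^ q * expectation (\<lambda>\<omega>. \<bar>Y k \<omega>\<bar> ^ q)" by simp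
    also have "\<dots> \<le> (\<bar>t\<bar> / sqrt n) ^ q * C" using that(2) by (intro mult_left_mono) auto
    finally show "expectation (\<lambda>\<omega>. \<bar>s n k \<omega>\<bar> ^ q) \<le> (\<bar>t\<bar> / sqrt n) ^ q * C" .
  qed
  have pow4: "\<bar>x\<bar> ^ 4 = x ^ 4" for x :: real by (simp add: power_even_abs_numeral)
  note s3 = s_int[OF Y3 Y3K]
  have s4: "integrable M (\<lambda>\<omega>. s n k \<omega> ^ 4)" "expectation (\<lambda>\<omega>. s n k \<omega> ^ 4) \<le> (\<bar>t\<bar> / sqrt n) ^ 4 * K" for n k
    using s_int[of k 4 K n] Y(2) K unfolding pow4 by auto

  \<comment> \<open>The error of one step: one factor \<open>exp L\<close> bounds the product
    accumulated so far, the other the new compensating factor; the remaining terms are bounds for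
    the fourth and third moments of \<open>s n k\<close>.\<close>
  define d where "d n = exp L * exp L * (v\<^sup>2 * ((\<bar>t\<bar> / sqrt (real n)) ^ 4 * K) + m3 * ((\<bar>t\<bar> / sqrt (real n)) ^ 3 * (1 + K)))" for n
  have step: "cmod (expectation (P n (Suc m)) - expectation (P n m)) \<le> d n" for n m
  proof -
    have "cmod (expectation (P n (Suc m)) - expectation (P n m)) \<le>
        exp L * exp L * (v\<^sup>2 * expectation (\<lambda>\<omega>. (s n m \<omega>) ^ 4)
        + expectation (\<lambda>\<omega>. \<bar>V 1 \<omega>\<bar> ^ 3) * expectation (\<lambda>\<omega>. \<bar>s n m \<omega>\<bar> ^ 3))"
      unfolding P_Suc
    proof (rule compensated_step[OF V3 P_meas _ s_meas _ s4(1) s3(1)])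
      fix \<omega>
      have "(s n m \<omega>)\<^sup>2 * v / 2 = W n (Suc m) \<omega> - W n m \<omega>" by (simp add: W_def)
      also have "\<dots> \<le> W n (Suc m) \<omega>" unfolding W_def using v_nonneg by (auto intro: sum_nonneg)
      finally show "(s n m \<omega>)\<^sup>2 * v / 2 \<le> L" using W_le[of n "Suc m" \<omega>] by simp
    qed (rule P_le)
    also have "\<dots> \<le> d n"
      unfolding d_def m3_def[symmetric] using s3(2) s4(2) m30 by (intro mult_left_mono add_mono) auto
    finally show ?thesis .
  qed
  have "cmod (expectation (P n m) - 1) \<le> m * d n" for n m
  proof (induction m)
    case 0
    show ?case by (simp add: P_def W_def N_def prob_space)
  next
    case (Suc m)
    have "cmod (expectation (P n (Suc m)) - 1) \<le> cmod (expectation (P n (Suc m)) - expectation (P n m)) + cmod (expectation (P n m) - 1)"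
      by (rule order.trans[OF _ norm_triangle_ineq]) simp
    also have "\<dots> \<le> d n + m * d n" using step Suc by (intro add_mono)
    finally show ?case by (simp add: algebra_simps)
  qed
  then have P_bound: "cmod (expectation (P n n) - 1) \<le> n * d n" for n .
  have nd: "(\<lambda>n. n * d n) \<longlonglongrightarrow> 0"
  proof -
    have eq: "real n * d n = exp L * exp L * (v\<^sup>2 * (t ^ 4 * K) * inverse (real n) + m3 * (\<bar>t\<bar> ^ 3 * (1 + K)) * inverse (sqrt (real n)))"
      if "n \<ge> 1" for n
    proof -
      have n: "real n > 0" using that by simp
      then have sq: "sqrt (real n) * sqrt (real n) = real n" "sqrt (real n) > 0" by auto
      have 4: "real n * (\<bar>t\<bar> / sqrt (real n)) ^ 4 = t ^ 4 * inverse (real n)"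
        using n sq by (simp add: power_divide pow4 power4_eq_xxxx field_simps)
      have 3: "real n * (\<bar>t\<bar> / sqrt (real n)) ^ 3 = \<bar>t\<bar> ^ 3 * inverse (sqrt (real n))"
        using n sq by (simp add: power_divide power3_eq_cube field_simps)
      have "real n * d n = exp L * exp L * (v\<^sup>2 * K * (real n * (\<bar>t\<bar> / sqrt (real n)) ^ 4) + m3 * (1 + K) * (real n * (\<bar>t\<bar> / sqrt (real n)) ^ 3))"
        unfolding d_def by (simp add: algebra_simps)
      then show ?thesis unfolding 3 4 by (simp add: mult_ac)
    qed
    have lim: "(\<lambda>n. exp L * exp L * (v\<^sup>2 * (t ^ 4 * K) * inverse (real n) + m3 * (\<bar>t\<bar> ^ 3 * (1 + K)) * inverse (sqrt (real n)))) \<longlonglongrightarrow>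
       exp L * exp L * (v\<^sup>2 * (t ^ 4 * K) * 0 + m3 * (\<bar>t\<bar> ^ 3 * (1 + K)) * 0)"
      by (intro tendsto_intros filterlim_compose[OF tendsto_inverse_0_at_top] filterlim_ident
          filterlim_compose[OF sqrt_at_top] filterlim_real_sequentially tendsto_inverse_0_at_top)
    show ?thesis
      by (rule Lim_transform_eventually[OF lim[unfolded mult_zero_right add_0_right] eventually_sequentiallyI[of 1]])
         (rule eq[symmetric])
  qed
  have P_lim: "(\<lambda>n. expectation (P n n)) \<longlonglongrightarrow> 1"
  proof -
    have "(\<lambda>n. expectation (P n n) - 1) \<longlonglongrightarrow> 0"
      by (rule tendsto_norm_zero_cancel, rule tendsto_sandwich[OF _ _ tendsto_const nd])
         (auto intro!: always_eventually P_bound)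
    then show ?thesis by (rule LIM_zero_cancel)
  qed

  define G where "G n \<omega> = exp l - exp (W n n \<omega>)" for n \<omega>
  have G_op: "op G"
    unfolding op_def
  proof (intro allI impI)
    fix e d :: real assume ed: "e > 0" "d > 0"
    \<comment> \<open>The bound 1 makes the truncation inactive, so that \<open>Z\<close> agrees
      with \<open>Y\<close>. The other bound is dictated by the Lipschitz constant of the
      exponential below \<open>L\<close>; the added 1 avoids a zero denominator when that constant
      is 0.\<close>
    define \<delta> where "\<delta> = min 1 (d / (exp L * (t\<^sup>2 * v / 2) + 1))"
    have c0: "exp L * (t\<^sup>2 * v / 2) \<ge> 0" using v_nonneg by simp
    then have \<delta>: "\<delta> > 0" using ed by (auto simp: \<delta>_def intro!: divide_pos_pos)
    have "\<forall>\<^sub>F n in sequentially. outside e (\<lambda>\<omega>. \<bar>(\<Sum>k<n. (Y k \<omega>)\<^sup>2) / n - w\<bar> \<le> \<delta>)"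
      using avg ed \<delta> unfolding op_def by blast
    then show "\<forall>\<^sub>F n in sequentially. outside e (\<lambda>\<omega>. \<bar>G n \<omega>\<bar> \<le> d)"
    proof (rule eventually_mono)
      have "\<bar>G n \<omega>\<bar> \<le> d" if h: "\<bar>(\<Sum>k<n. (Y k \<omega>)\<^sup>2) / n - w\<bar> \<le> \<delta>" for n \<omega>
      proof -
        have "(\<Sum>k<n. (Z n k \<omega>)\<^sup>2) = (\<Sum>k<n. (Y k \<omega>)\<^sup>2)"
          using h by (intro sum.cong refl) (subst Z_eq, auto simp: \<delta>_def)
        then have "l - W n n \<omega> = t\<^sup>2 * v / 2 * (w - (\<Sum>k<n. (Y k \<omega>)\<^sup>2) / n)"
          unfolding W_eq l_def by (simp add: algebra_simps)
        moreover have "\<bar>t\<^sup>2 * v / 2\<bar> = t\<^sup>2 * v / 2" using v_nonneg by simp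
        ultimately have "\<bar>l - W n n \<omega>\<bar> = t\<^sup>2 * v / 2 * \<bar>(\<Sum>k<n. (Y k \<omega>)\<^sup>2) / n - w\<bar>"
          by (simp only: abs_mult abs_minus_commute)
        then have "\<bar>G n \<omega>\<bar> \<le> exp L * (t\<^sup>2 * v / 2 * \<bar>(\<Sum>k<n. (Y k \<omega>)\<^sup>2) / n - w\<bar>)"
          unfolding G_def using abs_exp_diff_le[OF lL W_le, of n n \<omega>] by (simp only:)
        also have "\<dots> \<le> exp L * (t\<^sup>2 * v / 2) * \<delta>"
          using h v_nonneg by (simp only: mult.assoc[symmetric]) (intro mult_left_mono, auto)
        also have "\<dots> \<le> exp L * (t\<^sup>2 * v / 2) * (d / (exp L * (t\<^sup>2 * v / 2) + 1))"
          using c0 by (intro mult_left_mono) (auto simp: \<delta>_def)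
        also have "\<dots> = d * (exp L * (t\<^sup>2 * v / 2) / (exp L * (t\<^sup>2 * v / 2) + 1))" by (simp only: times_divide_eq_right mult_ac)
        also have "\<dots> \<le> d * 1" using c0 ed by (intro mult_left_mono) auto
        finally show ?thesis by simp
      qed
      then show "outside e (\<lambda>\<omega>. \<bar>(\<Sum>k<n. (Y k \<omega>)\<^sup>2) / n - w\<bar> \<le> \<delta>) \<Longrightarrow>
          outside e (\<lambda>\<omega>. \<bar>G n \<omega>\<bar> \<le> d)" for n by blast
    qed
  qed
  have [measurable]: "W n m \<in> borel_measurable M" "N n m \<in> borel_measurable M" for n m
    by (auto intro: F_M[OF W_meas] F_M[OF N_meas])
  have G_meas [measurable]: "G n \<in> borel_measurable M" for n unfolding G_def by measurable
  have G_lim: "(\<lambda>n. expectation (\<lambda>\<omega>. \<bar>G n \<omega>\<bar>)) \<longlonglongrightarrow> 0"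
  proof (rule op_bounded_expectation[OF G_meas G_op])
    fix n \<omega>
    have "exp l \<le> exp L" "exp (W n n \<omega>) \<le> exp L" using lL W_le by auto
    moreover have "exp l > 0" "exp (W n n \<omega>) > 0" by auto
    ultimately show "\<bar>G n \<omega>\<bar> \<le> exp L" unfolding G_def by linarith
  qed
  \<comment> \<open>\<open>G\<close> is the price of replacing the random compensator by its limit;
    the factor \<open>iexp\<close> has modulus 1 and does not affect it.\<close>
  have diff: "cmod (expectation (\<lambda>\<omega>. iexp (N n n \<omega>)) * exp l - expectation (P n n)) \<le> expectation (\<lambda>\<omega>. \<bar>G n \<omega>\<bar>)" for n
  proof -
    have 1: "integrable M (\<lambda>\<omega>. iexp (N n n \<omega>))"
      by (rule integrable_const_bound[where B=1]) auto
    have "P n n \<in> borel_measurable M" by (rule measurable_compose[OF id_F_M P_meas])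
    then have 2: "integrable M (P n n)"
      by (intro integrable_const_bound[where B="exp L"]) (auto intro: P_le)
    have "expectation (\<lambda>\<omega>. iexp (N n n \<omega>)) * exp l - expectation (P n n) = expectation (\<lambda>\<omega>. iexp (N n n \<omega>) * exp l - P n n \<omega>)"
      using 1 2 by simp
    also have "cmod \<dots> \<le> expectation (\<lambda>\<omega>. cmod (iexp (N n n \<omega>) * exp l - P n n \<omega>))"
      by (rule integral_norm_bound)
    also have "(\<lambda>\<omega>. cmod (iexp (N n n \<omega>) * exp l - P n n \<omega>)) = (\<lambda>\<omega>. \<bar>G n \<omega>\<bar>)"
    proof
      fix \<omega>
      have "iexp (N n n \<omega>) * exp l - P n n \<omega> = iexp (N n n \<omega>) * complex_of_real (G n \<omega>)"
        by (simp only: P_def G_def of_real_diff right_diff_distrib mult.commute)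
      then show "cmod (iexp (N n n \<omega>) * exp l - P n n \<omega>) = \<bar>G n \<omega>\<bar>" by (simp add: norm_mult)
    qed
    finally show ?thesis .
  qed
  have "(\<lambda>n. expectation (\<lambda>\<omega>. iexp (N n n \<omega>)) * exp l - expectation (P n n)) \<longlonglongrightarrow> 0"
    by (rule tendsto_norm_zero_cancel, rule tendsto_sandwich[OF _ _ tendsto_const G_lim])
       (rule always_eventually allI norm_ge_zero diff)+
  from tendsto_add[OF this P_lim]
  have "(\<lambda>n. expectation (\<lambda>\<omega>. iexp (N n n \<omega>)) * exp l) \<longlonglongrightarrow> 1" by simp
  note * = tendsto_mult[OF this tendsto_const[of "complex_of_real (exp (- l))"]]
  have lim: "(\<lambda>n. expectation (\<lambda>\<omega>. iexp (N n n \<omega>))) \<longlonglongrightarrow> complex_of_real (exp (- l))"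
  proof -
    have "complex_of_real (exp l) * complex_of_real (exp (- l)) = 1"
      unfolding of_real_mult[symmetric] exp_add[symmetric] by simp
    with * show ?thesis by (simp only: mult.assoc mult_1_right mult_1_left)
  qed

  show ?thesis unfolding l_def[symmetric]
  proof (rule op_char_diff[where A="\<lambda>n \<omega>. (\<Sum>k<n. Z n k \<omega> * V (Suc k) \<omega>) / sqrt n" and N=0])
    have Ym [measurable]: "Y k \<in> borel_measurable M" and Zm [measurable]: "Z n k \<in> borel_measurable M"
      and Vm [measurable]: "V (Suc k) \<in> borel_measurable M" for n k
      by (auto intro: F_M[OF Y(1)] F_M[OF Z_meas] V_meas)
    show "(\<lambda>\<omega>. (\<Sum>k<n. Z n k \<omega> * V (Suc k) \<omega>) / sqrt n) \<in> borel_measurable M" for n by measurable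
    show "(\<lambda>\<omega>. (\<Sum>k<n. Y k \<omega> * V (Suc k) \<omega>) / sqrt n) \<in> borel_measurable M" for n by measurable
    have "t * ((\<Sum>k<n. Z n k \<omega> * V (Suc k) \<omega>) / sqrt n) = N n n \<omega>" for n \<omega>
      unfolding N_def s_def by (simp add: sum_divide_distrib sum_distrib_left mult_ac)
    then show "(\<lambda>n. expectation (\<lambda>\<omega>. iexp (t * ((\<Sum>k<n. Z n k \<omega> * V (Suc k) \<omega>) / sqrt n)))) \<longlonglongrightarrow> complex_of_real (exp (- l))"
      using lim by simp
    \<comment> \<open>The two sums coincide, not merely approximately, wherever the empirical
      conditional variance is within 1 of its limit.\<close>
    show "op (\<lambda>n \<omega>. (\<Sum>k<n. Z n k \<omega> * V (Suc k) \<omega>) / sqrt n - (\<Sum>k<n. Y k \<omega> * V (Suc k) \<omega>) / sqrt n)"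
      unfolding op_def
    proof (intro allI impI)
      fix e d :: real assume ed: "e > 0" "d > 0"
      have "\<forall>\<^sub>F n in sequentially. outside e (\<lambda>\<omega>. \<bar>(\<Sum>k<n. (Y k \<omega>)\<^sup>2) / n - w\<bar> \<le> 1)"
        using ed by (intro avg[unfolded op_def, rule_format]) auto
      then show "\<forall>\<^sub>F n in sequentially. outside e (\<lambda>\<omega>. \<bar>(\<Sum>k<n. Z n k \<omega> * V (Suc k) \<omega>) / sqrt n - (\<Sum>k<n. Y k \<omega> * V (Suc k) \<omega>) / sqrt n\<bar> \<le> d)"
      proof (rule eventually_mono)
        have "\<bar>(\<Sum>k<n. Z n k \<omega> * V (Suc k) \<omega>) / sqrt n - (\<Sum>k<n. Y k \<omega> * V (Suc k) \<omega>) / sqrt n\<bar> \<le> d"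
          if h: "\<bar>(\<Sum>k<n. (Y k \<omega>)\<^sup>2) / n - w\<bar> \<le> 1" for n \<omega>
        proof -
          have "(\<Sum>k<n. Z n k \<omega> * V (Suc k) \<omega>) = (\<Sum>k<n. Y k \<omega> * V (Suc k) \<omega>)"
            using h by (intro sum.cong refl) (subst Z_eq, auto)
          then show ?thesis using ed by simp
        qed
        then show "outside e (\<lambda>\<omega>. \<bar>(\<Sum>k<n. (Y k \<omega>)\<^sup>2) / n - w\<bar> \<le> 1) \<Longrightarrow>
          outside e (\<lambda>\<omega>. \<bar>(\<Sum>k<n. Z n k \<omega> * V (Suc k) \<omega>) / sqrt n - (\<Sum>k<n. Y k \<omega> * V (Suc k) \<omega>) / sqrt n\<bar> \<le> d)" for n by blast
      qed
    qed
  qed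
qed

end

text \<open>The degenerate and the nondegenerate branch share one formula for the characteristic
  function, so a single limit argument serves both; the nondegenerate law is obtained by scaling the
  standard normal law.\<close>

lemma normal_law_char:
  assumes w: "w \<ge> 0"
  shows "real_distribution (normal_law 0 w)" and "char (normal_law 0 w) t = complex_of_real (exp (- (t\<^sup>2 * w / 2)))"
proof -
  have "real_distribution (normal_law 0 w) \<and> char (normal_law 0 w) t = complex_of_real (exp (- (t\<^sup>2 * w / 2)))"
  proof (cases "w = 0")
    case True
    have "prob_space (return borel (0::real))" by (rule prob_space_return) simp
    then show ?thesis
      using True by (auto simp: normal_law_def real_distribution_def real_distribution_axioms_def char_def integral_return)
  next
    case False
    then have s: "sqrt w > 0" "(sqrt w)\<^sup>2 = w" using w by auto
    interpret N: prob_space std_normal_distribution by (rule prob_space_normal_density) simp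
    have "distributed std_normal_distribution lborel (\<lambda>y. y) std_normal_density"
      by (auto simp: distributed_def intro!: distr_id2)
    from N.normal_density_affine[OF this, of "sqrt w" 0]
    have "distributed std_normal_distribution lborel (\<lambda>y. sqrt w * y) (normal_density 0 (sqrt w))"
      using s by simp
    then have d: "distr std_normal_distribution lborel (\<lambda>y. sqrt w * y) = normal_law 0 w"
      using False by (simp add: distributed_def normal_law_def)
    have "distr std_normal_distribution borel (\<lambda>y. sqrt w * y) = distr std_normal_distribution lborel (\<lambda>y. sqrt w * y)"
      by (rule distr_cong) auto
    then have eq: "normal_law 0 w = distr std_normal_distribution borel (\<lambda>y. sqrt w * y)" using d by simp
    have "real_distribution (normal_law 0 w)"
      unfolding eq by (rule N.real_distribution_distr) simp
    moreover have "char (normal_law 0 w) t = char std_normal_distribution (t * sqrt w)"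
      unfolding eq char_def by (subst integral_distr) (auto simp: mult_ac)
    ultimately show ?thesis
      unfolding char_std_normal_distribution using s(2) by (simp add: power_mult_distrib)
  qed
  then show "real_distribution (normal_law 0 w)" and "char (normal_law 0 w) t = complex_of_real (exp (- (t\<^sup>2 * w / 2)))"
    by auto
qed

section \<open>Empirical autocovariances of the process\<close>

text \<open>Cauchy-Schwarz after splitting \<open>u\<close> into sqrt |u| times sqrt |u| times its
  sign. Applied to the weights \<open>psi\<close>, whose absolute sum is bounded, it gives moment
  bounds that are uniform in time.\<close>

lemma weighted_square_le:
  fixes u z :: "'i \<Rightarrow> real"
  shows "(\<Sum>j\<in>A. u j * z j)\<^sup>2 \<le> (\<Sum>j\<in>A. \<bar>u j\<bar>) * (\<Sum>j\<in>A. \<bar>u j\<bar> * (z j)\<^sup>2)"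
proof -
  have "(\<Sum>j\<in>A. u j * z j)\<^sup>2 = (\<Sum>j\<in>A. sqrt \<bar>u j\<bar> * (sqrt \<bar>u j\<bar> * (sgn (u j) * z j)))\<^sup>2"
  proof (intro arg_cong[where f="\<lambda>x. x\<^sup>2"] sum.cong refl)
    fix j
    have "sqrt \<bar>u j\<bar> * (sqrt \<bar>u j\<bar> * (sgn (u j) * z j)) = (sqrt \<bar>u j\<bar> * sqrt \<bar>u j\<bar>) * sgn (u j) * z j"
      by (simp only: mult.assoc)
    also have "sqrt \<bar>u j\<bar> * sqrt \<bar>u j\<bar> = \<bar>u j\<bar>" by simp
    also have "\<bar>u j\<bar> * sgn (u j) = u j" by (simp add: abs_sgn mult_sgn_abs mult.commute)
    finally show "u j * z j = sqrt \<bar>u j\<bar> * (sqrt \<bar>u j\<bar> * (sgn (u j) * z j))" by (rule sym)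
  qed
  also have "\<dots> \<le> (\<Sum>j\<in>A. (sqrt \<bar>u j\<bar>)\<^sup>2) * (\<Sum>j\<in>A. (sqrt \<bar>u j\<bar> * (sgn (u j) * z j))\<^sup>2)"
    by (rule Cauchy_Schwarz_ineq_sum)
  also have "\<dots> = (\<Sum>j\<in>A. \<bar>u j\<bar>) * (\<Sum>j\<in>A. \<bar>u j\<bar> * (z j)\<^sup>2)"
    by (intro arg_cong2[where f="(*)"] sum.cong refl) (auto simp: power_mult_distrib sgn_if)
  finally show ?thesis .
qed

text \<open>The quadratic inequality is used twice, the second time for the squares of
  \<open>z\<close> with the weights |u|.\<close>

lemma weighted_fourth_le:
  fixes u z :: "'i \<Rightarrow> real"
  shows "(\<Sum>j\<in>A. u j * z j) ^ 4 \<le> (\<Sum>j\<in>A. \<bar>u j\<bar>) ^ 3 * (\<Sum>j\<in>A. \<bar>u j\<bar> * (z j) ^ 4)"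
proof -
  let ?s = "\<Sum>j\<in>A. \<bar>u j\<bar>"
  have s: "?s \<ge> 0" by (simp add: sum_nonneg)
  have sq: "((x::real)\<^sup>2)\<^sup>2 = x ^ 4" for x by (simp flip: power_mult)
  have "(\<Sum>j\<in>A. u j * z j) ^ 4 = ((\<Sum>j\<in>A. u j * z j)\<^sup>2)\<^sup>2" by (simp only: sq)
  also have "\<dots> \<le> (?s * (\<Sum>j\<in>A. \<bar>u j\<bar> * (z j)\<^sup>2))\<^sup>2"
    by (intro power_mono weighted_square_le) simp
  also have "\<dots> = ?s\<^sup>2 * (\<Sum>j\<in>A. \<bar>u j\<bar> * (z j)\<^sup>2)\<^sup>2" by (rule power_mult_distrib)
  also have "\<dots> \<le> ?s\<^sup>2 * (?s * (\<Sum>j\<in>A. \<bar>u j\<bar> * ((z j)\<^sup>2)\<^sup>2))"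
    using weighted_square_le[where u="\<lambda>j. \<bar>u j\<bar>" and z="\<lambda>j. (z j)\<^sup>2" and A=A] by (intro mult_left_mono) simp_all
  also have "\<dots> = ?s ^ 3 * (\<Sum>j\<in>A. \<bar>u j\<bar> * (z j) ^ 4)"
    unfolding sq by (simp add: power2_eq_square power3_eq_cube mult.assoc)
  finally show ?thesis .
qed

lemma integrable_dominated:
  fixes f B :: "'a \<Rightarrow> real"
  assumes B: "integrable M B" and f: "f \<in> borel_measurable M" and le: "\<And>\<omega>. 0 \<le> f \<omega>" "\<And>\<omega>. f \<omega> \<le> B \<omega>"
  shows "integrable M f"
proof (rule Bochner_Integration.integrable_bound[OF B f], rule AE_I2)
  fix \<omega>
  show "norm (f \<omega>) \<le> norm (B \<omega>)"
    using le[of \<omega>] by simp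
qed

lemma sum_Suc_shift: "(\<Sum>k=1..n. f k) = (\<Sum>k<n. f (Suc k))" for f :: "nat \<Rightarrow> 'b :: comm_monoid_add"
  by (rule sum.reindex_bij_witness[of _ Suc "\<lambda>k. k - 1"]) auto

locale dw_process = dw_params p \<theta> \<rho> + innovations M V v
  for p \<theta> \<rho> and M :: "'a measure" and V v +
  fixes U :: "'a \<Rightarrow> real"
  assumes v_pos: "v > 0"
    and V_fourth: "n \<ge> 1 \<Longrightarrow> integrable M (\<lambda>\<omega>. (V n \<omega>) ^ 4)"
    and U_meas: "U \<in> borel_measurable M"
    and U_square: "integrable M (\<lambda>\<omega>. (U \<omega>)\<^sup>2)"
begin

text \<open>\<open>Y\<close> is the process started from 0, to which martingale arguments apply. The initial value \<open>U\<close> may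
  depend on the innovations, but its contribution is negligible as \<open>psi\<close> is summable.\<close>

definition Y :: "int \<Rightarrow> 'a \<Rightarrow> real" where
  "Y m \<omega> = (\<Sum>j\<in>{1..nat m}. psi (m - int j) * V j \<omega>)"

definition x :: "int \<Rightarrow> 'a \<Rightarrow> real" where
  "x m \<omega> = psi m * U \<omega> + Y m \<omega>"

lemma Y_upto: "int N \<ge> m \<Longrightarrow> Y m \<omega> = (\<Sum>j\<in>{1..N}. psi (m - int j) * V j \<omega>)"
  unfolding Y_def by (rule sum.mono_neutral_left) auto

lemma Y_neg: "m \<le> 0 \<Longrightarrow> Y m \<omega> = 0"
  by (simp add: Y_def)

lemma x_neg: "m < 0 \<Longrightarrow> x m \<omega> = 0"
  by (simp add: x_def Y_neg)

lemma x_0: "x 0 \<omega> = U \<omega>"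
  by (simp add: x_def Y_neg)

text \<open>By \<open>psi_ar\<close> the recursion annihilates the response to \<open>U\<close> at
  times k \<ge> 1, and of the responses to the innovations it retains only the one to
  \<open>V k\<close>, at lag 0.\<close>

lemma x_ar: "k \<ge> 1 \<Longrightarrow> (\<Sum>j\<le>p+1. a (int j) * x (int k - int j) \<omega>) = V k \<omega>"
proof -
  assume k: "k \<ge> 1"
  have "(\<Sum>j\<le>p+1. a (int j) * x (int k - int j) \<omega>) =
      (\<Sum>j\<le>p+1. a (int j) * psi (int k - int j)) * U \<omega> + (\<Sum>j\<le>p+1. a (int j) * Y (int k - int j) \<omega>)"
    unfolding x_def sum_distrib_right by (simp only: distrib_left sum.distrib mult.assoc)
  also have "(\<Sum>j\<le>p+1. a (int j) * psi (int k - int j)) = 0" unfolding psi_ar using k by simp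
  also have "(\<Sum>j\<le>p+1. a (int j) * Y (int k - int j) \<omega>) =
      (\<Sum>j\<le>p+1. \<Sum>l\<in>{1..k}. a (int j) * (psi (int k - int j - int l) * V l \<omega>))"
    by (intro sum.cong refl) (subst Y_upto[where N=k], simp, simp only: sum_distrib_left)
  also have "\<dots> = (\<Sum>l\<in>{1..k}. \<Sum>j\<le>p+1. a (int j) * (psi (int k - int j - int l) * V l \<omega>))"
    by (rule sum.swap)
  also have "\<dots> = (\<Sum>l\<in>{1..k}. (\<Sum>j\<le>p+1. a (int j) * psi ((int k - int l) - int j)) * V l \<omega>)"
    unfolding sum_distrib_right by (intro sum.cong refl) (simp add: algebra_simps)
  also have "\<dots> = (\<Sum>l\<in>{1..k}. if l = k then V l \<omega> else 0)"
    unfolding psi_ar by (intro sum.cong refl) auto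
  also have "\<dots> = V k \<omega>" using k by simp
  finally show ?thesis by simp
qed

text \<open>At a time k \<ge> 1 the recursion of order p + 1 reaches back to k - p - 1 \<ge> - p, so
  the values at times - p to 0 determine everything later, the leading coefficient being 1.\<close>

lemma x_unique:
  assumes ar: "\<And>k. k \<ge> 1 \<Longrightarrow> (\<Sum>j\<le>p+1. a (int j) * X (int k - int j)) = V k \<omega>"
    and init: "X 0 = U \<omega>" "\<And>m. m < 0 \<Longrightarrow> m \<ge> - int p \<Longrightarrow> X m = 0"
    and m: "m \<ge> - int p"
  shows "X m = x m \<omega>"
proof -
  have nonneg: "X (int k) = x (int k) \<omega>" for k
  proof (induction k rule: less_induct)
    case (less k)
    show ?case
    proof (cases "k = 0")
      case False
      have step: "X (int k) + (\<Sum>j<p+1. a (int (Suc j)) * X (int k - int (Suc j))) = V k \<omega>"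
        using ar[of k] False unfolding sum.atMost_shift by simp
      have step': "x (int k) \<omega> + (\<Sum>j<p+1. a (int (Suc j)) * x (int k - int (Suc j)) \<omega>) = V k \<omega>"
        using x_ar[of k \<omega>] False unfolding sum.atMost_shift by simp
      have "X (int k - int (Suc j)) = x (int k - int (Suc j)) \<omega>" if "j < p + 1" for j
      proof (cases "Suc j \<le> k")
        case True
        then have e: "int k - int (Suc j) = int (k - Suc j)" by (simp add: of_nat_diff)
        show ?thesis unfolding e using True by (intro less) simp
      next
        case False
        then have "int k - int (Suc j) < 0" "int k - int (Suc j) \<ge> - int p" using that \<open>k \<noteq> 0\<close> by linarith+
        then show ?thesis by (simp only: init(2) x_neg)
      qed
      then have "(\<Sum>j<p+1. a (int (Suc j)) * X (int k - int (Suc j))) = (\<Sum>j<p+1. a (int (Suc j)) * x (int k - int (Suc j)) \<omega>)"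
        by (intro sum.cong refl) (metis lessThan_iff)
      then show ?thesis using step step' by linarith
    qed (simp add: init x_0)
  qed
  show ?thesis
  proof (cases "m \<ge> 0")
    case True
    then show ?thesis using nonneg[of "nat m"] by simp
  next
    case False
    then show ?thesis using init(2)[of m] m x_neg[of m \<omega>] by simp
  qed
qed

lemma Y_meas_F: "nat m \<le> k \<Longrightarrow> Y m \<in> borel_measurable (F k)"
  unfolding Y_def by (intro borel_measurable_sum borel_measurable_times borel_measurable_const) (auto intro: V_F)

lemma Y_meas [measurable]: "Y m \<in> borel_measurable M"
  by (rule F_M[OF Y_meas_F[OF order_refl]])

lemma x_meas [measurable]: "x m \<in> borel_measurable M"
  using U_meas unfolding x_def by measurable

lemma sum_psi_window: "(\<Sum>j\<in>A. \<bar>psi (m - int j)\<bar>) \<le> psi_norm" if "finite A"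
proof -
  have "(\<Sum>j\<in>A. \<bar>psi (m - int j)\<bar>) = (\<Sum>j\<in>{j\<in>A. int j \<le> m}. \<bar>psi (m - int j)\<bar>)"
    using that by (intro sum.mono_neutral_right) (auto intro!: psi_neg)
  also have "\<dots> = (\<Sum>i\<in>(\<lambda>j. nat (m - int j)) ` {j\<in>A. int j \<le> m}. \<bar>psi (int i)\<bar>)"
    by (subst sum.reindex) (auto simp: inj_on_def)
  also have "\<dots> \<le> psi_norm" using that by (intro sum_psi_le) auto
  finally show ?thesis .
qed

definition "m4 = expectation (\<lambda>\<omega>. (V 1 \<omega>) ^ 4)"

lemma V_fourth_eq: "n \<ge> 1 \<Longrightarrow> expectation (\<lambda>\<omega>. (V n \<omega>) ^ 4) = m4"
proof -
  assume n: "n \<ge> 1"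
  have "expectation (\<lambda>\<omega>. (V n \<omega>) ^ 4) = (\<integral>y. y ^ 4 \<partial>distr M borel (V n))"
    by (subst integral_distr) (use V_meas[OF n] in auto)
  also have "\<dots> = (\<integral>y. y ^ 4 \<partial>distr M borel (V 1))" using law_eq[OF n] law_eq[of 1] by simp
  also have "\<dots> = m4"
    unfolding m4_def by (subst integral_distr) (use V_meas[of 1] in auto)
  finally show ?thesis .
qed

lemma m4_nonneg: "m4 \<ge> 0"
  unfolding m4_def by (simp add: integral_nonneg_AE)

lemma Y_square:
  shows "integrable M (\<lambda>\<omega>. (Y m \<omega>)\<^sup>2)" "expectation (\<lambda>\<omega>. (Y m \<omega>)\<^sup>2) \<le> psi_norm\<^sup>2 * v"
proof -
  let ?B = "\<lambda>\<omega>. psi_norm * (\<Sum>j\<in>{1..nat m}. \<bar>psi (m - int j)\<bar> * (V j \<omega>)\<^sup>2)"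
  have b: "(Y m \<omega>)\<^sup>2 \<le> ?B \<omega>" for \<omega>
    unfolding Y_def
    by (rule order.trans[OF weighted_square_le]) (intro mult_right_mono sum_psi_window sum_nonneg, auto)
  have iB: "integrable M ?B" using V_square by (intro integrable_mult_right Bochner_Integration.integrable_sum) auto
  show i: "integrable M (\<lambda>\<omega>. (Y m \<omega>)\<^sup>2)"
    by (rule integrable_dominated[OF iB _ _ b]) auto
  have "expectation (\<lambda>\<omega>. (Y m \<omega>)\<^sup>2) \<le> expectation ?B"
    by (intro integral_mono i iB b)
  also have "\<dots> = psi_norm * (\<Sum>j\<in>{1..nat m}. \<bar>psi (m - int j)\<bar> * v)"
    using V_square V_second by (simp add: Bochner_Integration.integral_sum)
  also have "\<dots> \<le> psi_norm * (psi_norm * v)"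
    unfolding sum_distrib_right[symmetric]
    using psi_norm_nonneg v_nonneg sum_psi_window[of "{1..nat m}" m] by (intro mult_left_mono mult_right_mono) auto
  finally show "expectation (\<lambda>\<omega>. (Y m \<omega>)\<^sup>2) \<le> psi_norm\<^sup>2 * v" by (simp add: power2_eq_square mult.assoc)
qed

lemma Y_fourth:
  shows "integrable M (\<lambda>\<omega>. (Y m \<omega>) ^ 4)" "expectation (\<lambda>\<omega>. (Y m \<omega>) ^ 4) \<le> psi_norm ^ 4 * m4"
proof -
  let ?B = "\<lambda>\<omega>. psi_norm ^ 3 * (\<Sum>j\<in>{1..nat m}. \<bar>psi (m - int j)\<bar> * (V j \<omega>) ^ 4)"
  have b: "(Y m \<omega>) ^ 4 \<le> ?B \<omega>" for \<omega>
    unfolding Y_def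
    by (rule order.trans[OF weighted_fourth_le]) (intro mult_right_mono power_mono sum_psi_window sum_nonneg, auto)
  have iB: "integrable M ?B" using V_fourth by (intro integrable_mult_right Bochner_Integration.integrable_sum) auto
  show i: "integrable M (\<lambda>\<omega>. (Y m \<omega>) ^ 4)"
    by (rule integrable_dominated[OF iB _ _ b]) auto
  have "expectation (\<lambda>\<omega>. (Y m \<omega>) ^ 4) \<le> expectation ?B"
    by (intro integral_mono i iB b)
  also have "\<dots> = psi_norm ^ 3 * (\<Sum>j\<in>{1..nat m}. \<bar>psi (m - int j)\<bar> * m4)"
    using V_fourth V_fourth_eq by (simp add: Bochner_Integration.integral_sum)
  also have "\<dots> \<le> psi_norm ^ 3 * (psi_norm * m4)"
    unfolding sum_distrib_right[symmetric]
    using psi_norm_nonneg m4_nonneg sum_psi_window[of "{1..nat m}" m] by (intro mult_left_mono mult_right_mono) auto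
  also have "\<dots> = psi_norm ^ 4 * m4" by (simp add: power4_eq_xxxx power3_eq_cube)
  finally show "expectation (\<lambda>\<omega>. (Y m \<omega>) ^ 4) \<le> psi_norm ^ 4 * m4" .
qed

lemma x_square:
  obtains K where "K \<ge> 0" "\<And>m. integrable M (\<lambda>\<omega>. (x m \<omega>)\<^sup>2)" "\<And>m. expectation (\<lambda>\<omega>. (x m \<omega>)\<^sup>2) \<le> K"
proof -
  let ?u = "expectation (\<lambda>\<omega>. (U \<omega>)\<^sup>2)"
  have pU: "(\<lambda>\<omega>. psi m * U \<omega>) \<in> borel_measurable M" "integrable M (\<lambda>\<omega>. (psi m * U \<omega>)\<^sup>2)" for m
    using U_meas U_square by (auto simp: power_mult_distrib)
  have i: "integrable M (\<lambda>\<omega>. (x m \<omega>)\<^sup>2)" for m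
    unfolding x_def by (intro integrable_square_add pU Y_square) auto
  have "expectation (\<lambda>\<omega>. (x m \<omega>)\<^sup>2) \<le> 2 * (psi_norm\<^sup>2 * ?u) + 2 * (psi_norm\<^sup>2 * v)" for m
  proof -
    have "expectation (\<lambda>\<omega>. (x m \<omega>)\<^sup>2) \<le> expectation (\<lambda>\<omega>. 2 * ((psi m)\<^sup>2 * (U \<omega>)\<^sup>2) + 2 * (Y m \<omega>)\<^sup>2)"
    proof (rule integral_mono[OF i])
      have "(y + z)\<^sup>2 \<le> 2 * y\<^sup>2 + 2 * z\<^sup>2" for y z :: real
        using zero_le_power2[of "y - z"] by (simp add: power2_sum power2_diff)
      then show "(x m \<omega>)\<^sup>2 \<le> 2 * ((psi m)\<^sup>2 * (U \<omega>)\<^sup>2) + 2 * (Y m \<omega>)\<^sup>2" for \<omega>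
        unfolding x_def by (metis power_mult_distrib)
    qed (use U_square Y_square in auto)
    also have "\<dots> = 2 * ((psi m)\<^sup>2 * ?u) + 2 * expectation (\<lambda>\<omega>. (Y m \<omega>)\<^sup>2)"
      using U_square Y_square by simp
    also have "\<dots> \<le> 2 * (psi_norm\<^sup>2 * ?u) + 2 * (psi_norm\<^sup>2 * v)"
      using psi_le[of m] psi_norm_nonneg Y_square(2)[of m]
      by (intro add_mono mult_left_mono mult_right_mono) (auto simp: abs_le_square_iff[symmetric] integral_nonneg_AE)
    finally show ?thesis .
  qed
  moreover have "2 * (psi_norm\<^sup>2 * ?u) + 2 * (psi_norm\<^sup>2 * v) \<ge> 0"
    using v_nonneg by (auto intro!: add_nonneg_nonneg integral_nonneg_AE mult_nonneg_nonneg)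
  ultimately show ?thesis using that i by blast
qed

text \<open>Meant for the boundary terms that arise when a lag sum is shifted. Their times move with
  n, but the second moments of the process are bounded uniformly in time.\<close>

lemma x_prod_Op: "Op (\<lambda>n \<omega>. x (f n) \<omega> * x (g n) \<omega>)"
proof -
  obtain K where K: "\<And>m. integrable M (\<lambda>\<omega>. (x m \<omega>)\<^sup>2)" "\<And>m. expectation (\<lambda>\<omega>. (x m \<omega>)\<^sup>2) \<le> K"
    by (rule x_square) blast
  have "Op (\<lambda>n \<omega>. (x (f n) \<omega>)\<^sup>2 + (x (g n) \<omega>)\<^sup>2)"
    by (rule Op_add; rule Op_of_L1_bound[where N=0 and C=K]) (use K in auto)
  then show ?thesis
  proof (rule Op_cong)
    fix n \<omega>
    have "0 \<le> (\<bar>x (f n) \<omega>\<bar> - \<bar>x (g n) \<omega>\<bar>)\<^sup>2" "0 \<le> \<bar>x (f n) \<omega>\<bar> * \<bar>x (g n) \<omega>\<bar>" by simp_all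
    then show "\<bar>x (f n) \<omega> * x (g n) \<omega>\<bar> \<le> \<bar>(x (f n) \<omega>)\<^sup>2 + (x (g n) \<omega>)\<^sup>2\<bar>"
      unfolding power2_diff power2_abs abs_mult by (intro order.trans[OF _ abs_ge_self]) linarith
  qed
qed

lemma x_Op: "Op (\<lambda>n \<omega>. x (f n) \<omega>)"
proof (rule Op_cong[OF Op_add[OF Op_const[of 1] x_prod_Op[of f f]]])
  fix n \<omega>
  have "0 \<le> (\<bar>x (f n) \<omega>\<bar> - 1)\<^sup>2" by simp
  then show "\<bar>x (f n) \<omega>\<bar> \<le> \<bar>1 + x (f n) \<omega> * x (f n) \<omega>\<bar>"
    unfolding power2_diff power2_abs power2_eq_square[of "x (f n) \<omega>"] by (intro order.trans[OF _ abs_ge_self]) simp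
qed

text \<open>\<open>U\<close> may depend on all innovations, so no martingale structure is available.
  The bound is in L1 instead: each product of \<open>V k\<close> and \<open>U\<close> has expected
  absolute value at most the sum of the two second moments, and the weights \<open>psi\<close> are
  absolutely summable.\<close>

lemma U_part_Op: "Op (\<lambda>n \<omega>. \<Sum>k=1..n. V k \<omega> * (psi (int k - d) * U \<omega>))"
proof -
  let ?u = "expectation (\<lambda>\<omega>. (U \<omega>)\<^sup>2)"
  have iVU: "integrable M (\<lambda>\<omega>. V k \<omega> * U \<omega>)" if "k \<ge> 1" for k
    using that by (intro integrable_mult_of_squares V_meas U_meas V_square U_square) auto
  have eVU: "expectation (\<lambda>\<omega>. \<bar>V k \<omega> * U \<omega>\<bar>) \<le> v + ?u" if "k \<ge> 1" for k
  proof -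
    have "expectation (\<lambda>\<omega>. \<bar>V k \<omega> * U \<omega>\<bar>) \<le> expectation (\<lambda>\<omega>. (V k \<omega>)\<^sup>2 + (U \<omega>)\<^sup>2)"
    proof (rule integral_mono)
      show "\<bar>V k \<omega> * U \<omega>\<bar> \<le> (V k \<omega>)\<^sup>2 + (U \<omega>)\<^sup>2" for \<omega>
      proof -
        have "0 \<le> (\<bar>V k \<omega>\<bar> - \<bar>U \<omega>\<bar>)\<^sup>2" "0 \<le> \<bar>V k \<omega>\<bar> * \<bar>U \<omega>\<bar>" by simp_all
        then show ?thesis unfolding power2_diff power2_abs abs_mult by linarith
      qed
    qed (use iVU[OF that] V_square[OF that] U_square in auto)
    then show ?thesis using V_square[OF that] V_second[OF that] U_square by simp
  qed
  have i: "integrable M (\<lambda>\<omega>. \<Sum>k=1..n. V k \<omega> * (psi (int k - d) * U \<omega>))" for n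
  proof (rule Bochner_Integration.integrable_sum)
    fix k assume "k \<in> {1..n}"
    then have "integrable M (\<lambda>\<omega>. psi (int k - d) * (V k \<omega> * U \<omega>))" using iVU[of k] by simp
    then show "integrable M (\<lambda>\<omega>. V k \<omega> * (psi (int k - d) * U \<omega>))" by (simp add: mult_ac)
  qed
  show ?thesis
  proof (rule Op_of_L1_bound[OF i, where N=0 and C="psi_norm * (v + ?u)"])
    fix n
    have "expectation (\<lambda>\<omega>. \<bar>\<Sum>k=1..n. V k \<omega> * (psi (int k - d) * U \<omega>)\<bar>)
        \<le> expectation (\<lambda>\<omega>. \<Sum>k=1..n. \<bar>psi (int k - d)\<bar> * \<bar>V k \<omega> * U \<omega>\<bar>)"
    proof (rule integral_mono)
      show "integrable M (\<lambda>\<omega>. \<Sum>k=1..n. \<bar>psi (int k - d)\<bar> * \<bar>V k \<omega> * U \<omega>\<bar>)"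
        using iVU by (intro Bochner_Integration.integrable_sum integrable_mult_right integrable_abs) auto
      fix \<omega>
      have "\<bar>\<Sum>k=1..n. V k \<omega> * (psi (int k - d) * U \<omega>)\<bar> \<le> (\<Sum>k=1..n. \<bar>V k \<omega> * (psi (int k - d) * U \<omega>)\<bar>)"
        by (rule sum_abs)
      also have "\<dots> = (\<Sum>k=1..n. \<bar>psi (int k - d)\<bar> * \<bar>V k \<omega> * U \<omega>\<bar>)"
        by (simp add: abs_mult mult_ac)
      finally show "\<bar>\<Sum>k=1..n. V k \<omega> * (psi (int k - d) * U \<omega>)\<bar> \<le> (\<Sum>k=1..n. \<bar>psi (int k - d)\<bar> * \<bar>V k \<omega> * U \<omega>\<bar>)" .
    qed (use i in auto)
    also have "\<dots> = (\<Sum>k=1..n. \<bar>psi (int k - d)\<bar> * expectation (\<lambda>\<omega>. \<bar>V k \<omega> * U \<omega>\<bar>))"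
      using iVU by (subst Bochner_Integration.integral_sum) auto
    also have "\<dots> \<le> (\<Sum>k=1..n. \<bar>psi (int k - d)\<bar> * (v + ?u))"
      using eVU by (intro sum_mono mult_left_mono) auto
    also have "\<dots> = (\<Sum>k=1..n. \<bar>psi (int k - d)\<bar>) * (v + ?u)" by (rule sum_distrib_right[symmetric])
    \<comment> \<open>Reversing time brings the sum into the shape required by
      \<open>sum_psi_window\<close>.\<close>
    also have "(\<Sum>k=1..n. \<bar>psi (int k - d)\<bar>) = (\<Sum>k=1..n. \<bar>psi ((int n + 1 - d) - int k)\<bar>)"
      by (rule sum.reindex_bij_witness[of _ "\<lambda>k. n + 1 - k" "\<lambda>k. n + 1 - k"]) (auto simp: of_nat_diff algebra_simps)
    also have "\<dots> * (v + ?u) \<le> psi_norm * (v + ?u)"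
      using v_nonneg by (intro mult_right_mono sum_psi_window) (auto intro!: add_nonneg_nonneg integral_nonneg_AE)
    finally show "expectation (\<lambda>\<omega>. \<bar>\<Sum>k=1..n. V k \<omega> * (psi (int k - d) * U \<omega>)\<bar>) \<le> psi_norm * (v + ?u)" .
  qed
qed

section \<open>Scores, lag products and their laws of large numbers\<close>

definition score :: "nat \<Rightarrow> nat \<Rightarrow> 'a \<Rightarrow> real" where
  "score d n \<omega> = (\<Sum>k=1..n. V k \<omega> * x (int k - int d) \<omega>)"

text \<open>For d \<ge> 1 the factor of \<open>V k\<close> is a function of earlier innovations plus
  a multiple of \<open>U\<close>; the former produces a martingale of order sqrt n, the latter a
  term that stays bounded in probability. At d = 0 the factor contains \<open>V k\<close> itself and
  the sum drifts.\<close>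

lemma score_Op: "d \<ge> 1 \<Longrightarrow> Op (\<lambda>n \<omega>. score d n \<omega> / sqrt (real n))"
proof -
  assume d: "d \<ge> 1"
  have "Op (\<lambda>n \<omega>. (\<Sum>k<n. Y (int (Suc k) - int d) \<omega> * V (Suc k) \<omega>) / sqrt (real n))"
    by (rule martingale_Op[where K="psi_norm\<^sup>2 * v"]) (use d in \<open>auto intro!: Y_meas_F Y_square\<close>)
  from Op_add[OF this op_imp_Op[OF div_sqrt_Op[OF U_part_Op[of "int d", unfolded sum_Suc_shift]]]]
  show ?thesis
    by (rule Op_eq[where N=0])
      (unfold score_def x_def sum_Suc_shift add_divide_distrib[symmetric] sum.distrib[symmetric],
        intro arg_cong2[where f="(/)"] sum.cong refl, simp add: algebra_simps)
qed

definition lag_prod :: "nat \<Rightarrow> nat \<Rightarrow> nat \<Rightarrow> 'a \<Rightarrow> real" where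
  "lag_prod i j n \<omega> = (\<Sum>k=1..n. x (int k - int i) \<omega> * x (int k - int j) \<omega>)"

abbreviation "r h \<equiv> lag_prod 0 h"

lemma lag_prod_sym: "lag_prod i j = lag_prod j i"
  by (intro ext) (simp add: lag_prod_def mult.commute)

lemma lag_prod_Suc: "lag_prod (Suc i) (Suc j) n \<omega> = (\<Sum>k<n. x (int k - int i) \<omega> * x (int k - int j) \<omega>)"
  unfolding lag_prod_def sum_Suc_shift by (simp add: algebra_simps)

lemma lag_prod_shift: "eqO (lag_prod (Suc i) (Suc j)) (lag_prod i j)"
  unfolding eqO_def
proof (rule Op_eq[OF Op_diff[OF x_prod_Op[of "\<lambda>n. 0 - int i" "\<lambda>n. 0 - int j"] x_prod_Op[of "\<lambda>n. int n - int i" "\<lambda>n. int n - int j"]], where N=0])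
  fix n \<omega>
  let ?f = "\<lambda>k. x (int k - int i) \<omega> * x (int k - int j) \<omega>"
  have "lag_prod i j n \<omega> = (\<Sum>k<n. ?f (Suc k))" unfolding lag_prod_def sum_Suc_shift ..
  then have "lag_prod i j n \<omega> - lag_prod (Suc i) (Suc j) n \<omega> = (\<Sum>k<n. ?f (Suc k) - ?f k)"
    unfolding lag_prod_Suc sum_subtractf by simp
  also have "\<dots> = ?f n - ?f 0" by (rule sum_lessThan_telescope)
  finally show "lag_prod (Suc i) (Suc j) n \<omega> - lag_prod i j n \<omega> =
     x (0 - int i) \<omega> * x (0 - int j) \<omega> - x (int n - int i) \<omega> * x (int n - int j) \<omega>" by simp
qed

text \<open>Shifting both lags by one telescopes to two boundary products. Hence, up to O_P(1), only
  the difference of the lags matters; this Toeplitz structure is what makes time reversal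
  possible.\<close>

lemma lag_prod_eqO: "eqO (lag_prod i j) (r (nat \<bar>int i - int j\<bar>))"
proof -
  have *: "eqO (lag_prod i (i + h)) (r h)" for i h
  proof (induction i)
    case (Suc i)
    then show ?case using eqO_trans[OF lag_prod_shift[of i "i + h"]] by simp
  qed (simp add: eqO_refl)
  show ?thesis
  proof (cases "i \<le> j")
    case True
    have "nat \<bar>int i - int j\<bar> = j - i" using True by auto
    then show ?thesis using *[of i "j - i"] True by simp
  next
    case False
    have "nat \<bar>int i - int j\<bar> = i - j" using False by auto
    then show ?thesis using *[of j "i - j"] False by (simp add: lag_prod_sym[of i j])
  qed
qed

lemma score_eq: "score d n \<omega> = (\<Sum>j\<le>p+1. a (int j) * lag_prod j d n \<omega>)"
proof -
  have "score d n \<omega> = (\<Sum>k=1..n. \<Sum>j\<le>p+1. a (int j) * (x (int k - int j) \<omega> * x (int k - int d) \<omega>))"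
    unfolding score_def
  proof (rule sum.cong[OF refl])
    fix k assume "k \<in> {1..n}"
    then have "V k \<omega> = (\<Sum>j\<le>p+1. a (int j) * x (int k - int j) \<omega>)" using x_ar[of k \<omega>] by simp
    then show "V k \<omega> * x (int k - int d) \<omega> = (\<Sum>j\<le>p+1. a (int j) * (x (int k - int j) \<omega> * x (int k - int d) \<omega>))"
      by (simp only: sum_distrib_right mult.assoc)
  qed
  also have "\<dots> = (\<Sum>j\<le>p+1. a (int j) * lag_prod j d n \<omega>)"
    unfolding lag_prod_def sum_distrib_left by (rule sum.swap)
  finally show ?thesis .
qed

lemma score_eqO: "eqO (score d) (\<lambda>n \<omega>. \<Sum>j\<le>p+1. a (int j) * r (nat \<bar>int d - int j\<bar>) n \<omega>)"
proof -
  have "eqO (score d) (\<lambda>n \<omega>. \<Sum>j\<le>p+1. a (int j) * lag_prod d j n \<omega>)"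
    by (rule eqO_eq[where N=0]) (simp only: score_eq lag_prod_sym[of d])
  also have "eqO \<dots> (\<lambda>n \<omega>. \<Sum>j\<le>p+1. a (int j) * r (nat \<bar>int d - int j\<bar>) n \<omega>)"
    by (intro eqO_sum eqO_cmult lag_prod_eqO)
  finally show ?thesis .
qed

text \<open>Owing to the fourth moment, the centred squares of the innovations again satisfy the
  assumptions of the locale \<open>innovations\<close>; the martingale bound with constant weights
  is then Chebyshev's law of large numbers.\<close>

lemma V_square_lln: "op (\<lambda>n \<omega>. (\<Sum>k=1..n. (V k \<omega>)\<^sup>2) / real n - v)"
proof -
  let ?W = "\<lambda>n \<omega>. (V n \<omega>)\<^sup>2 - v"
  have sq: "((y::real)\<^sup>2 - v)\<^sup>2 = y ^ 4 - 2 * v * y\<^sup>2 + v\<^sup>2" for y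
    unfolding power2_diff by (simp flip: power_mult)
  interpret W: innovations M ?W "m4 - v\<^sup>2"
  proof
    show "indep_vars (\<lambda>_. borel) ?W {1..}"
      by (rule indep_vars_compose2[OF V_indep, where Y="\<lambda>_ y. y\<^sup>2 - v"]) simp
    fix n :: nat assume n: "n \<ge> 1"
    have *: "distr M borel (?W k) = distr law borel (\<lambda>y. y\<^sup>2 - v)" if "k \<ge> 1" for k
      using V_meas[OF that] law_eq[OF that, symmetric] by (simp add: distr_distr comp_def)
    show "distr M borel (?W n) = distr M borel (?W 1)" using *[OF n] *[of 1] by simp
    show "integrable M (\<lambda>\<omega>. (?W n \<omega>)\<^sup>2)"
      unfolding sq using V_fourth[OF n] V_square[OF n] by simp
    show "expectation (?W n) = 0"
      using V_square[OF n] V_second[OF n] by (simp add: prob_space)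
    show "expectation (\<lambda>\<omega>. (?W n \<omega>)\<^sup>2) = m4 - v\<^sup>2"
      unfolding sq using V_fourth[OF n] V_square[OF n] V_second[OF n] V_fourth_eq[OF n]
      by (simp add: prob_space power2_eq_square)
  qed
  have "Op (\<lambda>n \<omega>. (\<Sum>k<n. 1 * ?W (Suc k) \<omega>) / sqrt (real n))"
    by (rule W.martingale_Op[where K=1]) (auto simp: prob_space)
  from op_div_n[OF this] show ?thesis
    by (rule op_eq[where N=1])
       (unfold sum_Suc_shift, simp add: sum_subtractf field_simps)
qed

text \<open>Only d = 0 has a drift. Solving the recursion for X_k writes V_k X_k as V_k^2 minus
  products of V_k with earlier values, which are the summands of scores with lag at least 1.\<close>

lemma score_lln: "op (\<lambda>n \<omega>. score d n \<omega> / real n - (if d = 0 then v else 0))"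
proof (cases "d = 0")
  case False
  then show ?thesis using op_div_n[OF score_Op[of d]] by simp
next
  case True
  have "score 0 n \<omega> = (\<Sum>k=1..n. (V k \<omega>)\<^sup>2) - (\<Sum>j<p+1. a (int (Suc j)) * score (Suc j) n \<omega>)" for n \<omega>
  proof -
    have "score 0 n \<omega> = (\<Sum>k=1..n. (V k \<omega>)\<^sup>2 - (\<Sum>j<p+1. a (int (Suc j)) * (V k \<omega> * x (int k - int (Suc j)) \<omega>)))"
      unfolding score_def
    proof (rule sum.cong[OF refl])
      fix k assume "k \<in> {1..n}"
      then have "V k \<omega> = x (int k) \<omega> + (\<Sum>j<p+1. a (int (Suc j)) * x (int k - int (Suc j)) \<omega>)"
        using x_ar[of k \<omega>] unfolding sum.atMost_shift by simp
      then have "V k \<omega> * x (int k) \<omega> = V k \<omega> * (V k \<omega> - (\<Sum>j<p+1. a (int (Suc j)) * x (int k - int (Suc j)) \<omega>))"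
        by simp
      also have "\<dots> = (V k \<omega>)\<^sup>2 - (\<Sum>j<p+1. a (int (Suc j)) * (V k \<omega> * x (int k - int (Suc j)) \<omega>))"
        unfolding right_diff_distrib sum_distrib_left power2_eq_square by (simp only: mult.left_commute)
      finally show "V k \<omega> * x (int k - int 0) \<omega> = \<dots>" by simp
    qed
    also have "\<dots> = (\<Sum>k=1..n. (V k \<omega>)\<^sup>2) - (\<Sum>k=1..n. \<Sum>j<p+1. a (int (Suc j)) * (V k \<omega> * x (int k - int (Suc j)) \<omega>))"
      by (rule sum_subtractf)
    also have "(\<Sum>k=1..n. \<Sum>j<p+1. a (int (Suc j)) * (V k \<omega> * x (int k - int (Suc j)) \<omega>)) =
        (\<Sum>j<p+1. \<Sum>k=1..n. a (int (Suc j)) * (V k \<omega> * x (int k - int (Suc j)) \<omega>))"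
      by (rule sum.swap)
    also have "\<dots> = (\<Sum>j<p+1. a (int (Suc j)) * score (Suc j) n \<omega>)"
      unfolding score_def sum_distrib_left ..
    finally show ?thesis .
  qed
  then have eq: "score 0 n \<omega> / real n - v = ((\<Sum>k=1..n. (V k \<omega>)\<^sup>2) / real n - v) - (\<Sum>j<p+1. a (int (Suc j)) * (score (Suc j) n \<omega> / real n))" for n \<omega>
    by (simp only: diff_divide_distrib sum_divide_distrib times_divide_eq_right)
  have "op (\<lambda>n \<omega>. ((\<Sum>k=1..n. (V k \<omega>)\<^sup>2) / real n - v) - (\<Sum>j<p+1. a (int (Suc j)) * (score (Suc j) n \<omega> / real n)))"
    by (intro op_diff V_square_lln op_sum op_cmult op_div_n score_Op) simp
  then show ?thesis unfolding True by (simp only: eq refl if_True)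
qed

lemma B_det: "Determinant.det (B_mat p \<theta> \<rho>) \<noteq> 0"
proof
  assume "Determinant.det (B_mat p \<theta> \<rho>) = 0"
  then obtain L where "L \<in> carrier_vec (p + 2)" "L \<noteq> 0\<^sub>v (p + 2)" "B_mat p \<theta> \<rho> *\<^sub>v L = 0\<^sub>v (p + 2)"
    using det_0_iff_vec_prod_zero[OF B_carrier] by auto
  moreover have "B_mat p \<theta> \<rho> *\<^sub>v 0\<^sub>v (p + 2) = 0\<^sub>v (p + 2)"
    by (intro eq_vecI) (auto simp: scalar_prod_def B_mat_def)
  ultimately show False using B_inj[of L "0\<^sub>v (p + 2)"] by simp
qed

lemma r_lln:
  assumes h: "h \<le> p + 1"
  shows "op (\<lambda>n \<omega>. r h n \<omega> / real n - v * gam (int h))"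
proof -
  define z where "z n \<omega> j = r j n \<omega> / real n - v * gam (int j)" for n \<omega> j
  \<comment> \<open>\<open>T\<close> is \<open>B\<close> applied to the errors \<open>z\<close>. The
    limits solve the Yule-Walker equations exactly, so what remains is the deviation of the
    corresponding score plus boundary terms.\<close>
  define T where "T d n \<omega> = (\<Sum>j<p+2. B_mat p \<theta> \<rho> $$ (d, j) * z n \<omega> j)" for d n \<omega>
  have T_op: "op (T d)" if d: "d \<le> p + 1" for d
  proof -
    let ?S = "\<lambda>n \<omega>. \<Sum>j\<le>p+1. a (int j) * r (nat \<bar>int d - int j\<bar>) n \<omega>"
    have T: "T d n \<omega> = ?S n \<omega> / real n - (if d = 0 then v else 0)" for n \<omega>
    proof -
      have "T d n \<omega> = (\<Sum>j\<le>p+1. a (int j) * z n \<omega> (nat \<bar>int d - int j\<bar>))"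
        unfolding T_def by (rule B_mat_sum[OF d])
      also have "\<dots> = ?S n \<omega> / real n - (\<Sum>j\<le>p+1. a (int j) * (v * gam (int d - int j)))"
        unfolding z_def right_diff_distrib sum_subtractf sum_divide_distrib
        by (simp add: gam_abs)
      also have "(\<Sum>j\<le>p+1. a (int j) * (v * gam (int d - int j))) = v * (\<Sum>j\<le>p+1. a (int j) * gam (int d - int j))"
        unfolding sum_distrib_left by (simp only: mult.left_commute)
      also have "\<dots> = (if d = 0 then v else 0)" by (subst gam_ar) auto
      finally show ?thesis .
    qed
    have "op (\<lambda>n \<omega>. (score d n \<omega> / real n - (if d = 0 then v else 0)) - (score d n \<omega> - ?S n \<omega>) / real n)"
      using score_eqO[of d] unfolding eqO_def by (intro op_diff score_lln Op_div_n)
    then show ?thesis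
      by (rule op_eq[where N=0]) (simp add: T diff_divide_distrib del: sum.atMost_Suc)
  qed
  let ?C = "mat_inv (B_mat p \<theta> \<rho>)"
  note C = mat_inv_nonsingular[OF B_carrier B_det]
  have "op (\<lambda>n \<omega>. \<Sum>d<p+2. ?C $$ (h, d) * T d n \<omega>)"
    by (intro op_sum op_cmult T_op) auto
  then show ?thesis
  proof (rule op_eq[where N=0])
    fix n \<omega>
    have "(\<Sum>d<p+2. ?C $$ (h, d) * T d n \<omega>) = z n \<omega> h"
      unfolding T_def using C h by (intro left_inverse_solve[OF B_carrier]) auto
    then show "r h n \<omega> / real n - v * gam (int h) = (\<Sum>d<p+2. ?C $$ (h, d) * T d n \<omega>)"
      by (simp add: z_def)
  qed
qed

lemma lag_prod_lln:
  assumes "\<bar>int i - int j\<bar> \<le> int p + 1"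
  shows "op (\<lambda>n \<omega>. lag_prod i j n \<omega> / real n - v * gam (int i - int j))"
proof -
  let ?h = "nat \<bar>int i - int j\<bar>"
  have g: "gam (int ?h) = gam (int i - int j)" by (simp add: gam_abs)
  have h: "?h \<le> p + 1" using assms by linarith
  have 1: "op (\<lambda>n \<omega>. r ?h n \<omega> / real n - v * gam (int i - int j))"
    using r_lln[OF h] unfolding g .
  have 2: "op (\<lambda>n \<omega>. (lag_prod i j n \<omega> - r ?h n \<omega>) / real n)"
    using lag_prod_eqO[of i j] unfolding eqO_def by (rule Op_div_n)
  show ?thesis
    using op_add[OF 1 2] by (rule op_eq[where N=0]) (simp add: diff_divide_distrib)
qed

section \<open>Central limit theorem for linear combinations of the scores\<close>

definition "quad q g = (\<Sum>d<q. \<Sum>e<q. g d * g e * gam (int d - int e))"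

lemma quad_nonneg: "quad q g \<ge> 0"
proof (cases "\<forall>d<q. g d = 0")
  case True
  then show ?thesis by (simp add: quad_def)
next
  case False
  then show ?thesis using gam_pos_def[of _ q g] unfolding quad_def by (auto intro: less_imp_le)
qed

text \<open>The martingale theorem requires weights adapted to the innovations and with fourth
  moments, while \<open>U\<close> is only square integrable and not adapted. It is therefore applied
  to the process started from 0, and the contribution of \<open>U\<close>, which vanishes after
  division by sqrt n, is added afterwards.\<close>

lemma linear_clt_char:
  "(\<lambda>n. expectation (\<lambda>\<omega>. iexp (t * ((\<Sum>d<p+1. g d * score (Suc d) n \<omega>) / sqrt (real n)))))
    \<longlonglongrightarrow> complex_of_real (exp (- (t\<^sup>2 * v * (v * quad (p+1) g) / 2)))"
proof -
  \<comment> \<open>Instantiating the theory with initial value 0 turns its law of large numbers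
    into one for \<open>Y\<close>, which gives the limit of the conditional variance.\<close>
  interpret Z: dw_process p \<theta> \<rho> M V v "\<lambda>_. 0"
    by standard (use v_pos V_fourth in auto)
  have Zx: "Z.x m \<omega> = Y m \<omega>" for m \<omega> by (simp add: Z.x_def)
  define L where "L k \<omega> = (\<Sum>d<p+1. g d * Y (int k - int d) \<omega>)" for k \<omega>
  let ?G = "\<Sum>d<p+1. \<bar>g d\<bar>"
  have L_meas: "L k \<in> borel_measurable (F k)" for k
    unfolding L_def by (intro borel_measurable_sum borel_measurable_times borel_measurable_const Y_meas_F) auto
  let ?B = "\<lambda>k \<omega>. ?G ^ 3 * (\<Sum>d<p+1. \<bar>g d\<bar> * (Y (int k - int d) \<omega>) ^ 4)"
  have LB: "(L k \<omega>) ^ 4 \<le> ?B k \<omega>" for k \<omega>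
    unfolding L_def by (rule weighted_fourth_le)
  have iB: "integrable M (?B k)" for k
    using Y_fourth(1) by (intro integrable_mult_right Bochner_Integration.integrable_sum) auto
  have iL: "integrable M (\<lambda>\<omega>. (L k \<omega>) ^ 4)" for k
    by (rule integrable_dominated[OF iB _ _ LB]) (use F_M[OF L_meas] in auto)
  have KL: "expectation (\<lambda>\<omega>. (L k \<omega>) ^ 4) \<le> ?G ^ 3 * (\<Sum>d<p+1. \<bar>g d\<bar> * (psi_norm ^ 4 * m4))" for k
  proof -
    have "expectation (\<lambda>\<omega>. (L k \<omega>) ^ 4) \<le> expectation (?B k)" by (intro integral_mono iL iB LB)
    also have "\<dots> = ?G ^ 3 * (\<Sum>d<p+1. \<bar>g d\<bar> * expectation (\<lambda>\<omega>. (Y (int k - int d) \<omega>) ^ 4))"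
      using Y_fourth(1) by (simp add: Bochner_Integration.integral_sum del: sum.lessThan_Suc)
    also have "\<dots> \<le> ?G ^ 3 * (\<Sum>d<p+1. \<bar>g d\<bar> * (psi_norm ^ 4 * m4))"
      using Y_fourth(2) by (intro mult_left_mono sum_mono zero_le_power sum_nonneg) auto
    finally show ?thesis .
  qed
  have V3: "integrable M (\<lambda>\<omega>. \<bar>V 1 \<omega>\<bar> ^ 3)"
  proof (rule integrable_dominated[where B="\<lambda>\<omega>. 1 + (V 1 \<omega>) ^ 4"])
    show "integrable M (\<lambda>\<omega>. 1 + (V 1 \<omega>) ^ 4)" using V_fourth[of 1] by simp
    show "(\<lambda>\<omega>. \<bar>V 1 \<omega>\<bar> ^ 3) \<in> borel_measurable M" using V_meas[of 1] by simp
  qed (auto intro: abs_cube_le)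
  have avg: "op (\<lambda>n \<omega>. (\<Sum>k<n. (L k \<omega>)\<^sup>2) / real n - v * quad (p+1) g)"
  proof -
    have "op (\<lambda>n \<omega>. \<Sum>d<p+1. \<Sum>e<p+1. (g d * g e) * (Z.lag_prod (Suc d) (Suc e) n \<omega> / real n - v * gam (int (Suc d) - int (Suc e))))"
      by (intro op_sum op_cmult Z.lag_prod_lln) auto
    then show ?thesis
    proof (rule op_eq[where N=0])
      fix n \<omega>
      have "(\<Sum>k<n. (L k \<omega>)\<^sup>2) = (\<Sum>k<n. \<Sum>d<p+1. \<Sum>e<p+1. (g d * g e) * (Y (int k - int d) \<omega> * Y (int k - int e) \<omega>))"
        unfolding L_def power2_eq_square sum_product by (intro sum.cong refl) (simp only: mult_ac)
      also have "\<dots> = (\<Sum>d<p+1. \<Sum>k<n. \<Sum>e<p+1. (g d * g e) * (Y (int k - int d) \<omega> * Y (int k - int e) \<omega>))"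
        by (rule sum.swap)
      also have "\<dots> = (\<Sum>d<p+1. \<Sum>e<p+1. \<Sum>k<n. (g d * g e) * (Y (int k - int d) \<omega> * Y (int k - int e) \<omega>))"
        by (intro sum.cong refl sum.swap)
      also have "\<dots> = (\<Sum>d<p+1. \<Sum>e<p+1. (g d * g e) * Z.lag_prod (Suc d) (Suc e) n \<omega>)"
        unfolding Z.lag_prod_Suc Zx sum_distrib_left ..
      finally have 1: "(\<Sum>k<n. (L k \<omega>)\<^sup>2) / real n = (\<Sum>d<p+1. \<Sum>e<p+1. (g d * g e) * (Z.lag_prod (Suc d) (Suc e) n \<omega> / real n))"
        by (simp only: sum_divide_distrib times_divide_eq_right)
      have 2: "v * quad (p+1) g = (\<Sum>d<p+1. \<Sum>e<p+1. (g d * g e) * (v * gam (int (Suc d) - int (Suc e))))"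
        unfolding quad_def sum_distrib_left by (intro sum.cong refl) simp
      show "(\<Sum>k<n. (L k \<omega>)\<^sup>2) / real n - v * quad (p+1) g =
          (\<Sum>d<p+1. \<Sum>e<p+1. (g d * g e) * (Z.lag_prod (Suc d) (Suc e) n \<omega> / real n - v * gam (int (Suc d) - int (Suc e))))"
        unfolding 1 2 by (simp only: sum_subtractf right_diff_distrib)
    qed
  qed
  have lim: "(\<lambda>n. expectation (\<lambda>\<omega>. iexp (t * ((\<Sum>k<n. L k \<omega> * V (Suc k) \<omega>) / sqrt n))))
    \<longlonglongrightarrow> complex_of_real (exp (- (t\<^sup>2 * v * (v * quad (p+1) g) / 2)))"
    using v_nonneg quad_nonneg
    by (intro martingale_clt_char[OF V3 L_meas iL KL _ avg]) auto
  have score_meas: "score d n \<in> borel_measurable M" for d n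
    unfolding score_def by (intro borel_measurable_sum borel_measurable_times x_meas V_meas) auto
  show ?thesis
  proof (rule op_char_diff[OF _ _ _ lim, where N=0])
    show "(\<lambda>\<omega>. (\<Sum>k<n. L k \<omega> * V (Suc k) \<omega>) / sqrt (real n)) \<in> borel_measurable M" for n
      by (intro borel_measurable_divide borel_measurable_sum borel_measurable_times borel_measurable_const F_M[OF L_meas] V_meas) auto
    show "(\<lambda>\<omega>. (\<Sum>d<p+1. g d * score (Suc d) n \<omega>) / sqrt (real n)) \<in> borel_measurable M" for n
      by (intro borel_measurable_divide borel_measurable_sum borel_measurable_times borel_measurable_const score_meas)
    have q: "(\<Sum>d<p+1. g d * (S d / s)) = (\<Sum>d<p+1. g d * S d) / s" for S :: "nat \<Rightarrow> real" and s
      by (simp only: sum_divide_distrib times_divide_eq_right)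
    have "op (\<lambda>n \<omega>. - (\<Sum>d<p+1. g d * ((\<Sum>k=1..n. V k \<omega> * (psi (int k - int (Suc d)) * U \<omega>)) / sqrt (real n))))"
      by (intro op_uminus op_sum op_cmult div_sqrt_Op U_part_Op)
    then show "op (\<lambda>n \<omega>. (\<Sum>k<n. L k \<omega> * V (Suc k) \<omega>) / sqrt (real n) - (\<Sum>d<p+1. g d * score (Suc d) n \<omega>) / sqrt (real n))"
    proof (rule op_eq[where N=0])
      fix n \<omega>
      have "(\<Sum>k<n. L k \<omega> * V (Suc k) \<omega>) = (\<Sum>k<n. \<Sum>d<p+1. g d * (V (Suc k) \<omega> * Y (int (Suc k) - int (Suc d)) \<omega>))"
        unfolding L_def sum_distrib_right by (intro sum.cong refl) (simp add: mult_ac)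
      also have "\<dots> = (\<Sum>d<p+1. \<Sum>k<n. g d * (V (Suc k) \<omega> * Y (int (Suc k) - int (Suc d)) \<omega>))"
        by (rule sum.swap)
      also have "\<dots> = (\<Sum>d<p+1. g d * (\<Sum>k=1..n. V k \<omega> * Y (int k - int (Suc d)) \<omega>))"
        unfolding sum_Suc_shift sum_distrib_left ..
      finally have "(\<Sum>k<n. L k \<omega> * V (Suc k) \<omega>) - (\<Sum>d<p+1. g d * score (Suc d) n \<omega>) =
          (\<Sum>d<p+1. g d * ((\<Sum>k=1..n. V k \<omega> * Y (int k - int (Suc d)) \<omega>) - score (Suc d) n \<omega>))"
        by (simp only: right_diff_distrib sum_subtractf)
      also have "\<dots> = (\<Sum>d<p+1. g d * (- (\<Sum>k=1..n. V k \<omega> * (psi (int k - int (Suc d)) * U \<omega>))))"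
        unfolding score_def x_def distrib_left sum.distrib by simp
      finally show "(\<Sum>k<n. L k \<omega> * V (Suc k) \<omega>) / sqrt (real n) - (\<Sum>d<p+1. g d * score (Suc d) n \<omega>) / sqrt (real n) =
          - (\<Sum>d<p+1. g d * ((\<Sum>k=1..n. V k \<omega> * (psi (int k - int (Suc d)) * U \<omega>)) / sqrt (real n)))"
        unfolding diff_divide_distrib[symmetric] q
        by (simp only: mult_minus_right sum_negf minus_divide_left[symmetric])
    qed
  qed
qed

end

section \<open>Least squares and the Durbin-Watson statistic\<close>

context dw_process
begin

text \<open>The score with every lag product replaced by its Toeplitz representative. The identities
  used later, in particular those based on time reversal, are exact for these quantities.\<close>

definition score_approx :: "nat \<Rightarrow> nat \<Rightarrow> 'a \<Rightarrow> real" where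
  "score_approx d n \<omega> = (\<Sum>j\<le>p+1. a (int j) * r (nat \<bar>int d - int j\<bar>) n \<omega>)"

lemma score_md: "eqO (score d) (score_approx d)"
  using score_eqO unfolding score_approx_def[abs_def] .

lemma score_approx_eq: "score_approx d n \<omega> = r d n \<omega> - (\<Sum>j<p. b j * r (nat \<bar>int d - 1 - int j\<bar>) n \<omega>) + c * r (nat \<bar>int d - int p - 1\<bar>) n \<omega>"
  unfolding score_approx_def using ar_sum[of "\<lambda>m. r (nat \<bar>m\<bar>) n \<omega>" "int d"] by (simp del: sum.atMost_Suc)

lemma score_approx_Suc:
  assumes "i < p"
  shows "score_approx (Suc i) n \<omega> = r (Suc i) n \<omega> - (\<Sum>j<p. b j * r (nat \<bar>int i - int j\<bar>) n \<omega>) + c * r (p - i) n \<omega>"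
proof -
  have "nat \<bar>int (Suc i) - int p - 1\<bar> = p - i" using assms by auto
  moreover have "int (Suc i) - 1 - int j = int i - int j" for j by simp
  ultimately show ?thesis unfolding score_approx_eq by (simp only:)
qed

lemma score_approx_0: "score_approx 0 n \<omega> = r 0 n \<omega> - (\<Sum>j<p. b j * r (Suc j) n \<omega>) + c * r (Suc p) n \<omega>"
proof -
  have "nat \<bar>int 0 - 1 - int j\<bar> = Suc j" for j by auto
  moreover have "nat \<bar>int 0 - int p - 1\<bar> = Suc p" by auto
  ultimately show ?thesis unfolding score_approx_eq by (simp only:)
qed

lemma score_approx_last: "score_approx (Suc p) n \<omega> = r (Suc p) n \<omega> - (\<Sum>j<p. b j * r (p - j) n \<omega>) + c * r 0 n \<omega>"
proof -
  have "nat \<bar>int (Suc p) - 1 - int j\<bar> = p - j" if "j < p" for j using that by auto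
  moreover have "nat \<bar>int (Suc p) - int p - 1\<bar> = 0" by auto
  ultimately show ?thesis unfolding score_approx_eq by simp
qed

text \<open>The equations at positions i and p - 1 - i involve the same two autocovariances r (i +
  1) and r (p - i) with the coefficients 1 and c exchanged. Eliminating r (p - i) leaves the factor
  1 - c^2, which \<open>alph\<close> normalises; the coefficients of the remaining autocovariances
  become those of \<open>theta_star\<close>.\<close>

lemma score_approx_flip:
  assumes i: "i < p"
  shows "alph * (score_approx (Suc i) n \<omega> - c * score_approx (p - i) n \<omega>) =
    r (Suc i) n \<omega> - (\<Sum>j<p. th_star j * r (nat \<bar>int i - int j\<bar>) n \<omega>)"
proof -
  let ?i = "p - 1 - i"
  have i': "?i < p" "Suc ?i = p - i" "p - ?i = Suc i" using i by auto
  have "(\<Sum>j<p. b j * r (nat \<bar>int ?i - int j\<bar>) n \<omega>) = (\<Sum>j<p. b (p - 1 - j) * r (nat \<bar>int ?i - int (p - 1 - j)\<bar>) n \<omega>)"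
    by (rule sum_rev_index[symmetric])
  also have "\<dots> = (\<Sum>j<p. b (p - 1 - j) * r (nat \<bar>int i - int j\<bar>) n \<omega>)"
  proof (intro sum.cong refl)
    fix j assume "j \<in> {..<p}"
    then have "nat \<bar>int ?i - int (p - 1 - j)\<bar> = nat \<bar>int i - int j\<bar>" using i by auto
    then show "b (p - 1 - j) * r (nat \<bar>int ?i - int (p - 1 - j)\<bar>) n \<omega> = b (p - 1 - j) * r (nat \<bar>int i - int j\<bar>) n \<omega>"
      by simp
  qed
  finally have 1: "score_approx (p - i) n \<omega> = r (p - i) n \<omega> - (\<Sum>j<p. b (p - 1 - j) * r (nat \<bar>int i - int j\<bar>) n \<omega>) + c * r (Suc i) n \<omega>"
    using score_approx_Suc[OF i'(1), of n \<omega>] unfolding i' by simp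
  have "score_approx (Suc i) n \<omega> - c * score_approx (p - i) n \<omega> =
      (1 - c * c) * r (Suc i) n \<omega> - ((\<Sum>j<p. b j * r (nat \<bar>int i - int j\<bar>) n \<omega>) - c * (\<Sum>j<p. b (p - 1 - j) * r (nat \<bar>int i - int j\<bar>) n \<omega>))"
    unfolding score_approx_Suc[OF i] 1 by (simp add: algebra_simps)
  also have "(\<Sum>j<p. b j * r (nat \<bar>int i - int j\<bar>) n \<omega>) - c * (\<Sum>j<p. b (p - 1 - j) * r (nat \<bar>int i - int j\<bar>) n \<omega>)
     = (\<Sum>j<p. (b j - c * b (p - 1 - j)) * r (nat \<bar>int i - int j\<bar>) n \<omega>)"
    unfolding sum_distrib_left sum_subtractf[symmetric] by (intro sum.cong refl) (simp only: left_diff_distrib mult.assoc)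
  finally have e: "score_approx (Suc i) n \<omega> - c * score_approx (p - i) n \<omega> = (1 - c * c) * r (Suc i) n \<omega>
      - (\<Sum>j<p. (b j - c * b (p - 1 - j)) * r (nat \<bar>int i - int j\<bar>) n \<omega>)" .
  have distr: "alph * (q * z - s) = (alph * q) * z - alph * s" for q z s
    by (simp add: right_diff_distrib)
  have "alph * (score_approx (Suc i) n \<omega> - c * score_approx (p - i) n \<omega>) = (alph * (1 - c * c)) * r (Suc i) n \<omega>
      - alph * (\<Sum>j<p. (b j - c * b (p - 1 - j)) * r (nat \<bar>int i - int j\<bar>) n \<omega>)"
    unfolding e by (rule distr)
  then show ?thesis
    unfolding alph_c th_star_def by (simp only: sum_distrib_left mult_1_left mult.assoc)
qed

end

text \<open>The estimator enters only through its normal equations. With both lags raised by one,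
  the lag product runs over X at times 0 to n - 1, so that together with \<open>S i j\<close> it is
  an entry of S_{n-1}.\<close>

locale least_squares = dw_process p \<theta> \<rho> M V v U
  for p \<theta> \<rho> and M :: "'a measure" and V v U +
  fixes S :: "nat \<Rightarrow> nat \<Rightarrow> real" and th :: "nat \<Rightarrow> nat \<Rightarrow> 'a \<Rightarrow> real"
  assumes normal: "n \<ge> 1 \<Longrightarrow> \<omega> \<in> space M \<Longrightarrow> i < p \<Longrightarrow>
    (\<Sum>j<p. (lag_prod (Suc i) (Suc j) n \<omega> + S i j) * th j n \<omega>) = lag_prod (Suc i) 0 n \<omega>"
begin

definition "gram i j n \<omega> = lag_prod (Suc i) (Suc j) n \<omega> + S i j"

lemma gram_eqO: "eqO (gram i j) (r (nat \<bar>int i - int j\<bar>))"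
proof -
  have "eqO (\<lambda>n \<omega>. S i j) (\<lambda>n \<omega>. 0)" by (simp add: eqO_0 Op_const)
  from eqO_add[OF lag_prod_eqO[of "Suc i" "Suc j"] this] show ?thesis
    by (simp add: gram_def[abs_def])
qed

lemma gram_lln: "i < p \<Longrightarrow> j < p \<Longrightarrow> op (\<lambda>n \<omega>. v * gam (int i - int j) - gram i j n \<omega> / real n)"
proof -
  assume "i < p" "j < p"
  then have "op (\<lambda>n \<omega>. - (lag_prod (Suc i) (Suc j) n \<omega> / real n - v * gam (int (Suc i) - int (Suc j))) - S i j / real n)"
    by (intro op_diff op_uminus lag_prod_lln Op_div_n Op_const) auto
  then show ?thesis by (rule op_eq[where N=0]) (simp add: gram_def add_divide_distrib)
qed

definition "nscore i n \<omega> = alph * (score (Suc i) n \<omega> - c * score (p - i) n \<omega>)"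

text \<open>Inserting \<open>th_star\<close> into the normal equations leaves the defect computed in
  \<open>score_approx_flip\<close>, a combination of two scores. This is why the estimator converges
  to \<open>theta_star\<close> and not to \<theta>.\<close>

lemma normal_error:
  assumes i: "i < p"
  shows "eqO (\<lambda>n \<omega>. \<Sum>j<p. gram i j n \<omega> * (th j n \<omega> - th_star j)) (nscore i)"
proof -
  have "eqO (\<lambda>n \<omega>. \<Sum>j<p. gram i j n \<omega> * (th j n \<omega> - th_star j)) (\<lambda>n \<omega>. lag_prod (Suc i) 0 n \<omega> - (\<Sum>j<p. th_star j * gram i j n \<omega>))"
  proof (rule eqO_eq[where N=1])
    fix n :: nat and \<omega> assume "\<omega> \<in> space M" "1 \<le> n"
    then have "(\<Sum>j<p. gram i j n \<omega> * th j n \<omega>) = lag_prod (Suc i) 0 n \<omega>"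
      unfolding gram_def using normal i by blast
    moreover have "(\<Sum>j<p. gram i j n \<omega> * (th j n \<omega> - th_star j)) = (\<Sum>j<p. gram i j n \<omega> * th j n \<omega>) - (\<Sum>j<p. th_star j * gram i j n \<omega>)"
      by (simp only: right_diff_distrib sum_subtractf mult.commute[of "th_star _"])
    ultimately show "(\<Sum>j<p. gram i j n \<omega> * (th j n \<omega> - th_star j)) = lag_prod (Suc i) 0 n \<omega> - (\<Sum>j<p. th_star j * gram i j n \<omega>)"
      by simp
  qed
  also have "eqO \<dots> (\<lambda>n \<omega>. r (Suc i) n \<omega> - (\<Sum>j<p. th_star j * r (nat \<bar>int i - int j\<bar>) n \<omega>))"
  proof (intro eqO_diff eqO_sum eqO_cmult gram_eqO)
    show "eqO (lag_prod (Suc i) 0) (r (Suc i))" unfolding lag_prod_sym[of "Suc i" 0] by (rule eqO_refl)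
  qed
  also have "eqO \<dots> (\<lambda>n \<omega>. alph * (score_approx (Suc i) n \<omega> - c * score_approx (p - i) n \<omega>))"
    by (intro eqO_eq[where N=0]) (simp only: score_approx_flip[OF i])
  also have "eqO \<dots> (nscore i)"
    unfolding nscore_def[abs_def] by (intro eqO_cmult eqO_diff eqO_sym[OF score_md])
  finally show ?thesis .
qed

definition "u j n \<omega> = sqrt (real n) * (th j n \<omega> - th_star j)"
definition "nscore_scaled i n \<omega> = nscore i n \<omega> / sqrt (real n)"
definition "normal_err i n \<omega> = (\<Sum>j<p. gram i j n \<omega> / real n * u j n \<omega>) - nscore_scaled i n \<omega>"

lemma nscore_scaled_Op: "i < p \<Longrightarrow> Op (nscore_scaled i)"
proof -
  assume i: "i < p"
  have "Op (\<lambda>n \<omega>. alph * (score (Suc i) n \<omega> / sqrt (real n) - c * (score (p - i) n \<omega> / sqrt (real n))))"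
    using i by (intro Op_cmult Op_diff score_Op) auto
  then show ?thesis
    by (rule Op_eq[where N=0]) (simp only: nscore_scaled_def nscore_def times_divide_eq_right diff_divide_distrib[symmetric])
qed

lemma normal_err_op:
  assumes i: "i < p" shows "op (normal_err i)"
proof -
  have "op (\<lambda>n \<omega>. ((\<Sum>j<p. gram i j n \<omega> * (th j n \<omega> - th_star j)) - nscore i n \<omega>) / sqrt (real n))"
    using normal_error[OF i] unfolding eqO_def by (rule div_sqrt_Op)
  then show ?thesis
  proof (rule op_eq[where N=1])
    fix n :: nat and \<omega> assume "1 \<le> n"
    then have "y / real n * (sqrt (real n) * z) = y * z / sqrt (real n)" for y z
      using real_sqrt_mult_self[of "real n"] by (simp add: field_simps)
    then show "normal_err i n \<omega> = ((\<Sum>j<p. gram i j n \<omega> * (th j n \<omega> - th_star j)) - nscore i n \<omega>) / sqrt (real n)"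
      unfolding normal_err_def u_def nscore_scaled_def diff_divide_distrib sum_divide_distrib by (simp only:)
  qed
qed

definition "gam_u i n \<omega> = (\<Sum>j<p. gam (int i - int j) * u j n \<omega>)"
definition "cov_err i j n \<omega> = v * gam (int i - int j) - gram i j n \<omega> / real n"

text \<open>The empirical Gram matrix is replaced by its limit at the cost of a term that again
  contains \<open>u\<close>, so this becomes a linearisation only after \<open>u\<close> has been
  shown to be tight.\<close>

lemma gam_u_eq: "v * gam_u i n \<omega> = (\<Sum>j<p. cov_err i j n \<omega> * u j n \<omega>) + normal_err i n \<omega> + nscore_scaled i n \<omega>"
  by (simp add: gam_u_def cov_err_def normal_err_def left_diff_distrib sum_subtractf sum_distrib_left mult.assoc)

lemma u_solve:
  assumes "h < p"
  shows "u h n \<omega> = (\<Sum>i<p. mat_inv (Delta p \<theta> \<rho>) $$ (h, i) * gam_u i n \<omega>)"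
proof -
  have "u h n \<omega> = (\<Sum>i<p. mat_inv (Delta p \<theta> \<rho>) $$ (h, i) * (\<Sum>j<p. Delta p \<theta> \<rho> $$ (i, j) * u j n \<omega>))"
    by (rule left_inverse_solve[OF Delta_carrier Delta_inv(1,3) assms, symmetric])
  also have "\<dots> = (\<Sum>i<p. mat_inv (Delta p \<theta> \<rho>) $$ (h, i) * gam_u i n \<omega>)"
    unfolding gam_u_def by (intro sum.cong refl arg_cong2[where f="(*)"]) (simp_all add: Delta_nth)
  finally show ?thesis .
qed

text \<open>Inverting the limit \<open>Delta\<close>, and not the random Gram matrix, bounds the
  total size of \<open>u\<close> by a multiple \<open>H\<close> of itself plus a tight term. As
  \<open>H\<close> collects only the covariance errors, it vanishes, and \<open>op_absorb\<close>
  applies.\<close>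

lemma u_Op:
  assumes h: "h < p" shows "Op (u h)"
proof -
  define C where "C h i = \<bar>mat_inv (Delta p \<theta> \<rho>) $$ (h, i)\<bar>" for h i
  define tot where "tot n \<omega> = (\<Sum>j<p. \<bar>u j n \<omega>\<bar>)" for n \<omega>
  define G where "G i n \<omega> = (\<Sum>j<p. \<bar>cov_err i j n \<omega>\<bar>)" for i n \<omega>
  define H where "H n \<omega> = (\<Sum>h<p. \<Sum>i<p. (C h i / v) * G i n \<omega>)" for n \<omega>
  define B where "B n \<omega> = (\<Sum>h<p. \<Sum>i<p. (C h i / v) * \<bar>normal_err i n \<omega> + nscore_scaled i n \<omega>\<bar>)" for n \<omega>
  have tot0: "tot n \<omega> \<ge> 0" for n \<omega> unfolding tot_def by (simp add: sum_nonneg)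
  have H_op: "op H" unfolding H_def G_def
    by (intro op_sum op_cmult op_abs) (simp add: cov_err_def[abs_def] gram_lln)
  have B_Op: "Op B" unfolding B_def
    by (intro Op_sum Op_cmult Op_abs Op_add op_imp_Op normal_err_op nscore_scaled_Op) auto
  have tot_le: "tot n \<omega> \<le> H n \<omega> * tot n \<omega> + B n \<omega>" for n \<omega>
  proof -
    have gam_u: "\<bar>gam_u i n \<omega>\<bar> \<le> (1 / v) * ((\<Sum>j<p. \<bar>cov_err i j n \<omega>\<bar>) * tot n \<omega> + \<bar>normal_err i n \<omega> + nscore_scaled i n \<omega>\<bar>)" for i
    proof -
      have "\<bar>\<Sum>j<p. cov_err i j n \<omega> * u j n \<omega>\<bar> \<le> (\<Sum>j<p. \<bar>cov_err i j n \<omega>\<bar> * \<bar>u j n \<omega>\<bar>)"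
        by (rule order.trans[OF sum_abs]) (simp add: abs_mult)
      also have "\<dots> \<le> (\<Sum>j<p. \<bar>cov_err i j n \<omega>\<bar> * tot n \<omega>)"
        unfolding tot_def by (intro sum_mono mult_left_mono member_le_sum) auto
      finally have "\<bar>\<Sum>j<p. cov_err i j n \<omega> * u j n \<omega>\<bar> \<le> (\<Sum>j<p. \<bar>cov_err i j n \<omega>\<bar>) * tot n \<omega>"
        by (simp only: sum_distrib_right)
      then have "\<bar>v * gam_u i n \<omega>\<bar> \<le> (\<Sum>j<p. \<bar>cov_err i j n \<omega>\<bar>) * tot n \<omega> + \<bar>normal_err i n \<omega> + nscore_scaled i n \<omega>\<bar>"
        unfolding gam_u_eq by linarith
      then have "v * \<bar>gam_u i n \<omega>\<bar> \<le> (\<Sum>j<p. \<bar>cov_err i j n \<omega>\<bar>) * tot n \<omega> + \<bar>normal_err i n \<omega> + nscore_scaled i n \<omega>\<bar>"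
        using v_pos by (simp add: abs_mult)
      then show ?thesis using v_pos by (simp add: field_simps)
    qed
    have "tot n \<omega> \<le> (\<Sum>h<p. \<Sum>i<p. C h i * \<bar>gam_u i n \<omega>\<bar>)"
      unfolding tot_def
    proof (rule sum_mono)
      fix h assume "h \<in> {..<p}"
      then have "\<bar>u h n \<omega>\<bar> = \<bar>\<Sum>i<p. mat_inv (Delta p \<theta> \<rho>) $$ (h, i) * gam_u i n \<omega>\<bar>"
        using u_solve by simp
      also have "\<dots> \<le> (\<Sum>i<p. C h i * \<bar>gam_u i n \<omega>\<bar>)"
        by (rule order.trans[OF sum_abs]) (simp add: abs_mult C_def)
      finally show "\<bar>u h n \<omega>\<bar> \<le> (\<Sum>i<p. C h i * \<bar>gam_u i n \<omega>\<bar>)" .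
    qed
    also have "\<dots> \<le> (\<Sum>h<p. \<Sum>i<p. C h i * ((1 / v) * ((\<Sum>j<p. \<bar>cov_err i j n \<omega>\<bar>) * tot n \<omega> + \<bar>normal_err i n \<omega> + nscore_scaled i n \<omega>\<bar>)))"
      by (intro sum_mono mult_left_mono gam_u) (simp add: C_def)
    also have "\<dots> = H n \<omega> * tot n \<omega> + B n \<omega>"
      unfolding H_def B_def sum_distrib_right sum.distrib[symmetric] G_def[symmetric]
      by (intro sum.cong refl) (simp add: algebra_simps add_divide_distrib)
    finally show ?thesis .
  qed
  have "Op tot"
    by (rule op_absorb[where N=0, OF H_op B_Op]) (simp only: abs_of_nonneg[OF tot0] tot_le)
  then show ?thesis
  proof (rule Op_cong[where N=0])
    fix n \<omega>
    have "\<bar>u h n \<omega>\<bar> \<le> tot n \<omega>" unfolding tot_def using h by (intro member_le_sum[where f="\<lambda>j. \<bar>u j n \<omega>\<bar>"]) auto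
    then show "\<bar>u h n \<omega>\<bar> \<le> \<bar>tot n \<omega>\<bar>" by simp
  qed
qed

text \<open>Pairing the linearised normal equations with row h of the inverse of
  \<open>Delta\<close> isolates \<open>u h\<close>. The row is given by its defining property, so
  that the reversed first column can later be used for it.\<close>

lemma u_linear:
  assumes h: "h < p" and y: "\<And>j. j < p \<Longrightarrow> (\<Sum>i<p. y i * gam (int i - int j)) = (if j = h then 1 else 0)"
  shows "op (\<lambda>n \<omega>. u h n \<omega> - (1 / v) * (\<Sum>i<p. y i * nscore_scaled i n \<omega>))"
proof -
  have "op (\<lambda>n \<omega>. (1 / v) * (\<Sum>i<p. y i * ((\<Sum>j<p. cov_err i j n \<omega> * u j n \<omega>) + normal_err i n \<omega>)))"
    by (intro op_cmult op_sum op_add op_mult_Op u_Op normal_err_op) (simp_all add: cov_err_def[abs_def] gram_lln)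
  then show ?thesis
  proof (rule op_eq[where N=0])
    fix n \<omega>
    have "(\<Sum>i<p. y i * gam_u i n \<omega>) = (\<Sum>j<p. \<Sum>i<p. y i * gam (int i - int j) * u j n \<omega>)"
      unfolding gam_u_def sum_distrib_left by (subst sum.swap) (simp only: mult.assoc)
    also have "\<dots> = (\<Sum>j<p. (if j = h then 1 else 0) * u j n \<omega>)"
      unfolding sum_distrib_right[symmetric] by (intro sum.cong refl) (simp add: y)
    also have "\<dots> = u h n \<omega>" using h by (simp add: if_distrib[of "\<lambda>x. x * _"] cong: if_cong)
    finally have 1: "u h n \<omega> = (\<Sum>i<p. y i * gam_u i n \<omega>)" by simp
    have "gam_u i n \<omega> = (1 / v) * ((\<Sum>j<p. cov_err i j n \<omega> * u j n \<omega>) + normal_err i n \<omega> + nscore_scaled i n \<omega>)" for i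
      using gam_u_eq[of i n \<omega>] v_pos by (simp add: field_simps)
    then have "(\<Sum>i<p. y i * gam_u i n \<omega>) = (1 / v) * (\<Sum>i<p. y i * ((\<Sum>j<p. cov_err i j n \<omega> * u j n \<omega>) + normal_err i n \<omega>)) + (1 / v) * (\<Sum>i<p. y i * nscore_scaled i n \<omega>)"
      unfolding sum_distrib_left sum.distrib[symmetric] by (intro sum.cong refl) (simp add: algebra_simps)
    then show "u h n \<omega> - (1 / v) * (\<Sum>i<p. y i * nscore_scaled i n \<omega>) =
        (1 / v) * (\<Sum>i<p. y i * ((\<Sum>j<p. cov_err i j n \<omega> * u j n \<omega>) + normal_err i n \<omega>))"
      unfolding 1 by simp
  qed
qed

section \<open>Consistency of the estimator and cross products of the residuals\<close>

lemma th_op: "j < p \<Longrightarrow> op (\<lambda>n \<omega>. th j n \<omega> - th_star j)"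
proof -
  assume "j < p"
  then have "op (\<lambda>n \<omega>. u j n \<omega> / sqrt (real n))" by (intro div_sqrt_Op u_Op)
  then show ?thesis by (rule op_eq[where N=1]) (simp add: u_def)
qed

lemma th_Op: "j < p \<Longrightarrow> Op (th j)"
  by (rule Op_of_op_diff[OF th_op])

text \<open>By \<open>sum_res_x\<close> this is the sum over k of the residual at time k times
  X_{k-d}; the residuals themselves are introduced later.\<close>

definition "res_cross d n \<omega> = lag_prod 0 d n \<omega> - (\<Sum>j<p. th j n \<omega> * lag_prod (Suc j) d n \<omega>)"

text \<open>The normal equations make the residuals orthogonal to the regressors up to the
  contribution of S, which is a fixed matrix applied to the tight estimator.\<close>

lemma res_cross_orthogonal:
  assumes i: "i < p" shows "Op (res_cross (Suc i))"
proof -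
  have "Op (\<lambda>n \<omega>. \<Sum>j<p. S i j * th j n \<omega>)"
    by (intro Op_sum Op_cmult th_Op) auto
  then show ?thesis
  proof (rule Op_eq[where N=1])
    fix n :: nat and \<omega> assume "\<omega> \<in> space M" "1 \<le> n"
    then have "(\<Sum>j<p. (lag_prod (Suc i) (Suc j) n \<omega> + S i j) * th j n \<omega>) = lag_prod (Suc i) 0 n \<omega>"
      using normal i by blast
    then have "lag_prod 0 (Suc i) n \<omega> = (\<Sum>j<p. th j n \<omega> * lag_prod (Suc j) (Suc i) n \<omega>) + (\<Sum>j<p. S i j * th j n \<omega>)"
      unfolding lag_prod_sym[of 0] lag_prod_sym[of "Suc _" "Suc i"]
      by (simp only: distrib_right sum.distrib mult.commute[of "th _ _ _"])
    then show "res_cross (Suc i) n \<omega> = (\<Sum>j<p. S i j * th j n \<omega>)"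
      unfolding res_cross_def by simp
  qed
qed

text \<open>The Toeplitz versions of \<open>res_cross\<close> at lag 0, at lag p + 1 and at the lags
  i + 1 of the regressors.\<close>

definition "res_approx_0 n \<omega> = r 0 n \<omega> - (\<Sum>j<p. th j n \<omega> * r (Suc j) n \<omega>)"
definition "res_approx_last n \<omega> = r (Suc p) n \<omega> - (\<Sum>j<p. th j n \<omega> * r (p - j) n \<omega>)"
definition "res_approx i n \<omega> = r (Suc i) n \<omega> - (\<Sum>j<p. th j n \<omega> * r (nat \<bar>int i - int j\<bar>) n \<omega>)"

lemma res_cross_0: "eqO (res_cross 0) res_approx_0"
  unfolding res_cross_def[abs_def] res_approx_0_def[abs_def]
  by (intro eqO_diff eqO_refl eqO_sum eqO_mult th_Op) (simp_all add: lag_prod_sym[of "Suc _" 0] eqO_refl)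

lemma res_cross_last: "eqO (res_cross (Suc p)) res_approx_last"
  unfolding res_cross_def[abs_def] res_approx_last_def[abs_def]
proof (intro eqO_diff eqO_refl eqO_sum eqO_mult th_Op)
  fix j assume "j \<in> {..<p}"
  then have "nat \<bar>int (Suc j) - int (Suc p)\<bar> = p - j" by auto
  then show "eqO (lag_prod (Suc j) (Suc p)) (r (p - j))" using lag_prod_eqO[of "Suc j" "Suc p"] by (simp only:)
qed auto

lemma res_approx_Op: "i < p \<Longrightarrow> Op (res_approx i)"
proof -
  assume i: "i < p"
  have "eqO (res_cross (Suc i)) (res_approx i)"
    unfolding res_cross_def[abs_def] res_approx_def[abs_def]
  proof (intro eqO_diff eqO_refl eqO_sum eqO_mult th_Op)
    fix j
    have "nat \<bar>int (Suc i) - int (Suc j)\<bar> = nat \<bar>int i - int j\<bar>" by simp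
    then show "eqO (lag_prod (Suc j) (Suc i)) (r (nat \<bar>int i - int j\<bar>))"
      using lag_prod_eqO[of "Suc i" "Suc j"] by (simp add: lag_prod_sym[of "Suc j"])
  qed auto
  from eqO_trans[OF eqO_sym[OF this], of "\<lambda>n \<omega>. 0"] show ?thesis
    using res_cross_orthogonal[OF i] by (simp add: eqO_0)
qed

text \<open>The residual filter and the autoregressive filter commute: filtering the scores with the
  estimator equals applying the coefficients 1, - \<beta>, c to the residual products at lags 0, 1
  to p, and p + 1. The middle ones are negligible by orthogonality.\<close>

lemma forward_identity:
  "score_approx 0 n \<omega> - (\<Sum>j<p. th j n \<omega> * score_approx (Suc j) n \<omega>) = res_approx_0 n \<omega> + c * res_approx_last n \<omega> - (\<Sum>l<p. b l * res_approx l n \<omega>)"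
proof -
  have "(\<Sum>j<p. th j n \<omega> * score_approx (Suc j) n \<omega>) = (\<Sum>j<p. th j n \<omega> * r (Suc j) n \<omega>)
      - (\<Sum>j<p. \<Sum>l<p. th j n \<omega> * (b l * r (nat \<bar>int j - int l\<bar>) n \<omega>)) + c * (\<Sum>j<p. th j n \<omega> * r (p - j) n \<omega>)"
    unfolding sum_distrib_left sum_subtractf[symmetric] sum.distrib[symmetric]
    by (intro sum.cong refl) (simp add: score_approx_Suc algebra_simps sum_distrib_left)
  also have "(\<Sum>j<p. \<Sum>l<p. th j n \<omega> * (b l * r (nat \<bar>int j - int l\<bar>) n \<omega>)) =
      (\<Sum>l<p. b l * (\<Sum>j<p. th j n \<omega> * r (nat \<bar>int l - int j\<bar>) n \<omega>))"
    unfolding sum_distrib_left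
    by (subst sum.swap, intro sum.cong refl) (simp add: mult.left_commute abs_minus_commute)
  finally have 1: "(\<Sum>j<p. th j n \<omega> * score_approx (Suc j) n \<omega>) = (\<Sum>j<p. th j n \<omega> * r (Suc j) n \<omega>)
      - (\<Sum>l<p. b l * (\<Sum>j<p. th j n \<omega> * r (nat \<bar>int l - int j\<bar>) n \<omega>)) + c * (\<Sum>j<p. th j n \<omega> * r (p - j) n \<omega>)" .
  have 2: "(\<Sum>l<p. b l * res_approx l n \<omega>) = (\<Sum>l<p. b l * r (Suc l) n \<omega>) - (\<Sum>l<p. b l * (\<Sum>j<p. th j n \<omega> * r (nat \<bar>int l - int j\<bar>) n \<omega>))"
    unfolding res_approx_def by (simp only: right_diff_distrib sum_subtractf)
  show ?thesis unfolding 1 2 score_approx_0 res_approx_0_def res_approx_last_def by (simp add: algebra_simps)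
qed

text \<open>Time-reversed counterpart of the previous identity: \<open>X\<^sub>k\<^sub>-\<^sub>p\<^sub>-\<^sub>1\<close> is regressed on the same window, with
  the coefficients in reverse order.\<close>

lemma backward_identity:
  "score_approx (Suc p) n \<omega> - (\<Sum>j<p. th (p - 1 - j) n \<omega> * score_approx (Suc j) n \<omega>) =
    res_approx_last n \<omega> + c * res_approx_0 n \<omega> - (\<Sum>l<p. b l * res_approx (p - 1 - l) n \<omega>)"
proof -
  have flip: "(\<Sum>j<p. th (p - 1 - j) n \<omega> * f j) = (\<Sum>j<p. th j n \<omega> * f (p - 1 - j))" for f
    by (subst sum_rev_index[symmetric]) (intro sum.cong refl, simp)
  have "(\<Sum>j<p. th (p - 1 - j) n \<omega> * score_approx (Suc j) n \<omega>) = (\<Sum>j<p. th (p - 1 - j) n \<omega> * r (Suc j) n \<omega>)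
      - (\<Sum>j<p. \<Sum>l<p. th (p - 1 - j) n \<omega> * (b l * r (nat \<bar>int j - int l\<bar>) n \<omega>))
      + c * (\<Sum>j<p. th (p - 1 - j) n \<omega> * r (p - j) n \<omega>)"
    unfolding sum_distrib_left sum_subtractf[symmetric] sum.distrib[symmetric]
    by (intro sum.cong refl) (simp add: score_approx_Suc algebra_simps sum_distrib_left)
  also have "(\<Sum>j<p. th (p - 1 - j) n \<omega> * r (Suc j) n \<omega>) = (\<Sum>j<p. th j n \<omega> * r (p - j) n \<omega>)"
    unfolding flip by (intro sum.cong refl) (simp add: Suc_diff_Suc)
  also have "(\<Sum>j<p. th (p - 1 - j) n \<omega> * r (p - j) n \<omega>) = (\<Sum>j<p. th j n \<omega> * r (Suc j) n \<omega>)"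
    unfolding flip
  proof (intro sum.cong refl)
    fix j assume "j \<in> {..<p}"
    then have "p - (p - 1 - j) = Suc j" by auto
    then show "th j n \<omega> * r (p - (p - 1 - j)) n \<omega> = th j n \<omega> * r (Suc j) n \<omega>" by simp
  qed
  also have "(\<Sum>j<p. \<Sum>l<p. th (p - 1 - j) n \<omega> * (b l * r (nat \<bar>int j - int l\<bar>) n \<omega>)) =
      (\<Sum>l<p. b l * (\<Sum>j<p. th j n \<omega> * r (nat \<bar>int (p - 1 - l) - int j\<bar>) n \<omega>))"
  proof -
    have "(\<Sum>j<p. \<Sum>l<p. th (p - 1 - j) n \<omega> * (b l * r (nat \<bar>int j - int l\<bar>) n \<omega>)) =
        (\<Sum>l<p. b l * (\<Sum>j<p. th (p - 1 - j) n \<omega> * r (nat \<bar>int j - int l\<bar>) n \<omega>))"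
      unfolding sum_distrib_left by (subst sum.swap, intro sum.cong refl) (simp add: mult.left_commute)
    also have "\<dots> = (\<Sum>l<p. b l * (\<Sum>j<p. th j n \<omega> * r (nat \<bar>int (p - 1 - j) - int l\<bar>) n \<omega>))"
      unfolding flip ..
    also have "\<dots> = (\<Sum>l<p. b l * (\<Sum>j<p. th j n \<omega> * r (nat \<bar>int (p - 1 - l) - int j\<bar>) n \<omega>))"
    proof (intro sum.cong refl arg_cong2[where f="(*)"])
      fix l j assume "l \<in> {..<p}" "j \<in> {..<p}"
      then have "nat \<bar>int (p - 1 - j) - int l\<bar> = nat \<bar>int (p - 1 - l) - int j\<bar>" by auto
      then show "r (nat \<bar>int (p - 1 - j) - int l\<bar>) n \<omega> = r (nat \<bar>int (p - 1 - l) - int j\<bar>) n \<omega>" by simp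
    qed
    finally show ?thesis .
  qed
  finally have 1: "(\<Sum>j<p. th (p - 1 - j) n \<omega> * score_approx (Suc j) n \<omega>) = (\<Sum>j<p. th j n \<omega> * r (p - j) n \<omega>)
      - (\<Sum>l<p. b l * (\<Sum>j<p. th j n \<omega> * r (nat \<bar>int (p - 1 - l) - int j\<bar>) n \<omega>))
      + c * (\<Sum>j<p. th j n \<omega> * r (Suc j) n \<omega>)" .
  have "(\<Sum>l<p. b l * r (Suc (p - 1 - l)) n \<omega>) = (\<Sum>l<p. b l * r (p - l) n \<omega>)"
    by (intro sum.cong refl) (simp add: Suc_diff_Suc)
  then have 2: "(\<Sum>l<p. b l * res_approx (p - 1 - l) n \<omega>) = (\<Sum>l<p. b l * r (p - l) n \<omega>)
      - (\<Sum>l<p. b l * (\<Sum>j<p. th j n \<omega> * r (nat \<bar>int (p - 1 - l) - int j\<bar>) n \<omega>))"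
    unfolding res_approx_def by (simp only: right_diff_distrib sum_subtractf)
  show ?thesis unfolding 1 2 score_approx_last res_approx_0_def res_approx_last_def by (simp add: algebra_simps)
qed

text \<open>The sum over k of V_k times the backward residual of X_{k-p-1}, that is, its deviation
  from the reversed regression on X_{k-1}, ..., X_{k-p}.\<close>

definition "bscore n \<omega> = score (Suc p) n \<omega> - (\<Sum>j<p. th (p - 1 - j) n \<omega> * score (Suc j) n \<omega>)"

text \<open>The terms weighted by \<beta> in \<open>backward_identity\<close> are residual products
  at lags p - l, all between 1 and p, hence negligible; only the lags p + 1 and 0 remain.\<close>

lemma res_cross_backward: "eqO (res_cross (Suc p)) (\<lambda>n \<omega>. bscore n \<omega> - c * res_cross 0 n \<omega>)"
proof -
  have U: "eqO bscore (\<lambda>n \<omega>. score_approx (Suc p) n \<omega> - (\<Sum>j<p. th (p - 1 - j) n \<omega> * score_approx (Suc j) n \<omega>))"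
    unfolding bscore_def[abs_def] by (intro eqO_diff eqO_sum eqO_mult th_Op score_md) auto
  also have "eqO \<dots> (\<lambda>n \<omega>. res_approx_last n \<omega> + c * res_approx_0 n \<omega> - (\<Sum>l<p. b l * 0))"
    unfolding backward_identity
    by (intro eqO_diff eqO_refl eqO_sum eqO_cmult) (use res_approx_Op p in \<open>simp add: eqO_0\<close>)
  also have "eqO \<dots> (\<lambda>n \<omega>. res_cross (Suc p) n \<omega> + c * res_cross 0 n \<omega>)"
    using eqO_add[OF eqO_sym[OF res_cross_last] eqO_cmult[OF eqO_sym[OF res_cross_0], of c]] by simp
  finally have "eqO (\<lambda>n \<omega>. res_cross (Suc p) n \<omega> + c * res_cross 0 n \<omega>) bscore" by (rule eqO_sym)
  from eqO_diff[OF this eqO_refl[of "\<lambda>n \<omega>. c * res_cross 0 n \<omega>"]] show ?thesis by simp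
qed

lemma res_cross_forward: "eqO (\<lambda>n \<omega>. res_cross 0 n \<omega> + c * res_cross (Suc p) n \<omega>) (\<lambda>n \<omega>. score 0 n \<omega> - (\<Sum>j<p. th j n \<omega> * score (Suc j) n \<omega>))"
proof -
  have "eqO (\<lambda>n \<omega>. score 0 n \<omega> - (\<Sum>j<p. th j n \<omega> * score (Suc j) n \<omega>)) (\<lambda>n \<omega>. score_approx 0 n \<omega> - (\<Sum>j<p. th j n \<omega> * score_approx (Suc j) n \<omega>))"
    by (intro eqO_diff eqO_sum eqO_mult th_Op score_md) auto
  also have "eqO \<dots> (\<lambda>n \<omega>. res_approx_0 n \<omega> + c * res_approx_last n \<omega> - (\<Sum>l<p. b l * 0))"
    unfolding forward_identity
    by (intro eqO_diff eqO_refl eqO_sum eqO_cmult) (use res_approx_Op in \<open>simp add: eqO_0\<close>)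
  also have "eqO \<dots> (\<lambda>n \<omega>. res_cross 0 n \<omega> + c * res_cross (Suc p) n \<omega>)"
    using eqO_add[OF eqO_sym[OF res_cross_0] eqO_cmult[OF eqO_sym[OF res_cross_last], of c]] by simp
  finally show ?thesis by (rule eqO_sym)
qed

lemma bscore_Op: "Op (\<lambda>n \<omega>. bscore n \<omega> / sqrt (real n))"
proof -
  have "Op (\<lambda>n \<omega>. score (Suc p) n \<omega> / sqrt (real n) - (\<Sum>j<p. th (p - 1 - j) n \<omega> * (score (Suc j) n \<omega> / sqrt (real n))))"
    by (intro Op_diff Op_sum Op_mult th_Op score_Op) auto
  then show ?thesis
    by (rule Op_eq[where N=0]) (simp only: bscore_def diff_divide_distrib sum_divide_distrib times_divide_eq_right)
qed

text \<open>The forward and backward relations are two linear equations for the residual products at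
  lags 0 and p + 1. Eliminating the latter leaves (1 - c^2) times the former on one side and the
  drift of \<open>score 0\<close> on the other; hence the factor \<open>alph\<close>.\<close>

lemma res_cross_0_lln: "op (\<lambda>n \<omega>. res_cross 0 n \<omega> / real n - alph * v)"
proof -
  have 1: "op (\<lambda>n \<omega>. (res_cross (Suc p) n \<omega> - (bscore n \<omega> - c * res_cross 0 n \<omega>)) / real n)"
    using res_cross_backward unfolding eqO_def by (rule Op_div_n)
  have 2: "op (\<lambda>n \<omega>. (res_cross 0 n \<omega> + c * res_cross (Suc p) n \<omega> - (score 0 n \<omega> - (\<Sum>j<p. th j n \<omega> * score (Suc j) n \<omega>))) / real n)"
    using res_cross_forward unfolding eqO_def by (rule Op_div_n)
  have 3: "op (\<lambda>n \<omega>. \<Sum>j<p. th j n \<omega> * (score (Suc j) n \<omega> / real n))"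
    by (intro op_sum Op_mult_op th_Op op_div_n score_Op) auto
  have 4: "op (\<lambda>n \<omega>. score 0 n \<omega> / real n - v)" using score_lln[of 0] by simp
  have 5: "op (\<lambda>n \<omega>. bscore n \<omega> / real n)" by (rule op_div_n[OF bscore_Op])
  have "op (\<lambda>n \<omega>. alph * ((res_cross 0 n \<omega> + c * res_cross (Suc p) n \<omega> - (score 0 n \<omega> - (\<Sum>j<p. th j n \<omega> * score (Suc j) n \<omega>))) / real n
      - c * ((res_cross (Suc p) n \<omega> - (bscore n \<omega> - c * res_cross 0 n \<omega>)) / real n)
      + ((score 0 n \<omega> / real n - v) - (\<Sum>j<p. th j n \<omega> * (score (Suc j) n \<omega> / real n))) - c * (bscore n \<omega> / real n)))"
    by (intro op_cmult op_diff op_add 1 2 3 4 5)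
  then show ?thesis
  proof (rule op_eq[where N=0])
    fix n \<omega>
    define m where "m = real n"
    define s where "s = (\<Sum>j<p. th j n \<omega> * score (Suc j) n \<omega>)"
    have s: "(\<Sum>j<p. th j n \<omega> * (score (Suc j) n \<omega> / m)) = s / m"
      unfolding s_def by (simp only: times_divide_eq_right sum_divide_distrib)
    have id: "(E + k * L - (A - s)) / m - k * ((L - (W - k * E)) / m) + ((A / m - v) - s / m) - k * (W / m) = (1 - k * k) * (E / m) - v"
      for E L A W k by (simp add: diff_divide_distrib add_divide_distrib algebra_simps)
    have distr: "alph * (q * z - s) = (alph * q) * z - alph * s" for q z s
      by (simp add: right_diff_distrib)
    have "alph * ((1 - c * c) * (res_cross 0 n \<omega> / m) - v) = (alph * (1 - c * c)) * (res_cross 0 n \<omega> / m) - alph * v"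
      by (rule distr)
    then show "res_cross 0 n \<omega> / real n - alph * v = alph * ((res_cross 0 n \<omega> + c * res_cross (Suc p) n \<omega> - (score 0 n \<omega> - (\<Sum>j<p. th j n \<omega> * score (Suc j) n \<omega>))) / real n
      - c * ((res_cross (Suc p) n \<omega> - (bscore n \<omega> - c * res_cross 0 n \<omega>)) / real n)
      + ((score 0 n \<omega> / real n - v) - (\<Sum>j<p. th j n \<omega> * (score (Suc j) n \<omega> / real n))) - c * (bscore n \<omega> / real n))"
      unfolding m_def[symmetric] s s_def[symmetric] id alph_c by simp
  qed
qed

section \<open>Expansion of the Durbin-Watson statistic\<close>

definition "res n k \<omega> = x (int k) \<omega> - (\<Sum>j<p. th j n \<omega> * x (int k - 1 - int j) \<omega>)"

lemma res_0: "res n 0 \<omega> = U \<omega>"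
  by (simp add: res_def x_0 x_neg)

lemma sum_res_x: "(\<Sum>k=1..n. res n k \<omega> * x (int k - int d) \<omega>) = res_cross d n \<omega>"
proof -
  have "(\<Sum>k=1..n. res n k \<omega> * x (int k - int d) \<omega>) =
      (\<Sum>k=1..n. x (int k) \<omega> * x (int k - int d) \<omega>) - (\<Sum>k=1..n. \<Sum>j<p. th j n \<omega> * (x (int k - int (Suc j)) \<omega> * x (int k - int d) \<omega>))"
    unfolding res_def left_diff_distrib sum_subtractf sum_distrib_right
    by (simp add: mult.assoc algebra_simps)
  also have "(\<Sum>k=1..n. \<Sum>j<p. th j n \<omega> * (x (int k - int (Suc j)) \<omega> * x (int k - int d) \<omega>)) =
      (\<Sum>j<p. th j n \<omega> * lag_prod (Suc j) d n \<omega>)"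
    unfolding lag_prod_def sum_distrib_left by (rule sum.swap)
  finally show ?thesis unfolding res_cross_def lag_prod_def[of 0] by simp
qed

definition "rss n \<omega> = (\<Sum>k=0..n. (res n k \<omega>)\<^sup>2)"
definition "res_lag_sum n \<omega> = (\<Sum>k=1..n. res n k \<omega> * res n (k - 1) \<omega>)"

lemma rss_eq: "rss n \<omega> = (U \<omega>)\<^sup>2 + (res_cross 0 n \<omega> - (\<Sum>j<p. th j n \<omega> * res_cross (Suc j) n \<omega>))"
proof -
  have "rss n \<omega> = (res n 0 \<omega>)\<^sup>2 + (\<Sum>k=1..n. (res n k \<omega>)\<^sup>2)"
    unfolding rss_def by (simp add: sum.atLeast_Suc_atMost)
  also have "(\<Sum>k=1..n. (res n k \<omega>)\<^sup>2) = (\<Sum>k=1..n. res n k \<omega> * x (int k - int 0) \<omega> - (\<Sum>j<p. th j n \<omega> * (res n k \<omega> * x (int k - int (Suc j)) \<omega>)))"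
  proof (intro sum.cong refl)
    fix k
    have "(res n k \<omega>)\<^sup>2 = res n k \<omega> * (x (int k) \<omega> - (\<Sum>j<p. th j n \<omega> * x (int k - 1 - int j) \<omega>))"
      by (simp add: power2_eq_square res_def)
    then show "(res n k \<omega>)\<^sup>2 = res n k \<omega> * x (int k - int 0) \<omega> - (\<Sum>j<p. th j n \<omega> * (res n k \<omega> * x (int k - int (Suc j)) \<omega>))"
      by (simp add: right_diff_distrib sum_distrib_left mult.left_commute diff_diff_eq)
  qed
  also have "\<dots> = res_cross 0 n \<omega> - (\<Sum>k=1..n. \<Sum>j<p. th j n \<omega> * (res n k \<omega> * x (int k - int (Suc j)) \<omega>))"
    unfolding sum_subtractf sum_res_x ..
  also have "(\<Sum>k=1..n. \<Sum>j<p. th j n \<omega> * (res n k \<omega> * x (int k - int (Suc j)) \<omega>)) = (\<Sum>j<p. th j n \<omega> * res_cross (Suc j) n \<omega>)"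
    unfolding sum_res_x[symmetric] sum_distrib_left by (rule sum.swap)
  finally show ?thesis by (simp add: res_0)
qed

lemma res_lag_sum_eq: "res_lag_sum n \<omega> = res_cross 1 n \<omega> - (\<Sum>j<p. th j n \<omega> * res_cross (Suc (Suc j)) n \<omega>)"
proof -
  have "res_lag_sum n \<omega> = (\<Sum>k=1..n. res n k \<omega> * x (int k - int 1) \<omega> - (\<Sum>j<p. th j n \<omega> * (res n k \<omega> * x (int k - int (Suc (Suc j))) \<omega>)))"
    unfolding res_lag_sum_def
  proof (intro sum.cong refl)
    fix k assume "k \<in> {1..n}"
    then have "int (k - 1) = int k - 1" by auto
    then have "res n (k - 1) \<omega> = x (int k - int 1) \<omega> - (\<Sum>j<p. th j n \<omega> * x (int k - int (Suc (Suc j))) \<omega>)"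
      unfolding res_def by (simp add: algebra_simps)
    then show "res n k \<omega> * res n (k - 1) \<omega> = res n k \<omega> * x (int k - int 1) \<omega> - (\<Sum>j<p. th j n \<omega> * (res n k \<omega> * x (int k - int (Suc (Suc j))) \<omega>))"
      by (simp only: right_diff_distrib sum_distrib_left mult.left_commute)
  qed
  also have "\<dots> = res_cross 1 n \<omega> - (\<Sum>k=1..n. \<Sum>j<p. th j n \<omega> * (res n k \<omega> * x (int k - int (Suc (Suc j))) \<omega>))"
    unfolding sum_subtractf sum_res_x ..
  also have "(\<Sum>k=1..n. \<Sum>j<p. th j n \<omega> * (res n k \<omega> * x (int k - int (Suc (Suc j))) \<omega>)) = (\<Sum>j<p. th j n \<omega> * res_cross (Suc (Suc j)) n \<omega>)"
    unfolding sum_res_x[symmetric] sum_distrib_left by (rule sum.swap)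
  finally show ?thesis .
qed

lemma rss_eqO: "eqO rss (res_cross 0)"
proof -
  have "eqO (\<lambda>n \<omega>. (U \<omega>)\<^sup>2 + (res_cross 0 n \<omega> - (\<Sum>j<p. th j n \<omega> * res_cross (Suc j) n \<omega>))) (\<lambda>n \<omega>. 0 + (res_cross 0 n \<omega> - (\<Sum>j<p. th j n \<omega> * 0)))"
    by (intro eqO_add eqO_diff eqO_refl eqO_sum eqO_mult th_Op)
       (use res_cross_orthogonal U_meas in \<open>auto simp: eqO_0 intro: Op_fun\<close>)
  then show ?thesis unfolding rss_eq[abs_def] by simp
qed

abbreviation "th_last \<equiv> th (p - 1)"

text \<open>The product of two consecutive residuals involves X at lags 1 to p + 1 from the later
  one. Orthogonality removes the lags 1 to p, and lag p + 1 carries minus the last component of the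
  estimator.\<close>

lemma res_lag_sum_eqO: "eqO res_lag_sum (\<lambda>n \<omega>. - (th_last n \<omega> * res_cross (Suc p) n \<omega>))"
proof -
  have split: "(\<Sum>j<p. f j) = (\<Sum>j<p-1. f j) + f (p - 1)" for f :: "nat \<Rightarrow> real"
    using p by (cases p) auto
  have pp: "Suc (Suc (p - 1)) = Suc p" using p by simp
  have "eqO res_lag_sum (\<lambda>n \<omega>. res_cross 1 n \<omega> - ((\<Sum>j<p-1. th j n \<omega> * res_cross (Suc (Suc j)) n \<omega>) + th_last n \<omega> * res_cross (Suc p) n \<omega>))"
    by (rule eqO_eq[where N=0]) (simp only: res_lag_sum_eq split pp)
  also have "eqO \<dots> (\<lambda>n \<omega>. 0 - ((\<Sum>j<p-1. th j n \<omega> * 0) + th_last n \<omega> * res_cross (Suc p) n \<omega>))"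
    by (intro eqO_add eqO_diff eqO_refl eqO_sum eqO_mult th_Op)
       (use res_cross_orthogonal[of 0] res_cross_orthogonal[of "Suc _"] p in \<open>auto simp: eqO_0\<close>)
  finally show ?thesis by simp
qed

lemma rss_lln: "op (\<lambda>n \<omega>. rss n \<omega> / real n - alph * v)"
proof -
  have "op (\<lambda>n \<omega>. (rss n \<omega> - res_cross 0 n \<omega>) / real n + (res_cross 0 n \<omega> / real n - alph * v))"
    using rss_eqO unfolding eqO_def by (intro op_add Op_div_n res_cross_0_lln)
  then show ?thesis by (rule op_eq[where N=0]) (simp add: diff_divide_distrib)
qed

lemma res_lag_sum_error: "eqO res_lag_sum (\<lambda>n \<omega>. c * (th_last n \<omega> * rss n \<omega>) - th_last n \<omega> * bscore n \<omega>)"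
proof -
  have th_last: "Op (th_last)" using p by (intro th_Op) auto
  note res_lag_sum_eqO
  also have "eqO (\<lambda>n \<omega>. - (th_last n \<omega> * res_cross (Suc p) n \<omega>)) (\<lambda>n \<omega>. - (th_last n \<omega> * (bscore n \<omega> - c * res_cross 0 n \<omega>)))"
    using eqO_cmult[OF eqO_mult[OF th_last res_cross_backward], of "-1"] by simp
  also have "eqO \<dots> (\<lambda>n \<omega>. - (th_last n \<omega> * (bscore n \<omega> - c * rss n \<omega>)))"
    using eqO_cmult[OF eqO_mult[OF th_last eqO_diff[OF eqO_refl[of bscore] eqO_cmult[OF eqO_sym[OF rss_eqO], of c]]], of "-1"] by simp
  also have "eqO \<dots> (\<lambda>n \<omega>. c * (th_last n \<omega> * rss n \<omega>) - th_last n \<omega> * bscore n \<omega>)"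
    by (rule eqO_eq[where N=0]) (simp add: algebra_simps)
  finally show ?thesis .
qed

definition "dw_stat n \<omega> = inverse (rss n \<omega>) * (\<Sum>k=1..n. (res n k \<omega> - res n (k - 1) \<omega>)\<^sup>2)"
definition "th_star_last = th_star (p - 1)"

text \<open>The bounded part of the numerator: after expanding the squares, each of the two sums of
  squared residuals lacks one end term of \<open>rss\<close>, and the last bracket is the error in
  \<open>res_lag_sum_error\<close>.\<close>

definition "dw_rem n \<omega> = - (U \<omega>)\<^sup>2 - (res n n \<omega>)\<^sup>2 - 2 * (res_lag_sum n \<omega> - (c * (th_last n \<omega> * rss n \<omega>) - th_last n \<omega> * bscore n \<omega>))"

lemma dw_stat_num: "(\<Sum>k=1..n. (res n k \<omega> - res n (k - 1) \<omega>)\<^sup>2) =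
    2 * rss n \<omega> - 2 * (c * (th_last n \<omega> * rss n \<omega>) - th_last n \<omega> * bscore n \<omega>) + dw_rem n \<omega>"
proof -
  have "(\<Sum>k=1..n. (res n k \<omega> - res n (k - 1) \<omega>)\<^sup>2) = (\<Sum>k=1..n. (res n k \<omega>)\<^sup>2) + (\<Sum>k=1..n. (res n (k - 1) \<omega>)\<^sup>2) - 2 * res_lag_sum n \<omega>"
    unfolding res_lag_sum_def power2_diff sum_subtractf sum.distrib by (simp add: sum_distrib_left mult.assoc)
  also have "(\<Sum>k=1..n. (res n k \<omega>)\<^sup>2) = rss n \<omega> - (U \<omega>)\<^sup>2"
    unfolding rss_def by (simp add: sum.atLeast_Suc_atMost res_0)
  also have "(\<Sum>k=1..n. (res n (k - 1) \<omega>)\<^sup>2) = (\<Sum>k<n. (res n k \<omega>)\<^sup>2)"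
    unfolding sum_Suc_shift by simp
  also have "\<dots> = rss n \<omega> - (res n n \<omega>)\<^sup>2"
    unfolding rss_def atLeast0AtMost lessThan_Suc_atMost[symmetric] by simp
  finally show ?thesis unfolding dw_rem_def by simp
qed

lemma dw_rem_Op: "Op dw_rem"
proof -
  have "Op (\<lambda>n \<omega>. x (int n) \<omega> - (\<Sum>j<p. th j n \<omega> * x (int n - 1 - int j) \<omega>))"
    by (intro Op_diff x_Op Op_sum Op_mult th_Op) auto
  then have "Op (\<lambda>n \<omega>. res n n \<omega>)" unfolding res_def .
  then have r: "Op (\<lambda>n \<omega>. (res n n \<omega>)\<^sup>2)" unfolding power2_eq_square by (intro Op_mult)
  show ?thesis unfolding dw_rem_def[abs_def]
    by (rule Op_diff[OF Op_diff[OF Op_uminus[OF Op_fun] r] Op_cmult[OF res_lag_sum_error[unfolded eqO_def]]])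
       (use U_meas in measurable)
qed

text \<open>The deviation of the statistic equals -2 c times the error of the last component plus (2
  \<open>th_last\<close> \<open>bscore\<close> + \<open>dw_rem\<close>) / \<open>rss\<close>. After
  multiplication by sqrt n, the estimator and \<open>rss\<close> / n in the second part may be
  replaced by their limits, and the bounded remainder disappears.\<close>

lemma dw_stat_expansion:
  "op (\<lambda>n \<omega>. sqrt (real n) * (dw_stat n \<omega> - 2 * (1 - c * th_star_last))
     - (- 2 * c * u (p - 1) n \<omega> + 2 * th_star_last / (alph * v) * ((score (Suc p) n \<omega> - (\<Sum>j<p. th_star (p - 1 - j) * score (Suc j) n \<omega>)) / sqrt (real n))))"
proof -
  let ?q = "\<lambda>n \<omega>. rss n \<omega> / real n"
  let ?Us = "\<lambda>n \<omega>. score (Suc p) n \<omega> - (\<Sum>j<p. th_star (p - 1 - j) * score (Suc j) n \<omega>)"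
  have av: "alph * v \<noteq> 0" using alph_pos v_pos by simp
  note inv = op_inverse[OF rss_lln av]
  have inv_Op: "Op (\<lambda>n \<omega>. inverse (?q n \<omega>))" by (rule Op_of_op_diff[OF inv])
  have tl_op: "op (\<lambda>n \<omega>. th_last n \<omega> - th_star_last)" unfolding th_star_last_def using p by (intro th_op) auto
  have U_diff: "op (\<lambda>n \<omega>. bscore n \<omega> / sqrt (real n) - ?Us n \<omega> / sqrt (real n))"
  proof -
    have "op (\<lambda>n \<omega>. - (\<Sum>j<p. (th (p - 1 - j) n \<omega> - th_star (p - 1 - j)) * (score (Suc j) n \<omega> / sqrt (real n))))"
      by (intro op_uminus op_sum op_mult_Op th_op score_Op) auto
    then show ?thesis
    proof (rule op_eq[where N=0])
      fix n \<omega>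
      have 1: "(\<Sum>j<p. (th (p - 1 - j) n \<omega> - th_star (p - 1 - j)) * (score (Suc j) n \<omega> / sqrt (real n))) =
         ((\<Sum>j<p. th (p - 1 - j) n \<omega> * score (Suc j) n \<omega>) - (\<Sum>j<p. th_star (p - 1 - j) * score (Suc j) n \<omega>)) / sqrt (real n)"
        by (simp only: left_diff_distrib sum_subtractf diff_divide_distrib sum_divide_distrib times_divide_eq_right)
      show "bscore n \<omega> / sqrt (real n) - ?Us n \<omega> / sqrt (real n) =
         - (\<Sum>j<p. (th (p - 1 - j) n \<omega> - th_star (p - 1 - j)) * (score (Suc j) n \<omega> / sqrt (real n)))"
        unfolding 1 bscore_def diff_divide_distrib by simp
    qed
  qed
  have Us_Op: "Op (\<lambda>n \<omega>. ?Us n \<omega> / sqrt (real n))"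
    using Op_diff[OF bscore_Op op_imp_Op[OF U_diff]] by simp
  have tl_Op: "Op th_last" by (rule Op_of_op_diff[OF tl_op])
  have rest: "op (\<lambda>n \<omega>. 2 * (((th_last n \<omega> - th_star_last) * (bscore n \<omega> / sqrt (real n))) * inverse (?q n \<omega>))
     + 2 * th_star_last * ((bscore n \<omega> / sqrt (real n) - ?Us n \<omega> / sqrt (real n)) * inverse (?q n \<omega>))
     + 2 * th_star_last * ((?Us n \<omega> / sqrt (real n)) * (inverse (?q n \<omega>) - inverse (alph * v)))
     + (dw_rem n \<omega> / sqrt (real n)) * inverse (?q n \<omega>))"
    by (intro op_add op_cmult op_mult_Op[OF op_mult_Op[OF tl_op bscore_Op] inv_Op] op_mult_Op[OF U_diff inv_Op]
        Op_mult_op[OF Us_Op inv] op_mult_Op[OF div_sqrt_Op[OF dw_rem_Op] inv_Op])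
  show ?thesis
  proof (rule op_off_zero[OF rss_lln av rest, where N=1])
    \<comment> \<open>The algebra divides by \<open>rss\<close>, which is legitimate only off its
      zeros; \<open>op_off_zero\<close> takes care of the rest.\<close>
    fix n :: nat and \<omega> assume n: "n \<ge> 1" and q: "?q n \<omega> \<noteq> 0"
    define s where "s = sqrt (real n)"
    have s: "s \<noteq> 0" and ss: "real n = s * s" using n by (auto simp: s_def)
    have Q: "rss n \<omega> \<noteq> 0" using q by auto
    have iq: "inverse (?q n \<omega>) = s * s * inverse (rss n \<omega>)" unfolding ss using s Q by (simp add: field_simps)
    have D: "dw_stat n \<omega> - 2 * (1 - c * th_star_last) = - 2 * c * (th_last n \<omega> - th_star_last) + (2 * th_last n \<omega> * bscore n \<omega> + dw_rem n \<omega>) * inverse (rss n \<omega>)"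
      unfolding dw_stat_def dw_stat_num using Q by (simp add: field_simps)
    have uu: "u (p - 1) n \<omega> = s * (th_last n \<omega> - th_star_last)" by (simp add: u_def th_star_last_def s_def)
    \<comment> \<open>The limits are inserted one factor at a time, as in the expansion of a
      difference of products; here \<open>i\<close> stands for the inverse of \<open>rss\<close>,
      \<open>a\<close> for the limit of \<open>rss\<close> / n and \<open>Z\<close> for the
      remainder.\<close>
    have alg: "s * (- 2 * k * (t - t') + (2 * t * W + Z) * i) - (- 2 * k * (s * (t - t')) + 2 * t' / a * (W' / s)) =
       2 * (((t - t') * (W / s)) * (s * s * i)) + 2 * t' * ((W / s - W' / s) * (s * s * i))
       + 2 * t' * ((W' / s) * (s * s * i - inverse a)) + (Z / s) * (s * s * i)" for k t t' W W' Z i a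
      using s by (simp add: field_simps)
    show "sqrt (real n) * (dw_stat n \<omega> - 2 * (1 - c * th_star_last)) - (- 2 * c * u (p - 1) n \<omega> + 2 * th_star_last / (alph * v) * (?Us n \<omega> / sqrt (real n))) =
      2 * (((th_last n \<omega> - th_star_last) * (bscore n \<omega> / sqrt (real n))) * inverse (?q n \<omega>))
     + 2 * th_star_last * ((bscore n \<omega> / sqrt (real n) - ?Us n \<omega> / sqrt (real n)) * inverse (?q n \<omega>))
     + 2 * th_star_last * ((?Us n \<omega> / sqrt (real n)) * (inverse (?q n \<omega>) - inverse (alph * v)))
     + (dw_rem n \<omega> / sqrt (real n)) * inverse (?q n \<omega>)"
      unfolding D uu iq s_def[symmetric] by (rule alg)
  qed
qed

end

section \<open>Normal equations and measurability for the concrete estimator\<close>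

lemma borel_measurable_det:
  fixes A :: "'a \<Rightarrow> real mat"
  assumes c: "\<And>\<omega>. A \<omega> \<in> carrier_mat m m"
    and e: "\<And>i j. i < m \<Longrightarrow> j < m \<Longrightarrow> (\<lambda>\<omega>. A \<omega> $$ (i, j)) \<in> borel_measurable M"
  shows "(\<lambda>\<omega>. Determinant.det (A \<omega>)) \<in> borel_measurable M"
proof -
  have "(\<lambda>\<omega>. Determinant.det (A \<omega>)) = (\<lambda>\<omega>. \<Sum>\<pi>\<in>{\<pi>. \<pi> permutes {0..<m}}. signof \<pi> * (\<Prod>i=0..<m. A \<omega> $$ (i, \<pi> i)))"
    by (intro ext det_def' c)
  also have "\<dots> \<in> borel_measurable M"
    by (intro borel_measurable_sum borel_measurable_times borel_measurable_const borel_measurable_prod e)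
       (auto dest: permutes_in_image)
  finally show ?thesis .
qed

lemma borel_measurable_mat_inv:
  fixes A :: "'a \<Rightarrow> real mat"
  assumes c: "\<And>\<omega>. A \<omega> \<in> carrier_mat m m"
    and e: "\<And>i j. i < m \<Longrightarrow> j < m \<Longrightarrow> (\<lambda>\<omega>. A \<omega> $$ (i, j)) \<in> borel_measurable M"
    and det: "\<And>\<omega>. Determinant.det (A \<omega>) \<noteq> 0"
    and ij: "i < m" "j < m"
  shows "(\<lambda>\<omega>. mat_inv (A \<omega>) $$ (i, j)) \<in> borel_measurable M"
proof -
  have dims: "dim_row (A \<omega>) = m" "dim_col (A \<omega>) = m" for \<omega> using c[of \<omega>] by auto
  have eq: "mat_inv (A \<omega>) $$ (i, j) = 1 / Determinant.det (A \<omega>) * ((-1) ^ (j + i) * Determinant.det (mat_delete (A \<omega>) j i))" for \<omega>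
    unfolding mat_inv_nonsingular(4)[OF c det] using ij dims
    by (simp add: adj_mat_def cofactor_def)
  have d1: "(\<lambda>\<omega>. Determinant.det (A \<omega>)) \<in> borel_measurable M"
    by (rule borel_measurable_det[OF c e])
  have d2: "(\<lambda>\<omega>. Determinant.det (mat_delete (A \<omega>) j i)) \<in> borel_measurable M"
  proof (rule borel_measurable_det[where m="m-1"])
    show "mat_delete (A \<omega>) j i \<in> carrier_mat (m - 1) (m - 1)" for \<omega>
      using c by (rule mat_delete_carrier)
    fix k l assume kl: "k < m - 1" "l < m - 1"
    then have "(\<lambda>\<omega>. mat_delete (A \<omega>) j i $$ (k, l)) =
        (\<lambda>\<omega>. A \<omega> $$ (if k < j then k else Suc k, if l < i then l else Suc l))"
      by (simp add: mat_delete_def dims)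
    moreover have "(\<lambda>\<omega>. A \<omega> $$ (if k < j then k else Suc k, if l < i then l else Suc l)) \<in> borel_measurable M"
      using kl by (intro e) auto
    ultimately show "(\<lambda>\<omega>. mat_delete (A \<omega>) j i $$ (k, l)) \<in> borel_measurable M" by simp
  qed
  show ?thesis unfolding eq using d1 d2 by measurable
qed

lemma S_mat_carrier: "S \<in> carrier_mat p p \<Longrightarrow> S_mat p S X n \<in> carrier_mat p p"
  by (simp add: S_mat_def)

lemma S_mat_nth:
  assumes "S \<in> carrier_mat p p" "i < p" "j < p"
  shows "S_mat p S X n $$ (i, j) = (\<Sum>k=0..n. X (int k - int i) * X (int k - int j)) + S $$ (i, j)"
  using assms by (simp add: S_mat_def Phi_def)

text \<open>The quadratic form is a sum of squares plus that of S. Hence S makes the matrix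
  invertible on every trajectory, and the estimator never depends on the value of
  \<open>mat_inv\<close> at a singular matrix.\<close>

lemma S_mat_det:
  assumes S: "sym_pos_def p S"
  shows "Determinant.det (S_mat p S X n) \<noteq> 0"
proof (rule pos_def_det_nonzero)
  have Sc: "S \<in> carrier_mat p p" using S by (simp add: sym_pos_def_def)
  show c: "S_mat p S X n \<in> carrier_mat p p" by (rule S_mat_carrier[OF Sc])
  fix y :: "real vec" assume y: "y \<in> carrier_vec p" "y \<noteq> 0\<^sub>v p"
  have "y \<bullet> (S_mat p S X n *\<^sub>v y) = (\<Sum>i<p. \<Sum>j<p. y $ i * y $ j * ((\<Sum>k=0..n. X (int k - int i) * X (int k - int j)) + S $$ (i, j)))"
    unfolding quad_form_sum[OF c y(1)] by (intro sum.cong refl) (simp add: S_mat_nth[OF Sc])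
  also have "\<dots> = (\<Sum>i<p. \<Sum>j<p. \<Sum>k=0..n. (y $ i * X (int k - int i)) * (y $ j * X (int k - int j))) + y \<bullet> (S *\<^sub>v y)"
    unfolding quad_form_sum[OF Sc y(1)] sum.distrib[symmetric]
    by (intro sum.cong refl) (simp add: distrib_left sum_distrib_left mult_ac)
  also have "(\<Sum>i<p. \<Sum>j<p. \<Sum>k=0..n. (y $ i * X (int k - int i)) * (y $ j * X (int k - int j))) =
      (\<Sum>i<p. \<Sum>k=0..n. \<Sum>j<p. (y $ i * X (int k - int i)) * (y $ j * X (int k - int j)))"
    by (intro sum.cong refl sum.swap)
  also have "\<dots> = (\<Sum>k=0..n. \<Sum>i<p. \<Sum>j<p. (y $ i * X (int k - int i)) * (y $ j * X (int k - int j)))"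
    by (rule sum.swap)
  also have "\<dots> = (\<Sum>k=0..n. (\<Sum>i<p. y $ i * X (int k - int i))\<^sup>2)"
    by (simp only: power2_eq_square sum_product)
  finally have "y \<bullet> (S_mat p S X n *\<^sub>v y) = (\<Sum>k=0..n. (\<Sum>i<p. y $ i * X (int k - int i))\<^sup>2) + y \<bullet> (S *\<^sub>v y)" .
  moreover have "(\<Sum>k=0..n. (\<Sum>i<p. y $ i * X (int k - int i))\<^sup>2) \<ge> 0" by (intro sum_nonneg) auto
  moreover have "0 < y \<bullet> (S *\<^sub>v y)" using S y by (simp add: sym_pos_def_def)
  ultimately show "0 < y \<bullet> (S_mat p S X n *\<^sub>v y)" by linarith
qed

lemma theta_hat_nth:
  assumes S: "sym_pos_def p S" and i: "i < p"
  shows "theta_hat p S X n $ i = (\<Sum>j<p. mat_inv (S_mat p S X (n - 1)) $$ (i, j) * (\<Sum>k=1..n. X (int k - 1 - int j) * X (int k)))"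
proof -
  have c: "mat_inv (S_mat p S X (n - 1)) \<in> carrier_mat p p"
    using S S_mat_det[OF S] by (intro mat_inv_nonsingular(1) S_mat_carrier) (auto simp: sym_pos_def_def)
  show ?thesis
    unfolding theta_hat_def by (subst mult_mat_vec_nth[OF c _ i]) (auto simp: Phi_def)
qed

lemma theta_hat_dim:
  assumes S: "sym_pos_def p S"
  shows "theta_hat p S X n \<in> carrier_vec p"
proof -
  have c: "mat_inv (S_mat p S X (n - 1)) \<in> carrier_mat p p"
    using S S_mat_det[OF S] by (intro mat_inv_nonsingular(1) S_mat_carrier) (auto simp: sym_pos_def_def)
  show ?thesis unfolding theta_hat_def by (rule mult_mat_vec_carrier[OF c]) simp
qed

lemma theta_hat_normal:
  assumes S: "sym_pos_def p S" and i: "i < p"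
  shows "(\<Sum>j<p. S_mat p S X (n - 1) $$ (i, j) * theta_hat p S X n $ j) = (\<Sum>k=1..n. X (int k - 1 - int i) * X (int k))"
proof -
  let ?A = "S_mat p S X (n - 1)"
  let ?G = "vec p (\<lambda>i. \<Sum>k=1..n. Phi p X (int k - 1) $ i * X (int k))"
  have A: "?A \<in> carrier_mat p p" using S by (intro S_mat_carrier) (simp add: sym_pos_def_def)
  note inv = mat_inv_nonsingular[OF A S_mat_det[OF S]]
  have G: "?G \<in> carrier_vec p" by simp
  have "(\<Sum>j<p. ?A $$ (i, j) * theta_hat p S X n $ j) = (?A *\<^sub>v theta_hat p S X n) $ i"
    by (rule mult_mat_vec_nth[OF A theta_hat_dim[OF S] i, symmetric])
  also have "?A *\<^sub>v theta_hat p S X n = (?A * mat_inv ?A) *\<^sub>v ?G"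
    unfolding theta_hat_def by (rule assoc_mult_mat_vec[OF A inv(1) G, symmetric])
  also have "\<dots> = ?G" unfolding inv(2) using G by simp
  also have "?G $ i = (\<Sum>k=1..n. X (int k - 1 - int i) * X (int k))" using i by (simp add: Phi_def)
  finally show ?thesis .
qed

lemma residual_eq:
  assumes S: "sym_pos_def p S" and k: "k \<ge> 1"
  shows "residual p S X n k = X (int k) - (\<Sum>j<p. theta_hat p S X n $ j * X (int k - 1 - int j))"
  using k by (simp add: residual_def scalar_prod_def Phi_def lessThan_atLeast0)

lemma borel_measurable_durbin_watson:
  fixes X :: "int \<Rightarrow> 'a \<Rightarrow> real"
  assumes S: "sym_pos_def p S" and X: "\<And>t. X t \<in> borel_measurable M"
  shows "(\<lambda>\<omega>. durbin_watson p S (\<lambda>t. X t \<omega>) n) \<in> borel_measurable M"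
proof -
  note X [measurable]
  have Sc: "S \<in> carrier_mat p p" using S by (simp add: sym_pos_def_def)
  have "(\<lambda>\<omega>. mat_inv (S_mat p S (\<lambda>t. X t \<omega>) (n - 1)) $$ (i, j)) \<in> borel_measurable M" if "i < p" "j < p" for i j
  proof (rule borel_measurable_mat_inv[OF S_mat_carrier[OF Sc] _ S_mat_det[OF S] that])
    fix i j assume ij: "i < p" "j < p"
    show "(\<lambda>\<omega>. S_mat p S (\<lambda>t. X t \<omega>) (n - 1) $$ (i, j)) \<in> borel_measurable M"
      unfolding S_mat_nth[OF Sc ij] by measurable
  qed
  then have th: "(\<lambda>\<omega>. theta_hat p S (\<lambda>t. X t \<omega>) n $ i) \<in> borel_measurable M" if "i < p" for i
    unfolding theta_hat_nth[OF S that]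
    by (intro borel_measurable_sum borel_measurable_times) (use that in auto)
  have r: "(\<lambda>\<omega>. residual p S (\<lambda>t. X t \<omega>) n k) \<in> borel_measurable M" for k
  proof (cases "k = 0")
    case False
    then have "(\<lambda>\<omega>. residual p S (\<lambda>t. X t \<omega>) n k) =
        (\<lambda>\<omega>. X (int k) \<omega> - (\<Sum>j<p. theta_hat p S (\<lambda>t. X t \<omega>) n $ j * X (int k - 1 - int j) \<omega>))"
      by (simp add: residual_eq[OF S])
    also have "\<dots> \<in> borel_measurable M"
      by (intro borel_measurable_diff borel_measurable_sum borel_measurable_times X th) auto
    finally show ?thesis .
  qed (simp add: residual_def X)
  show ?thesis unfolding durbin_watson_def using r by measurable
qed

text \<open>Bridges the given process and the explicit solution \<open>x\<close>, which are known to
  agree only from time - p on; the regressors at times k \<ge> 0 reach back no further than 1 -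
  p.\<close>

lemma durbin_watson_cong:
  assumes eq: "\<And>t. t \<ge> - int p \<Longrightarrow> X t = X' t"
  shows "durbin_watson p S X n = durbin_watson p S X' n"
proof -
  have Phi: "Phi p X k = Phi p X' k" if "k \<ge> 0" for k
    using that by (auto simp: Phi_def intro!: eq_vecI eq)
  have "S_mat p S X m = S_mat p S X' m" for m
    unfolding S_mat_def by (intro arg_cong2[where f="(+)"] cong_mat) (auto simp: Phi)
  then have "theta_hat p S X n = theta_hat p S X' n"
    unfolding theta_hat_def
    by (intro arg_cong2[where f="(*\<^sub>v)"] arg_cong[where f=mat_inv] eq_vecI) (auto simp: Phi eq)
  then have "residual p S X n k = residual p S X' n k" for k
    by (cases "k = 0") (auto simp: residual_def Phi eq)
  then show ?thesis by (simp add: durbin_watson_def)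
qed

section \<open>The limiting linear form and the convergence in distribution\<close>

context least_squares
begin

text \<open>By \<open>Delta_inv_last\<close> this is the last column of the inverse of
  \<open>Delta\<close>; by symmetry it also serves as the row that isolates the last component of
  the estimator.\<close>

abbreviation "y i \<equiv> mat_inv (Delta p \<theta> \<rho>) $$ (p - 1 - i, 0)"

text \<open>The origin of \<open>P_L\<close>: its part with the inverse of \<open>Delta\<close>
  comes from the error of the last component, its part with \<beta> from the backward score. The
  factor (I_p - c J_p) reflects the pairing of mirrored scores in \<open>nscore\<close> and, applied
  to \<beta>, gives \<open>theta_star\<close> divided by \<open>alph\<close>.\<close>

lemma linear_form:
  "- 2 * c * ((1 / v) * (\<Sum>i<p. y i * nscore_scaled i n \<omega>))
     + 2 * th_star_last / (alph * v) * ((score (Suc p) n \<omega> - (\<Sum>j<p. th_star (p - 1 - j) * score (Suc j) n \<omega>)) / sqrt (real n))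
   = (\<Sum>d<p+1. (- 2 / v * limit_coeff d) * score (Suc d) n \<omega>) / sqrt (real n)"
proof -
  define s where "s = sqrt (real n)"
  define A where "A = (\<Sum>d<p. y d * score (Suc d) n \<omega>)"
  define B where "B = (\<Sum>d<p. y (p - 1 - d) * score (Suc d) n \<omega>)"
  define T where "T = (\<Sum>d<p. th_star (p - 1 - d) * score (Suc d) n \<omega>)"
  define N where "N = score (Suc p) n \<omega>"
  have "(\<Sum>i<p. y i * score (p - i) n \<omega>) = (\<Sum>i<p. y (p - 1 - (p - 1 - i)) * score (Suc (p - 1 - i)) n \<omega>)"
    by (intro sum.cong refl) (auto simp: Suc_diff_Suc)
  also have "\<dots> = B" unfolding B_def by (rule sum_rev_index)
  finally have B: "(\<Sum>i<p. y i * score (p - i) n \<omega>) = B" .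
  have "(\<Sum>i<p. y i * nscore_scaled i n \<omega>) = (\<Sum>i<p. (alph / s) * (y i * score (Suc i) n \<omega>) - (alph * c / s) * (y i * score (p - i) n \<omega>))"
    unfolding nscore_scaled_def nscore_def s_def[symmetric] by (intro sum.cong refl) (simp add: algebra_simps diff_divide_distrib)
  also have "\<dots> = (alph / s) * A - (alph * c / s) * B"
    unfolding sum_subtractf sum_distrib_left[symmetric] B A_def ..
  finally have 1: "(\<Sum>i<p. y i * nscore_scaled i n \<omega>) = (alph / s) * A - (alph * c / s) * B" .
  have limit_coeff: "limit_coeff d = alph * c * y d - alph * c * c * y (p - 1 - d) + th_star_last / alph * th_star (p - 1 - d)" if d: "d < p" for d
  proof -
    have dd: "p - 1 - (p - 1 - d) = d" using d by auto
    have "b (p - 1 - d) - c * b d = th_star (p - 1 - d) / alph"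
      unfolding th_star_def dd using alph_pos by simp
    moreover have "limit_coeff d = alph * c * (y d - c * y (p - 1 - d)) + th_star_last * (b (p - 1 - d) - c * b d)"
      unfolding limit_coeff_def P_L_nth[OF d] PL_arg_def th_star_last_def dd using d by (simp add: algebra_simps)
    ultimately show ?thesis by (simp add: algebra_simps)
  qed
  have "(\<Sum>d<p. limit_coeff d * score (Suc d) n \<omega>) = (\<Sum>d<p. (alph * c) * (y d * score (Suc d) n \<omega>) - (alph * c * c) * (y (p - 1 - d) * score (Suc d) n \<omega>)
      + th_star_last / alph * (th_star (p - 1 - d) * score (Suc d) n \<omega>))"
  proof (intro sum.cong refl)
    fix d assume "d \<in> {..<p}"
    then have "d < p" by simp
    show "limit_coeff d * score (Suc d) n \<omega> = (alph * c) * (y d * score (Suc d) n \<omega>) - (alph * c * c) * (y (p - 1 - d) * score (Suc d) n \<omega>)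
      + th_star_last / alph * (th_star (p - 1 - d) * score (Suc d) n \<omega>)"
      unfolding limit_coeff[OF \<open>d < p\<close>] by (simp only: distrib_right left_diff_distrib mult.assoc)
  qed
  also have "\<dots> = alph * c * A - alph * c * c * B + th_star_last / alph * T"
    unfolding sum.distrib sum_subtractf sum_distrib_left[symmetric] A_def B_def T_def ..
  finally have 2: "(\<Sum>d<p. limit_coeff d * score (Suc d) n \<omega>) = alph * c * A - alph * c * c * B + th_star_last / alph * T" .
  have "limit_coeff p = - (th_star_last / alph)" by (simp add: limit_coeff_def th_star_last_def field_simps)
  then have "(\<Sum>d<p+1. (- 2 / v * limit_coeff d) * score (Suc d) n \<omega>) = - 2 / v * ((\<Sum>d<p. limit_coeff d * score (Suc d) n \<omega>) - th_star_last / alph * N)"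
    unfolding N_def by (simp add: right_diff_distrib sum_distrib_left mult.assoc)
  then have 3: "(\<Sum>d<p+1. (- 2 / v * limit_coeff d) * score (Suc d) n \<omega>) = - 2 / v * (alph * c * A - alph * c * c * B + th_star_last / alph * T - th_star_last / alph * N)"
    unfolding 2 .
  \<comment> \<open>For n = 0 both sides consist of divisions by zero and equal 0.\<close>
  have alg: "- 2 * k * ((1 / v) * ((q / s) * A - (q * k / s) * B)) + 2 * l / (q * v) * ((N - T) / s)
     = (- 2 / v * (q * k * A - q * k * k * B + l / q * T - l / q * N)) / s" if "q \<noteq> 0" for k q l
  proof (cases "s = 0")
    case False
    then show ?thesis using that v_pos by (simp add: field_simps)
  qed simp
  show ?thesis
    unfolding 1 3 T_def[symmetric] N_def[symmetric] s_def[symmetric] using alph_pos by (intro alg) simp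
qed

lemma dw_stat_char:
  assumes meas: "\<And>n. (\<lambda>\<omega>. dw_stat n \<omega>) \<in> borel_measurable M"
  shows "(\<lambda>n. expectation (\<lambda>\<omega>. iexp (t * (sqrt (real n) * (dw_stat n \<omega> - D_star p \<theta> \<rho>)))))
    \<longlonglongrightarrow> complex_of_real (exp (- (t\<^sup>2 * sigma2_D p \<theta> \<rho> / 2)))"
proof -
  let ?g = "\<lambda>d. - 2 / v * limit_coeff d"
  \<comment> \<open>One factor \<open>v\<close> is the variance of the next innovation, the other
    the scale of the autocovariances; the square of -2 / v cancels both and leaves the 4 of
    \<open>sigma2_D\<close>.\<close>
  have quad: "v * (v * quad (p+1) ?g) = sigma2_D p \<theta> \<rho>"
  proof -
    have "quad (p+1) ?g = (\<Sum>d<p+1. \<Sum>e<p+1. 4 / v\<^sup>2 * (limit_coeff d * limit_coeff e * gam (int d - int e)))"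
      unfolding quad_def by (intro sum.cong refl) (simp add: power2_eq_square)
    also have "\<dots> = 4 / v\<^sup>2 * sigma2_rho p \<theta> \<rho>"
      unfolding sigma2_rho_eq sum_distrib_left ..
    finally show ?thesis using v_pos by (simp add: sigma2_D_def power2_eq_square)
  qed
  have lim: "(\<lambda>n. expectation (\<lambda>\<omega>. iexp (t * ((\<Sum>d<p+1. ?g d * score (Suc d) n \<omega>) / sqrt (real n)))))
    \<longlonglongrightarrow> complex_of_real (exp (- (t\<^sup>2 * sigma2_D p \<theta> \<rho> / 2)))"
    using linear_clt_char[of t ?g] unfolding quad[symmetric] by (simp only: mult.assoc)
  have u: "op (\<lambda>n \<omega>. - 2 * c * (u (p - 1) n \<omega> - (1 / v) * (\<Sum>i<p. y i * nscore_scaled i n \<omega>)))"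
    using p by (intro op_cmult u_linear Delta_inv_last) auto
  have score_meas: "score d n \<in> borel_measurable M" for d n
    unfolding score_def by (intro borel_measurable_sum borel_measurable_times x_meas V_meas) auto
  show ?thesis
  proof (rule op_char_diff[OF _ _ _ lim, where N=0])
    show "(\<lambda>\<omega>. (\<Sum>d<p+1. ?g d * score (Suc d) n \<omega>) / sqrt (real n)) \<in> borel_measurable M" for n
      by (intro borel_measurable_divide borel_measurable_sum borel_measurable_times borel_measurable_const score_meas)
    show "(\<lambda>\<omega>. sqrt (real n) * (dw_stat n \<omega> - D_star p \<theta> \<rho>)) \<in> borel_measurable M" for n
      using meas by measurable
    show "op (\<lambda>n \<omega>. (\<Sum>d<p+1. ?g d * score (Suc d) n \<omega>) / sqrt (real n) - sqrt (real n) * (dw_stat n \<omega> - D_star p \<theta> \<rho>))"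
    proof (rule op_eq[OF op_uminus[OF op_add[OF dw_stat_expansion u]], where N=0])
      fix n \<omega>
      have "X' - Y' = - ((Y' - (k * U' + W')) + k * (U' - L))" if "k * L + W' = X'" for X' Y' k U' W' L :: real
        using that by (simp add: algebra_simps)
      from this[OF linear_form]
      show "(\<Sum>d<p+1. ?g d * score (Suc d) n \<omega>) / sqrt (real n) - sqrt (real n) * (dw_stat n \<omega> - D_star p \<theta> \<rho>) =
        - ((sqrt (real n) * (dw_stat n \<omega> - 2 * (1 - c * th_star_last)) - (- 2 * c * u (p - 1) n \<omega> + 2 * th_star_last / (alph * v) * ((score (Suc p) n \<omega> - (\<Sum>j<p. th_star (p - 1 - j) * score (Suc j) n \<omega>)) / sqrt (real n))))
         + - 2 * c * (u (p - 1) n \<omega> - (1 / v) * (\<Sum>i<p. y i * nscore_scaled i n \<omega>)))"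
        unfolding D_star_eq th_star_last_def[symmetric] by blast
    qed
  qed
qed

end

locale dw_model = dw_process p \<theta> \<rho> M V v U
  for p \<theta> \<rho> and M :: "'a measure" and V v U +
  fixes S :: "real mat"
  assumes S: "sym_pos_def p S"
begin

sublocale least_squares p \<theta> \<rho> M V v U "\<lambda>i j. S $$ (i, j)" "\<lambda>j n \<omega>. theta_hat p S (\<lambda>t. x t \<omega>) n $ j"
proof
  fix n :: nat and \<omega> i assume n: "n \<ge> 1" and i: "i < p"
  have Sc: "S \<in> carrier_mat p p" using S by (simp add: sym_pos_def_def)
  have "{0..n-1} = {..<n}" using n by auto
  then have "lag_prod (Suc i) (Suc j) n \<omega> + S $$ (i, j) = S_mat p S (\<lambda>t. x t \<omega>) (n - 1) $$ (i, j)" if "j < p" for j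
    unfolding S_mat_nth[OF Sc i that] lag_prod_Suc by simp
  then have "(\<Sum>j<p. (lag_prod (Suc i) (Suc j) n \<omega> + S $$ (i, j)) * theta_hat p S (\<lambda>t. x t \<omega>) n $ j) =
      (\<Sum>j<p. S_mat p S (\<lambda>t. x t \<omega>) (n - 1) $$ (i, j) * theta_hat p S (\<lambda>t. x t \<omega>) n $ j)"
    by (intro sum.cong refl) simp
  also have "\<dots> = (\<Sum>k=1..n. x (int k - 1 - int i) \<omega> * x (int k) \<omega>)"
    by (rule theta_hat_normal[OF S i])
  also have "\<dots> = lag_prod (Suc i) 0 n \<omega>"
    unfolding lag_prod_def by (simp add: diff_diff_eq)
  finally show "(\<Sum>j<p. (lag_prod (Suc i) (Suc j) n \<omega> + S $$ (i, j)) * theta_hat p S (\<lambda>t. x t \<omega>) n $ j) = lag_prod (Suc i) 0 n \<omega>" .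
qed

lemma durbin_watson_eq: "durbin_watson p S (\<lambda>t. x t \<omega>) n = dw_stat n \<omega>"
proof -
  have "residual p S (\<lambda>t. x t \<omega>) n k = res n k \<omega>" for k
  proof (cases "k = 0")
    case True
    then show ?thesis by (simp add: residual_def res_0 x_0)
  next
    case False
    then show ?thesis by (simp add: residual_eq[OF S] res_def)
  qed
  then show ?thesis by (simp add: durbin_watson_def dw_stat_def rss_def)
qed

lemma sigma2_D_nonneg: "sigma2_D p \<theta> \<rho> \<ge> 0"
  using quad_nonneg[of "p+1" limit_coeff] unfolding sigma2_D_def sigma2_rho_eq quad_def by simp

lemma durbin_watson_clt:
  "weak_conv_m (\<lambda>n. distr M borel (\<lambda>\<omega>. sqrt (real n) * (durbin_watson p S (\<lambda>t. x t \<omega>) n - D_star p \<theta> \<rho>)))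
    (normal_law 0 (sigma2_D p \<theta> \<rho>))"
proof (rule levy_continuity)
  have dw_stat_meas: "(\<lambda>\<omega>. dw_stat n \<omega>) \<in> borel_measurable M" for n
    using borel_measurable_durbin_watson[OF S, of x M n] x_meas unfolding durbin_watson_eq by blast
  then have meas: "(\<lambda>\<omega>. sqrt (real n) * (durbin_watson p S (\<lambda>t. x t \<omega>) n - D_star p \<theta> \<rho>)) \<in> borel_measurable M" for n
    unfolding durbin_watson_eq by measurable
  show "real_distribution (distr M borel (\<lambda>\<omega>. sqrt (real n) * (durbin_watson p S (\<lambda>t. x t \<omega>) n - D_star p \<theta> \<rho>)))" for n
    by (rule real_distribution_distr[OF meas])
  show "real_distribution (normal_law 0 (sigma2_D p \<theta> \<rho>))"
    by (rule normal_law_char(1)[OF sigma2_D_nonneg])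
  fix t
  have "char (distr M borel (\<lambda>\<omega>. sqrt (real n) * (durbin_watson p S (\<lambda>t. x t \<omega>) n - D_star p \<theta> \<rho>))) t =
      expectation (\<lambda>\<omega>. iexp (t * (sqrt (real n) * (dw_stat n \<omega> - D_star p \<theta> \<rho>))))" for n
    unfolding char_def by (subst integral_distr[OF meas]) (simp_all add: durbin_watson_eq)
  then show "(\<lambda>n. char (distr M borel (\<lambda>\<omega>. sqrt (real n) * (durbin_watson p S (\<lambda>t. x t \<omega>) n - D_star p \<theta> \<rho>))) t)
      \<longlonglongrightarrow> char (normal_law 0 (sigma2_D p \<theta> \<rho>)) t"
    unfolding normal_law_char(2)[OF sigma2_D_nonneg] using dw_stat_char[OF dw_stat_meas, of t] by simp
qed

end

theorem theorem4p2:
  fixes M :: "'a measure"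
    and p :: nat
    and \<theta> :: "real vec"
    and \<rho> \<sigma> :: real
    and S :: "real mat"
    and V \<epsilon> :: "nat \<Rightarrow> 'a \<Rightarrow> real"
    and X :: "int \<Rightarrow> 'a \<Rightarrow> real"
  assumes M: "prob_space M"
    and p: "p \<ge> 1"
    and \<theta>: "\<theta> \<in> carrier_vec p" "\<theta> \<noteq> 0\<^sub>v p" "(\<Sum>i=1..p. \<bar>\<theta> $ (i - 1)\<bar>) < 1"
    and \<rho>: "\<bar>\<rho>\<bar> < 1"
    and S: "sym_pos_def p S"
    and V_indep: "prob_space.indep_vars M (\<lambda>_. borel) V {1..}"
    and V_ident: "\<forall>n\<ge>1. distr M borel (V n) = distr M borel (V 1)"
    and V_square: "\<forall>n\<ge>1. integrable M (\<lambda>\<omega>. (V n \<omega>)\<^sup>2)"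
    and V_mean: "\<forall>n\<ge>1. prob_space.expectation M (V n) = 0"
    and V_var: "\<forall>n\<ge>1. prob_space.variance M (V n) = \<sigma>\<^sup>2"
    and \<sigma>: "\<sigma> > 0"
    and V_fourth: "\<forall>n\<ge>1. integrable M (\<lambda>\<omega>. V n \<omega> ^ 4)"
    and X0: "X 0 \<in> borel_measurable M" "integrable M (\<lambda>\<omega>. (X 0 \<omega>)\<^sup>2)"
    and init: "\<forall>\<omega>\<in>space M. X 0 \<omega> = \<epsilon> 0 \<omega>"
    and init_neg: "\<forall>i\<in>{1..p}. \<forall>\<omega>\<in>space M. X (- int i) \<omega> = 0"
    and X_rec: "\<forall>n\<ge>1. \<forall>\<omega>\<in>space M.
        X (int n) \<omega> = (\<Sum>i=1..p. \<theta> $ (i - 1) * X (int n - int i) \<omega>) + \<epsilon> n \<omega>"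
    and \<epsilon>_rec: "\<forall>n\<ge>1. \<forall>\<omega>\<in>space M. \<epsilon> n \<omega> = \<rho> * \<epsilon> (n - 1) \<omega> + V n \<omega>"
  shows "weak_conv_m
    (\<lambda>n. distr M borel
       (\<lambda>\<omega>. sqrt (real n) * (durbin_watson p S (\<lambda>t. X t \<omega>) n - D_star p \<theta> \<rho>)))
    (normal_law 0 (sigma2_D p \<theta> \<rho>))"
proof -
  interpret prob_space M by (rule M)
  have shift: "(\<Sum>i=1..p. f i) = (\<Sum>i<p. f (Suc i))" for f :: "nat \<Rightarrow> real"
    by (rule sum.reindex_bij_witness[of _ Suc "\<lambda>k. k - 1"]) auto
  interpret dw_params p \<theta> \<rho>
  proof
    show "(\<Sum>i<p. \<bar>\<theta> $ i\<bar>) < 1" using \<theta>(3) unfolding shift by simp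
  qed (fact p \<rho>)+
  interpret innovations M V "\<sigma>\<^sup>2"
  proof
    fix n :: nat assume n: "n \<ge> 1"
    show "distr M borel (V n) = distr M borel (V 1)" using V_ident n by blast
    show "integrable M (\<lambda>\<omega>. (V n \<omega>)\<^sup>2)" using V_square n by blast
    show mean: "expectation (V n) = 0" using V_mean n by blast
    have "variance (V n) = \<sigma>\<^sup>2" using V_var n by blast
    then show "expectation (\<lambda>\<omega>. (V n \<omega>)\<^sup>2) = \<sigma>\<^sup>2" unfolding mean by simp
  qed (fact V_indep)
  interpret dw_model p \<theta> \<rho> M V "\<sigma>\<^sup>2" "X 0" S
  proof
    show "\<sigma>\<^sup>2 > 0" using \<sigma> by simp
    show "integrable M (\<lambda>\<omega>. V n \<omega> ^ 4)" if "n \<ge> 1" for n using V_fourth that by blast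
  qed (fact X0 S)+
  \<comment> \<open>The given process is the explicit solution with U = X 0, since both satisfy the
    recursion of order p + 1 with the same initial values.\<close>
  have X_eq: "X t \<omega> = x t \<omega>" if t: "t \<ge> - int p" and \<omega>: "\<omega> \<in> space M" for t \<omega>
  proof (rule x_unique[of "\<lambda>t. X t \<omega>", OF _ _ _ t])
    have neg: "X m \<omega> = 0" if "m < 0" "m \<ge> - int p" for m
    proof -
      have "nat (- m) \<in> {1..p}" "- int (nat (- m)) = m" using that by auto
      then show ?thesis using init_neg \<omega> by metis
    qed
    then show "X m \<omega> = 0" if "m < 0" "m \<ge> - int p" for m using that by blast
    \<comment> \<open>At k = 0 the regression sum vanishes and X 0 = \<epsilon> 0, so the identity
      extends to k = 0; this makes the combined recursion available already at k = 1.\<close>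
    have e: "X (int k) \<omega> - (\<Sum>i<p. \<theta> $ i * X (int k - 1 - int i) \<omega>) = \<epsilon> k \<omega>" for k
    proof (cases "k = 0")
      case True
      have "(\<Sum>i<p. \<theta> $ i * X (int k - 1 - int i) \<omega>) = 0"
        unfolding True by (intro sum.neutral ballI) (simp add: neg)
      then show ?thesis using True init \<omega> by simp
    next
      case False
      then have "X (int k) \<omega> = (\<Sum>i=1..p. \<theta> $ (i - 1) * X (int k - int i) \<omega>) + \<epsilon> k \<omega>"
        using X_rec \<omega> by simp
      then show ?thesis unfolding shift by (simp add: algebra_simps)
    qed
    fix k :: nat assume k: "k \<ge> 1"
    have k1: "int (k - 1) = int k - 1" "int k - 1 - 1 = int k - 2" using k by auto
    have "(\<Sum>j\<le>p+1. a (int j) * X (int k - int j) \<omega>) = \<epsilon> k \<omega> - \<rho> * \<epsilon> (k - 1) \<omega>"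
      unfolding ar_factor[of "\<lambda>m. X m \<omega>"] e[of k] using e[of "k - 1"] unfolding k1 by simp
    then show "(\<Sum>j\<le>p+1. a (int j) * X (int k - int j) \<omega>) = V k \<omega>"
      using \<epsilon>_rec k \<omega> by simp
  qed auto
  have "distr M borel (\<lambda>\<omega>. sqrt (real n) * (durbin_watson p S (\<lambda>t. X t \<omega>) n - D_star p \<theta> \<rho>)) =
      distr M borel (\<lambda>\<omega>. sqrt (real n) * (durbin_watson p S (\<lambda>t. x t \<omega>) n - D_star p \<theta> \<rho>))" for n
  proof (rule distr_cong[OF refl refl])
    fix \<omega> assume "\<omega> \<in> space M"
    then have "durbin_watson p S (\<lambda>t. X t \<omega>) n = durbin_watson p S (\<lambda>t. x t \<omega>) n"
      by (intro durbin_watson_cong X_eq)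
    then show "sqrt (real n) * (durbin_watson p S (\<lambda>t. X t \<omega>) n - D_star p \<theta> \<rho>) =
        sqrt (real n) * (durbin_watson p S (\<lambda>t. x t \<omega>) n - D_star p \<theta> \<rho>)" by simp
  qed
  then show ?thesis using durbin_watson_clt by simp
qed

end
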